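(* Let $p\in\mathbb{Z}_{\geq 2}$ and let $G=G_{p,p}=\langle x,y\mid x^p=y^p\rangle$. For $g\in G$ let $\iota_g$ denote conjugation $h\mapsto ghg^{-1}$, let $\tau$ be the automorphism with $\tau(x)=x^{-1}$, $\tau(y)=y^{-1}$, and let $\sigma$ be the automorphism with $\sigma(x)=y$, $\sigma(y)=x$. Let $g\in G$. (A) Class $[\sigma]$. 1. If $\iota_g\sigma$ has finite order, then $\mathrm{Fix}(\iota_g\sigma)=\langle x^p\rangle\cong\mathbb{Z}$. 2. If $\iota_g\sigma$ has infinite order, then $\mathrm{Fix}(\iota_g\sigma)=C(g\sigma(g))\cong\mathbb{Z}^2$, the centralizer of $g\sigma(g)$. It is generated by $x^p$ and $\widehat{g\sigma(g)}$, where $\widehat{g\sigma(g)}\in G$ is an element acting hyperbolically on the Bass-Serre tree along the same axis as $g\sigma(g)$ with minimal (non-zero) translation length. (B) Class $[\sigma\tau]$. 1. If $\iota_g\sigma\tau$ has finite order, then $\mathrm{Fix}(\iota_g\sigma\tau)=\{1\}$. 2. If $\iota_g\sigma\tau$ has infinite order, then $\mathrm{Fix}(\iota_g\sigma\tau)=\langle|g\,\sigma\tau(g)|\rangle\cong\mathbb{Z}$.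
   Context: For an automorphism $\varphi$ of a group $G$, $\mathrm{Fix}(\varphi)=\{g\in G\mid\varphi(g)=g\}$, and $[\varphi]$ denotes its class in $\mathrm{Out}(G)$; the class $[\sigma]$ consists of the automorphisms $\iota_g\sigma=\iota_g\circ\sigma$ and $[\sigma\tau]$ of the $\iota_g\sigma\tau=\iota_g\circ\sigma\circ\tau$, $g\in G$. For a non-central $g\in G_{p,p}$, $\langle|g|\rangle$ denotes the maximal cyclic subgroup containing $g$, i.e. the cyclic subgroup of $G_{p,p}$ containing $g$ that contains every cyclic subgroup containing $g$ (this is well defined for non-central elements). The Bass-Serre tree $T$ of $G=G_{p,p}$ has vertices $v_{g\langle x\rangle}$ and $v_{g\langle y\rangle}$ (one for each left coset of $\langle x\rangle$ and of $\langle y\rangle$) and edges $e_{g\langle x^p\rangle}$ (one for each left coset of $\langle x^p\rangle=\langle y^p\rangle$), the edge $e_{g\langle x^p\rangle}$ joining $v_{g\langle x\rangle}$ and $v_{g\langle y\rangle}$; each edge has length $1$, and $G$ acts by left multiplication on cosets. For an isometry $\gamma$ of $T$, its translation length is $l(\gamma)=\inf_{z\in T}d(z,\gamma z)$. It is hyperbolic if $l(\gamma)>0$, in which case the set of points $z$ with $d(z,\gamma z)=l(\gamma)$ is a bi-infinite line (its axis) along which $\gamma$ translates by $l(\gamma)$. *)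

theory Defs
  imports "HOL-Algebra.Algebra" Complex_Main
begin

section \<open>Groups given by a presentation\<close>

text \<open>A letter is a generator tagged \<open>True\<close>, or its formal inverse, tagged \<open>False\<close>.\<close>

type_synonym 'a word = "('a \<times> bool) list"

inductive pres_eq :: "('a word \<times> 'a word) set \<Rightarrow> 'a word \<Rightarrow> 'a word \<Rightarrow> bool" for R where
  pres_refl: "pres_eq R u u"
| pres_sym: "pres_eq R u v \<Longrightarrow> pres_eq R v u"
| pres_trans: "pres_eq R u v \<Longrightarrow> pres_eq R v w \<Longrightarrow> pres_eq R u w"
| pres_cong: "pres_eq R u u' \<Longrightarrow> pres_eq R v v' \<Longrightarrow> pres_eq R (u @ v) (u' @ v')"
| pres_cancel: "pres_eq R [(a, b), (a, \<not> b)] []"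
| pres_rel: "(u, v) \<in> R \<Longrightarrow> pres_eq R u v"

definition pres_class :: "('a word \<times> 'a word) set \<Rightarrow> 'a word \<Rightarrow> 'a word set" where
  "pres_class R w = {v. pres_eq R w v}"

definition presented_group :: "('a word \<times> 'a word) set \<Rightarrow> 'a word set monoid" where
  "presented_group R =
     \<lparr>carrier = range (pres_class R),
      monoid.mult = (\<lambda>A B. \<Union>u\<in>A. \<Union>v\<in>B. pres_class R (u @ v)),
      one = pres_class R []\<rparr>"

text \<open>The map of a presented group induced by the letter substitution \<open>f\<close>
  (all the classes in the union coincide if \<open>f\<close> respects the relations).\<close>

definition letter_hom ::
  "('a word \<times> 'a word) set \<Rightarrow> ('a \<times> bool \<Rightarrow> 'a \<times> bool) \<Rightarrow> 'a word set \<Rightarrow> 'a word set" where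
  "letter_hom R f = (\<lambda>A\<in>carrier (presented_group R). \<Union>w\<in>A. pres_class R (map f w))"

lemma pres_class_eq_iff: "pres_class R u = pres_class R v \<longleftrightarrow> pres_eq R u v"
  unfolding pres_class_def by (metis (mono_tags) Collect_cong mem_Collect_eq pres_refl pres_sym pres_trans)

lemma mult_pres_class:
  "pres_class R u \<otimes>\<^bsub>presented_group R\<^esub> pres_class R v = pres_class R (u @ v)"
proof -
  have "pres_class R (u' @ v') = pres_class R (u @ v)"
    if "u' \<in> pres_class R u" "v' \<in> pres_class R v" for u' v'
    unfolding pres_class_eq_iff using that
    by (intro pres_sym[OF pres_cong]) (simp_all add: pres_class_def)
  then have "(\<Union>u'\<in>pres_class R u. \<Union>v'\<in>pres_class R v. pres_class R (u' @ v')) =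
      (\<Union>u'\<in>pres_class R u. \<Union>v'\<in>pres_class R v. pres_class R (u @ v))"
    by (intro SUP_cong refl)
  also have "\<dots> = pres_class R (u @ v)"
    using pres_refl[of R u] pres_refl[of R v] by (auto simp: pres_class_def)
  finally show ?thesis by (simp add: presented_group_def)
qed

lemma pres_inverse: "pres_eq R (rev (map (\<lambda>(a, b). (a, \<not> b)) w) @ w) []"
proof (induction w)
  case Nil
  then show ?case by (simp add: pres_refl)
next
  case (Cons l w)
  obtain a b where l: "l = (a, b)" by fastforce
  let ?v = "rev (map (\<lambda>(a, b). (a, \<not> b)) w)"
  have "pres_eq R [(a, \<not> b), (a, b)] []"
    using pres_cancel[of R a "\<not> b"] by (simp only: not_not)
  from pres_cong[OF pres_refl[of R ?v] pres_cong[OF this pres_refl[of R w]]]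
  have "pres_eq R (?v @ [(a, \<not> b), (a, b)] @ w) (?v @ w)" by (simp only: append_Nil)
  from pres_trans[OF this Cons.IH] show ?case by (simp add: l)
qed

lemma group_presented_group: "group (presented_group R)"
proof (rule groupI)
  let ?G = "presented_group R"
  have c: "A \<in> carrier ?G \<longleftrightarrow> (\<exists>u. A = pres_class R u)" for A
    by (auto simp: presented_group_def)
  have o: "\<one>\<^bsub>?G\<^esub> = pres_class R []" by (simp add: presented_group_def)
  show "\<one>\<^bsub>?G\<^esub> \<in> carrier ?G" unfolding c o by blast
  fix A assume A: "A \<in> carrier ?G"
  then show "\<one>\<^bsub>?G\<^esub> \<otimes>\<^bsub>?G\<^esub> A = A" by (auto simp: c o mult_pres_class)
  show "\<exists>B\<in>carrier ?G. B \<otimes>\<^bsub>?G\<^esub> A = \<one>\<^bsub>?G\<^esub>"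
    using A pres_inverse unfolding c o Bex_def by (metis mult_pres_class pres_class_eq_iff)
  fix B assume B: "B \<in> carrier ?G"
  then show "A \<otimes>\<^bsub>?G\<^esub> B \<in> carrier ?G" using A by (auto simp: c mult_pres_class)
  fix C assume "C \<in> carrier ?G"
  then show "A \<otimes>\<^bsub>?G\<^esub> B \<otimes>\<^bsub>?G\<^esub> C = A \<otimes>\<^bsub>?G\<^esub> (B \<otimes>\<^bsub>?G\<^esub> C)"
    using A B by (auto simp: c mult_pres_class)
qed

lemma pres_eq_map:
  assumes f: "\<And>a b. f (a, \<not> b) = apsnd Not (f (a, b))"
    and R: "\<And>u v. (u, v) \<in> R \<Longrightarrow> pres_eq R (map f u) (map f v)"
    and "pres_eq R u v"
  shows "pres_eq R (map f u) (map f v)"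
  using assms(3)
proof induction
  case (pres_cancel a b)
  obtain c d where "f (a, b) = (c, d)" by fastforce
  then show ?case using f[of a b] by (simp add: pres_eq.pres_cancel)
next
  case (pres_sym u v)
  show ?case by (rule pres_eq.pres_sym[OF pres_sym.IH])
next
  case (pres_trans u v w)
  show ?case by (rule pres_eq.pres_trans[OF pres_trans.IH])
next
  case (pres_cong u u' v v')
  show ?case unfolding map_append by (rule pres_eq.pres_cong[OF pres_cong.IH])
qed (simp_all add: pres_eq.pres_refl R)

lemma letter_hom_class:
  assumes "\<And>a b. f (a, \<not> b) = apsnd Not (f (a, b))"
    and "\<And>u v. (u, v) \<in> R \<Longrightarrow> pres_eq R (map f u) (map f v)"
  shows "letter_hom R f (pres_class R w) = pres_class R (map f w)"
proof -
  have "pres_class R (map f v) = pres_class R (map f w)" if "v \<in> pres_class R w" for v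
    unfolding pres_class_eq_iff
    using that by (intro pres_sym[OF pres_eq_map[OF assms]]) (simp_all add: pres_class_def)
  then have "(\<Union>v\<in>pres_class R w. pres_class R (map f v)) =
      (\<Union>v\<in>pres_class R w. pres_class R (map f w))"
    by (intro SUP_cong refl)
  also have "\<dots> = pres_class R (map f w)"
    using pres_refl[of R w] by (auto simp: pres_class_def)
  finally show ?thesis by (simp add: letter_hom_def presented_group_def)
qed

lemma letter_hom_auto:
  assumes f: "\<And>a b. f (a, \<not> b) = apsnd Not (f (a, b))"
    and R: "\<And>u v. (u, v) \<in> R \<Longrightarrow> pres_eq R (map f u) (map f v)"
    and inv: "\<And>l. f (f l) = l"
  shows "letter_hom R f \<in> auto (presented_group R)"
proof -
  let ?G = "presented_group R"
  note h = letter_hom_class[OF f R]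
  have c: "A \<in> carrier ?G \<longleftrightarrow> (\<exists>u. A = pres_class R u)" for A
    by (auto simp: presented_group_def)
  have m: "map f (map f w) = w" for w by (simp add: inv map_idI)
  have "letter_hom R f A \<in> carrier ?G \<and> letter_hom R f (letter_hom R f A) = A"
    if "A \<in> carrier ?G" for A
    using that unfolding c by (elim exE) (metis h m)
  then have "bij_betw (letter_hom R f) (carrier ?G) (carrier ?G)"
    by (intro bij_betw_byWitness[where f' = "letter_hom R f"]) auto
  moreover have "letter_hom R f \<in> hom ?G ?G"
    by (rule homI) (auto simp: c h mult_pres_class)
  moreover have "letter_hom R f \<in> extensional (carrier ?G)"
    by (simp add: letter_hom_def)
  ultimately show ?thesis by (simp add: auto_def Bij_def)
qed


section \<open>The group \<open>\<langle>x, y | x^p = y^p\<rangle>\<close>\<close>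

datatype gen = Gen_x | Gen_y

definition Gpp_rels :: "nat \<Rightarrow> (gen word \<times> gen word) set" where
  "Gpp_rels p = {(replicate p (Gen_x, True), replicate p (Gen_y, True))}"

definition Gpp :: "nat \<Rightarrow> gen word set monoid" where
  "Gpp p = presented_group (Gpp_rels p)"

definition gx :: "nat \<Rightarrow> gen word set" where
  "gx p = pres_class (Gpp_rels p) [(Gen_x, True)]"

definition gy :: "nat \<Rightarrow> gen word set" where
  "gy p = pres_class (Gpp_rels p) [(Gen_y, True)]"

fun swap_letter :: "gen \<times> bool \<Rightarrow> gen \<times> bool" where
  "swap_letter (Gen_x, b) = (Gen_y, b)"
| "swap_letter (Gen_y, b) = (Gen_x, b)"

fun invert_letter :: "gen \<times> bool \<Rightarrow> gen \<times> bool" where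
  "invert_letter (a, b) = (a, \<not> b)"

text \<open>Lemmas \<open>sigma_spec\<close> and \<open>tau_spec\<close> below confirm that these are the automorphisms
  with \<open>x \<mapsto> y, y \<mapsto> x\<close> and \<open>x \<mapsto> x\<inverse>, y \<mapsto> y\<inverse>\<close> respectively.\<close>

definition sigma :: "nat \<Rightarrow> gen word set \<Rightarrow> gen word set" where
  "sigma p = letter_hom (Gpp_rels p) swap_letter"

definition tau :: "nat \<Rightarrow> gen word set \<Rightarrow> gen word set" where
  "tau p = letter_hom (Gpp_rels p) invert_letter"

lemma group_Gpp: "group (Gpp p)"
  by (simp add: Gpp_def group_presented_group)

lemma gx_gy_carrier: "gx p \<in> carrier (Gpp p)" "gy p \<in> carrier (Gpp p)"
  by (auto simp: gx_def gy_def Gpp_def presented_group_def)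

lemma pres_class_pow:
  "pres_class R [l] [^]\<^bsub>presented_group R\<^esub> (n::nat) = pres_class R (replicate n l)"
proof (induction n)
  case 0
  show ?case unfolding nat_pow_0 by (simp add: presented_group_def)
next
  case (Suc n)
  show ?case
    unfolding nat_pow_Suc Suc mult_pres_class replicate_append_same by simp
qed

lemma Gpp_relation: "gx p [^]\<^bsub>Gpp p\<^esub> p = gy p [^]\<^bsub>Gpp p\<^esub> p"
  unfolding gx_def gy_def Gpp_def pres_class_pow pres_class_eq_iff
  by (rule pres_rel) (simp add: Gpp_rels_def)

lemma inv_letter_class:
  "inv\<^bsub>presented_group R\<^esub> (pres_class R [(a, True)]) = pres_class R [(a, False)]"
proof -
  interpret group "presented_group R" by (rule group_presented_group)
  show ?thesis
  proof (rule inv_equality)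
    show "pres_class R [(a, False)] \<otimes>\<^bsub>presented_group R\<^esub> pres_class R [(a, True)]
        = \<one>\<^bsub>presented_group R\<^esub>"
      unfolding mult_pres_class using pres_cancel[of R a False]
      by (simp add: presented_group_def pres_class_eq_iff)
  qed (auto simp: presented_group_def)
qed

lemma swap_letter_ok:
  "swap_letter (a, \<not> b) = apsnd Not (swap_letter (a, b))"
  "(u, v) \<in> Gpp_rels p \<Longrightarrow> pres_eq (Gpp_rels p) (map swap_letter u) (map swap_letter v)"
  "swap_letter (swap_letter l) = l"
proof -
  show "swap_letter (a, \<not> b) = apsnd Not (swap_letter (a, b))" by (cases a) auto
  show "swap_letter (swap_letter l) = l" by (cases l rule: swap_letter.cases) auto
  have "pres_eq (Gpp_rels p) (replicate p (Gen_y, True)) (replicate p (Gen_x, True))"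
    by (rule pres_sym, rule pres_rel) (simp add: Gpp_rels_def)
  then show "(u, v) \<in> Gpp_rels p \<Longrightarrow>
      pres_eq (Gpp_rels p) (map swap_letter u) (map swap_letter v)"
    by (auto simp: Gpp_rels_def)
qed

lemma invert_letter_ok:
  "invert_letter (a, \<not> b) = apsnd Not (invert_letter (a, b))"
  "(u, v) \<in> Gpp_rels p \<Longrightarrow> pres_eq (Gpp_rels p) (map invert_letter u) (map invert_letter v)"
  "invert_letter (invert_letter l) = l"
proof -
  show "invert_letter (a, \<not> b) = apsnd Not (invert_letter (a, b))" by simp
  show "invert_letter (invert_letter l) = l" by (cases l) auto
  interpret group "Gpp p" by (rule group_Gpp)
  have "pres_class (Gpp_rels p) (replicate p (a, False))
      = inv\<^bsub>Gpp p\<^esub> (pres_class (Gpp_rels p) [(a, True)] [^]\<^bsub>Gpp p\<^esub> p)" for a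
  proof -
    have "pres_class (Gpp_rels p) [(a, True)] \<in> carrier (Gpp p)"
      by (simp add: Gpp_def presented_group_def)
    then show ?thesis
      unfolding pres_class_pow[symmetric] inv_letter_class[symmetric] Gpp_def[symmetric]
      by (rule nat_pow_inv)
  qed
  then have "pres_eq (Gpp_rels p) (replicate p (Gen_x, False)) (replicate p (Gen_y, False))"
    using Gpp_relation[of p] unfolding pres_class_eq_iff[symmetric] gx_def gy_def by simp
  then show "(u, v) \<in> Gpp_rels p \<Longrightarrow>
      pres_eq (Gpp_rels p) (map invert_letter u) (map invert_letter v)"
    by (auto simp: Gpp_rels_def)
qed

lemma sigma_spec:
  "sigma p \<in> auto (Gpp p)" "sigma p (gx p) = gy p" "sigma p (gy p) = gx p"
  unfolding sigma_def Gpp_def gx_def gy_def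
  by (rule letter_hom_auto[OF swap_letter_ok], assumption)
    (simp_all add: letter_hom_class[OF swap_letter_ok(1,2)])

lemma tau_spec:
  "tau p \<in> auto (Gpp p)"
  "tau p (gx p) = inv\<^bsub>Gpp p\<^esub> gx p" "tau p (gy p) = inv\<^bsub>Gpp p\<^esub> gy p"
  unfolding tau_def Gpp_def gx_def gy_def inv_letter_class
  by (rule letter_hom_auto[OF invert_letter_ok], assumption)
    (simp_all add: letter_hom_class[OF invert_letter_ok(1,2)])


section \<open>Automorphisms, fixed subgroups, centralizers, maximal cyclic subgroups\<close>

definition inner_aut :: "('a, 'b) monoid_scheme \<Rightarrow> 'a \<Rightarrow> 'a \<Rightarrow> 'a" where
  "inner_aut G g = (\<lambda>h\<in>carrier G. g \<otimes>\<^bsub>G\<^esub> h \<otimes>\<^bsub>G\<^esub> inv\<^bsub>G\<^esub> g)"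

definition has_finite_order :: "('a, 'b) monoid_scheme \<Rightarrow> 'a \<Rightarrow> bool" where
  "has_finite_order H a \<longleftrightarrow> (\<exists>n::nat. 0 < n \<and> a [^]\<^bsub>H\<^esub> n = \<one>\<^bsub>H\<^esub>)"

definition Fix :: "('a, 'b) monoid_scheme \<Rightarrow> ('a \<Rightarrow> 'a) \<Rightarrow> 'a set" where
  "Fix G \<phi> = {h \<in> carrier G. \<phi> h = h}"

definition centralizer :: "('a, 'b) monoid_scheme \<Rightarrow> 'a \<Rightarrow> 'a set" where
  "centralizer G a = {h \<in> carrier G. h \<otimes>\<^bsub>G\<^esub> a = a \<otimes>\<^bsub>G\<^esub> h}"

definition center :: "('a, 'b) monoid_scheme \<Rightarrow> 'a set" where
  "center G = {z \<in> carrier G. \<forall>h\<in>carrier G. z \<otimes>\<^bsub>G\<^esub> h = h \<otimes>\<^bsub>G\<^esub> z}"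

definition cyclic_subgroup :: "('a, 'b) monoid_scheme \<Rightarrow> 'a set \<Rightarrow> bool" where
  "cyclic_subgroup G C \<longleftrightarrow> (\<exists>c\<in>carrier G. C = generate G {c})"

text \<open>\<open>C = \<langle>|a|\<rangle>\<close>; such a \<open>C\<close> is unique when it exists.\<close>

definition is_max_cyclic :: "('a, 'b) monoid_scheme \<Rightarrow> 'a \<Rightarrow> 'a set \<Rightarrow> bool" where
  "is_max_cyclic G a C \<longleftrightarrow>
     cyclic_subgroup G C \<and> a \<in> C \<and> (\<forall>D. cyclic_subgroup G D \<and> a \<in> D \<longrightarrow> D \<subseteq> C)"

abbreviation subgroup_iso :: "('a, 'b) monoid_scheme \<Rightarrow> 'a set \<Rightarrow> ('c, 'd) monoid_scheme \<Rightarrow> bool" where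
  "subgroup_iso G H K \<equiv> G\<lparr>carrier := H\<rparr> \<cong> K"


section \<open>The Bass-Serre tree as a metric tree\<close>

abbreviation sub_x :: "nat \<Rightarrow> gen word set set" where
  "sub_x p \<equiv> generate (Gpp p) {gx p}"

abbreviation sub_y :: "nat \<Rightarrow> gen word set set" where
  "sub_y p \<equiv> generate (Gpp p) {gy p}"

abbreviation sub_xp :: "nat \<Rightarrow> gen word set set" where
  "sub_xp p \<equiv> generate (Gpp p) {gx p [^]\<^bsub>Gpp p\<^esub> p}"

text \<open>\<open>Vx C\<close> and \<open>Vy C\<close> are the vertices given by a coset \<open>C\<close> of \<open>\<langle>x\<rangle>\<close>, resp.\ of \<open>\<langle>y\<rangle>\<close>.\<close>

datatype 'a bs_vertex = Vx "'a set" | Vy "'a set"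

text \<open>\<open>Inner E t\<close>, with \<open>0 < t < 1\<close>, is the point in the interior of the edge \<open>E\<close> at distance \<open>t\<close>
  from the endpoint of type \<open>Vx\<close>.\<close>

datatype 'a bs_point = Vert "'a bs_vertex" | Inner "'a set" real

definition bs_points :: "nat \<Rightarrow> gen word set bs_point set" where
  "bs_points p =
     {Vert (Vx C) |C. C \<in> lcosets\<^bsub>Gpp p\<^esub> sub_x p} \<union>
     {Vert (Vy C) |C. C \<in> lcosets\<^bsub>Gpp p\<^esub> sub_y p} \<union>
     {Inner E t |E t. E \<in> lcosets\<^bsub>Gpp p\<^esub> sub_xp p \<and> 0 < t \<and> t < 1}"

text \<open>The endpoints of \<open>E = g\<langle>x^p\<rangle>\<close> are \<open>g\<langle>x\<rangle> = E\<langle>x\<rangle>\<close> and \<open>g\<langle>y\<rangle> = E\<langle>y\<rangle>\<close>.\<close>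

definition end_x :: "nat \<Rightarrow> gen word set set \<Rightarrow> gen word set bs_vertex" where
  "end_x p E = Vx (E <#>\<^bsub>Gpp p\<^esub> sub_x p)"

definition end_y :: "nat \<Rightarrow> gen word set set \<Rightarrow> gen word set bs_vertex" where
  "end_y p E = Vy (E <#>\<^bsub>Gpp p\<^esub> sub_y p)"

definition bs_adj :: "nat \<Rightarrow> gen word set bs_vertex rel" where
  "bs_adj p = (\<Union>E \<in> lcosets\<^bsub>Gpp p\<^esub> sub_xp p. {(end_x p E, end_y p E), (end_y p E, end_x p E)})"

text \<open>Combinatorial distance: least number of edges of an edge path (the graph is connected).\<close>

definition bs_vdist ::
  "nat \<Rightarrow> gen word set bs_vertex \<Rightarrow> gen word set bs_vertex \<Rightarrow> nat" where
  "bs_vdist p u v = (LEAST n. (u, v) \<in> bs_adj p ^^ n)"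

text \<open>The vertices through which a path can leave a point, with their distances to it.\<close>

fun bs_exits :: "nat \<Rightarrow> gen word set bs_point \<Rightarrow> (gen word set bs_vertex \<times> real) set" where
  "bs_exits p (Vert v) = {(v, 0)}"
| "bs_exits p (Inner E t) = {(end_x p E, t), (end_y p E, 1 - t)}"

definition via_vertices_dist :: "nat \<Rightarrow> gen word set bs_point \<Rightarrow> gen word set bs_point \<Rightarrow> real" where
  "via_vertices_dist p z w =
     Min {a + real (bs_vdist p u v) + b |u a v b. (u, a) \<in> bs_exits p z \<and> (v, b) \<in> bs_exits p w}"

text \<open>Path metric with all edges of length \<open>1\<close>.\<close>

fun bs_dist :: "nat \<Rightarrow> gen word set bs_point \<Rightarrow> gen word set bs_point \<Rightarrow> real" where
  "bs_dist p (Inner E s) (Inner F t) =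
     (if E = F then \<bar>s - t\<bar> else via_vertices_dist p (Inner E s) (Inner F t))"
| "bs_dist p z w = via_vertices_dist p z w"

fun bs_act :: "nat \<Rightarrow> gen word set \<Rightarrow> gen word set bs_point \<Rightarrow> gen word set bs_point" where
  "bs_act p h (Vert (Vx C)) = Vert (Vx (h <#\<^bsub>Gpp p\<^esub> C))"
| "bs_act p h (Vert (Vy C)) = Vert (Vy (h <#\<^bsub>Gpp p\<^esub> C))"
| "bs_act p h (Inner E t) = Inner (h <#\<^bsub>Gpp p\<^esub> E) t"

definition transl_len :: "nat \<Rightarrow> gen word set \<Rightarrow> real" where
  "transl_len p h = (INF z\<in>bs_points p. bs_dist p z (bs_act p h z))"

definition hyperbolic :: "nat \<Rightarrow> gen word set \<Rightarrow> bool" where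
  "hyperbolic p h \<longleftrightarrow> 0 < transl_len p h"

definition axis :: "nat \<Rightarrow> gen word set \<Rightarrow> gen word set bs_point set" where
  "axis p h = {z \<in> bs_points p. bs_dist p z (bs_act p h z) = transl_len p h}"

text \<open>\<open>h\<close> acts hyperbolically along the same axis as \<open>a\<close>, and its translation length is least
  among the elements of the group that do so.\<close>

definition min_translation_along :: "nat \<Rightarrow> gen word set \<Rightarrow> gen word set \<Rightarrow> bool" where
  "min_translation_along p a h \<longleftrightarrow>
     h \<in> carrier (Gpp p) \<and> hyperbolic p h \<and> axis p h = axis p a \<and>
     (\<forall>k\<in>carrier (Gpp p). hyperbolic p k \<and> axis p k = axis p a \<longrightarrow> transl_len p h \<le> transl_len p k)"

end

theory Submission
  imports Defs
begin

text \<open>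
  The element \<open>z = x^p = y^p\<close> is central, and \<open>G / \<langle>z\<rangle>\<close> is the free product of two cyclic groups of
  order \<open>p\<close>. So an element of \<open>G\<close> is a reduced word (an alternating list of syllables) together with
  a power of \<open>z\<close>: the homomorphism \<open>nf\<close> reads off the word, and its kernel is \<open>\<langle>z\<rangle>\<close>. The edges of
  the Bass-Serre tree correspond to the reduced words, and an edge \<open>u\<langle>z\<rangle>\<close> lies on the axis of a
  hyperbolic \<open>h\<close> exactly if \<open>u\<inverse>hu\<close> has cyclically reduced normal form. As there are only two kinds of
  syllables, a nonempty reduced word is cyclically reduced in this sense (its ends have different
  kinds) exactly if its length is even. The hyperbolic elements are therefore those conjugate to a
  word of positive even length, and this length is the translation length.

  Let \<open>\<theta>\<close> be \<open>\<sigma>\<close> or \<open>\<sigma>\<tau>\<close>, put \<open>\<phi> = \<iota>\<^sub>g\<theta>\<close> and \<open>a = g\<theta>(g)\<close>. Then \<open>\<phi>\<^sup>2 = \<iota>\<^sub>a\<close>, so that \<open>\<phi>\<close> has finite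
  order exactly if a positive power of \<open>a\<close> is central. Replacing \<open>g\<close> by a twisted conjugate \<open>u\<inverse>g\<theta>(u)\<close>
  shortens its normal form until it is empty or has odd length, because \<open>\<theta>\<close> exchanges the two kinds
  of syllables (\<open>inversion_or_loxodromic\<close>). If it is empty, \<open>\<phi>\<close> is conjugate to \<open>\<theta>\<close> up to a central
  factor: \<open>\<phi>\<close> inverts an edge of the tree, and all its fixed points are powers of \<open>z\<close>. If it is odd,
  \<open>a\<close> is conjugate to a word of even length, hence hyperbolic.

  In the hyperbolic case the fixed points of \<open>\<phi>\<close> commute with \<open>a\<close>, as \<open>\<phi>\<^sup>2 = \<iota>\<^sub>a\<close>. The centralizer of a
  cyclically reduced word in the free product is generated by the root of that word
  (\<open>cyc_centralizer\<close>), so \<open>C(a)\<close> is a lattice \<open>\<langle>h\<rangle> \<times> \<langle>z\<rangle>\<close> and \<open>a = h^m z^l\<close> with \<open>m > 0\<close>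
  (\<open>centralizer_loxodromic\<close>). Since \<open>\<phi>\<close> fixes \<open>a\<close>, it acts on this lattice by \<open>h \<mapsto> h z^i\<close> and
  \<open>z \<mapsto> z^\<epsilon>\<close> with \<open>i m = (1 - \<epsilon>) l\<close>. For \<open>\<sigma>\<close> we have \<open>\<epsilon> = 1\<close>, so \<open>i = 0\<close> and everything in \<open>C(a)\<close> is
  fixed; for \<open>\<sigma>\<tau>\<close> we have \<open>\<epsilon> = - 1\<close>, and the fixed points \<open>h^r z^s\<close> are given by the single equation
  \<open>i r = 2 s\<close>, whose solutions form an infinite cyclic group.

  It remains to recognise \<open>h\<close> geometrically. Explicit distances in terms of normal forms show that
  the axis of a hyperbolic element determines, and is determined by, the set of edges on it
  (\<open>axis_eq_iff\<close>). Two elements with the same axis commute: the conjugates of \<open>k\<close> by the powers of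
  \<open>a\<close> have bounded length, hence two of them agree modulo \<open>z\<close> and \<open>k\<close> commutes with a power of \<open>a\<close>
  modulo \<open>z\<close>; the exponent sum \<open>G \<rightarrow> \<int>\<close> removes the ambiguity. So the elements with the axis of \<open>a\<close> are
  the \<open>h^j z^i\<close> with \<open>j \<noteq> 0\<close>; their translation length is \<open>\<bar>j\<bar>\<close> times that of \<open>h\<close>.
\<close>

section \<open>Homomorphisms out of a presented group\<close>

definition word_val :: "('h, 'm) monoid_scheme \<Rightarrow> ('a \<Rightarrow> 'h) \<Rightarrow> 'a word \<Rightarrow> 'h" where
  "word_val H f w =
     foldr (\<lambda>(a, b) h. (if b then f a else inv\<^bsub>H\<^esub> f a) \<otimes>\<^bsub>H\<^esub> h) w \<one>\<^bsub>H\<^esub>"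

context group
begin

lemma word_val_Nil [simp]: "word_val G f [] = \<one>"
  by (simp add: word_val_def)

lemma word_val_Cons [simp]:
  "word_val G f ((a, b) # w) = (if b then f a else inv f a) \<otimes> word_val G f w"
  by (simp add: word_val_def)

context
  fixes f :: "'gen \<Rightarrow> 'a"
  assumes f: "\<And>a. f a \<in> carrier G"
begin

lemma word_val_closed [simp]: "word_val G f w \<in> carrier G"
  by (induction w) (auto simp: f)

lemma word_val_append: "word_val G f (u @ v) = word_val G f u \<otimes> word_val G f v"
  by (induction u) (auto simp: f m_assoc)

lemma word_val_replicate: "word_val G f (replicate n (a, True)) = f a [^] n"
  by (induction n) (auto simp: f nat_pow_Suc2[OF f, unfolded nat_pow_Suc])

lemma word_val_cong:
  assumes "\<And>u v. (u, v) \<in> R \<Longrightarrow> word_val G f u = word_val G f v" and "pres_eq R u v"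
  shows "word_val G f u = word_val G f v"
  using assms(2)
proof induction
  case (pres_rel u v)
  then show ?case by (rule assms(1))
qed (auto simp: word_val_append f)

text \<open>The universal property: an assignment of the generators to elements of \<open>G\<close> that respects the
  relations extends to the presented group. It provides both the map to the free product of cyclic
  groups and the exponent sum.\<close>

lemma presented_group_universal:
  assumes "\<And>u v. (u, v) \<in> R \<Longrightarrow> word_val G f u = word_val G f v"
  shows "\<exists>F \<in> hom (presented_group R) G. \<forall>w. F (pres_class R w) = word_val G f w"
proof -
  define F where "F A = (THE h. \<exists>w\<in>A. h = word_val G f w)" for A
  have F: "F (pres_class R w) = word_val G f w" for w
    unfolding F_def
  proof (rule the_equality)
    show "\<exists>w'\<in>pres_class R w. word_val G f w = word_val G f w'"
      using pres_refl by (auto simp: pres_class_def)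
  next
    fix h assume "\<exists>w'\<in>pres_class R w. h = word_val G f w'"
    then show "h = word_val G f w"
      using word_val_cong[OF assms] by (force simp: pres_class_def)
  qed
  have "F \<in> hom (presented_group R) G"
  proof (rule homI)
    fix A B assume "A \<in> carrier (presented_group R)" "B \<in> carrier (presented_group R)"
    then obtain u v where "A = pres_class R u" "B = pres_class R v"
      by (auto simp: presented_group_def)
    then show "F (A \<otimes>\<^bsub>presented_group R\<^esub> B) = F A \<otimes> F B"
      by (simp add: mult_pres_class F word_val_append)
  qed (auto simp: presented_group_def F)
  then show ?thesis using F by blast
qed

end

end

lemma presented_group_hom_unique:
  assumes H: "group H" and F: "F \<in> hom (presented_group R) H" and F': "F' \<in> hom (presented_group R) H"
    and gen: "\<And>a. F (pres_class R [(a, True)]) = F' (pres_class R [(a, True)])"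
    and A: "A \<in> carrier (presented_group R)"
  shows "F A = F' A"
proof -
  interpret P: group "presented_group R" by (rule group_presented_group)
  interpret H: group H by (rule H)
  interpret F: group_hom "presented_group R" H F
    by unfold_locales (rule F)
  interpret F': group_hom "presented_group R" H F'
    by unfold_locales (rule F')
  have c: "pres_class R w \<in> carrier (presented_group R)" for w
    by (simp add: presented_group_def)
  have letter: "F (pres_class R [(a, b)]) = F' (pres_class R [(a, b)])" for a b
  proof (cases b)
    case False
    then show ?thesis
      using gen[of a] c by (simp add: inv_letter_class[symmetric])
  qed (simp add: gen)
  have "F (pres_class R w) = F' (pres_class R w)" for w
  proof (induction w)
    case Nil
    have "pres_class R [] = \<one>\<^bsub>presented_group R\<^esub>" by (simp add: presented_group_def)
    then show ?case by simp
  next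
    case (Cons l w)
    have "pres_class R (l # w) = pres_class R [l] \<otimes>\<^bsub>presented_group R\<^esub> pres_class R w"
      by (simp add: mult_pres_class)
    then show ?case using Cons letter c by (cases l) simp
  qed
  then show ?thesis using A by (auto simp: presented_group_def)
qed


section \<open>Reduced words\<close>

text \<open>The free product of two cyclic groups of order \<open>p\<close>, realised on its normal forms.\<close>

type_synonym syllable = "gen \<times> nat"

definition reduced :: "nat \<Rightarrow> syllable list \<Rightarrow> bool" where
  "reduced p w \<longleftrightarrow> distinct_adj (map fst w) \<and> (\<forall>s\<in>set w. 0 < snd s \<and> snd s < p)"

text \<open>Left multiplication of a reduced word by a syllable. Exponents lie strictly between \<open>0\<close> and \<open>p\<close>,
  so two adjacent syllables of the same kind cancel exactly if their exponents add up to \<open>p\<close>.\<close>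

fun syl_mult :: "nat \<Rightarrow> syllable \<Rightarrow> syllable list \<Rightarrow> syllable list" where
  "syl_mult p s [] = [s]"
| "syl_mult p (c, i) ((d, j) # w) =
     (if c \<noteq> d then (c, i) # (d, j) # w
      else if i + j = p then w else (c, (i + j) mod p) # w)"

definition free_prod :: "nat \<Rightarrow> syllable list monoid" where
  "free_prod p = \<lparr>carrier = {w. reduced p w}, monoid.mult = foldr (syl_mult p), one = []\<rparr>"

fun syl_inv :: "nat \<Rightarrow> syllable \<Rightarrow> syllable" where
  "syl_inv p (c, i) = (c, p - i)"

lemma fst_syl_inv [simp]: "fst (syl_inv p s) = fst s"
  by (cases s) simp

lemma reduced_Nil [simp]: "reduced p []"
  by (simp add: reduced_def)

lemma reduced_Cons:
  "reduced p (s # w) \<longleftrightarrow>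
     0 < snd s \<and> snd s < p \<and> reduced p w \<and> (w = [] \<or> fst s \<noteq> fst (hd w))"
  by (cases w) (auto simp: reduced_def)

lemma reduced_append:
  "reduced p (u @ v) \<longleftrightarrow>
     reduced p u \<and> reduced p v \<and> (u = [] \<or> v = [] \<or> fst (last u) \<noteq> fst (hd v))"
  by (auto simp: reduced_def distinct_adj_append_iff last_map hd_map)

lemma mod_below_double:
  "n < 2 * p \<Longrightarrow> n mod p = (if n < p then n else n - p)" for n p :: nat
  by (auto simp: le_mod_geq)

lemma reduced_syl_mult:
  assumes "reduced p [s]" "reduced p w"
  shows "reduced p (syl_mult p s w)"
proof -
  have "(i + j) mod p \<noteq> 0" if "0 < i" "i < p" "0 < j" "j < p" "i + j \<noteq> p" for i j :: nat
    using that by (auto simp: mod_below_double)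
  then show ?thesis using assms
    by (cases "(p, s, w)" rule: syl_mult.cases) (auto simp: reduced_Cons)
qed

lemma reduced_mult:
  assumes "reduced p u" "reduced p w"
  shows "reduced p (foldr (syl_mult p) u w)"
  using assms(1)
  by (induction u) (use assms(2) in \<open>auto simp: reduced_Cons intro!: reduced_syl_mult\<close>)

text \<open>Two syllables of the same kind act like their product. This is the only case of associativity
  that needs a computation; the general law follows by induction along words, as in van der
  Waerden's construction of free products.\<close>

lemma syl_mult_syl_mult:
  assumes "reduced p [(c, i)]" "reduced p [(c, j)]" "reduced p w"
  shows "syl_mult p (c, i) (syl_mult p (c, j) w) =
    (if i + j = p then w else syl_mult p (c, (i + j) mod p) w)"
proof (cases w)
  case (Cons t v)
  obtain d k where t: "t = (d, k)" by fastforce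
  have r: "0 < i" "i < p" "0 < j" "j < p" "0 < k" "k < p"
    using assms Cons t by (auto simp: reduced_Cons)
  show ?thesis
  proof (cases "c = d")
    case True
    then have v: "syl_mult p (c, x) v = (c, x) # v" for x
      using assms Cons t by (cases "(p, (c, x), v)" rule: syl_mult.cases) (auto simp: reduced_Cons)
    show ?thesis
      using r v unfolding Cons t True
      by (auto simp: mod_below_double add.assoc)
  qed (use r Cons t in auto)
qed (use assms in auto)

lemma mult_syl_mult:
  assumes "reduced p [s]" "reduced p v" "reduced p w"
  shows "foldr (syl_mult p) (syl_mult p s v) w = syl_mult p s (foldr (syl_mult p) v w)"
proof (cases "(p, s, v)" rule: syl_mult.cases)
  case (2 p' c i d j u)
  then have [simp]: "p' = p" and eq: "s = (c, i)" "v = (d, j) # u" by auto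
  have r: "reduced p (foldr (syl_mult p) u w)" "reduced p [(d, j)]"
    using assms eq by (auto simp: reduced_Cons intro: reduced_mult)
  show ?thesis
    using assms(1) eq syl_mult_syl_mult[OF _ r(2) r(1)] by auto
qed (use assms in auto)

lemma mult_inv_word:
  assumes "reduced p u"
  shows "foldr (syl_mult p) (rev (map (syl_inv p) u)) u = []"
  using assms
proof (induction u)
  case (Cons s u)
  obtain c i where s: "s = (c, i)" by fastforce
  have "syl_mult p (c, p - i) ((c, i) # u) = u"
    using Cons.prems s by (auto simp: reduced_Cons)
  then show ?case using Cons s by (auto simp: reduced_Cons)
qed simp

lemma reduced_inv_word:
  assumes "reduced p u"
  shows "reduced p (rev (map (syl_inv p) u))"
proof -
  have "map fst (rev (map (syl_inv p) u)) = rev (map fst u)"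
    by (simp add: rev_map comp_def)
  moreover have "\<forall>s\<in>set (rev (map (syl_inv p) u)). 0 < snd s \<and> snd s < p"
    using assms by (force simp: reduced_def)
  ultimately show ?thesis using assms by (simp only: reduced_def distinct_adj_rev)
qed

lemma carrier_free_prod [simp]: "u \<in> carrier (free_prod p) \<longleftrightarrow> reduced p u"
  by (simp add: free_prod_def)

lemma one_free_prod [simp]: "\<one>\<^bsub>free_prod p\<^esub> = []"
  by (simp add: free_prod_def)

lemma mult_free_prod: "u \<otimes>\<^bsub>free_prod p\<^esub> v = foldr (syl_mult p) u v"
  by (simp add: free_prod_def)

lemma group_free_prod: "group (free_prod p)"
proof (rule groupI)
  fix u v w
  assume "u \<in> carrier (free_prod p)" "v \<in> carrier (free_prod p)" "w \<in> carrier (free_prod p)"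
  then have r: "reduced p u" "reduced p v" "reduced p w" by auto
  then show "u \<otimes>\<^bsub>free_prod p\<^esub> v \<in> carrier (free_prod p)"
    by (simp add: mult_free_prod reduced_mult)
  show "u \<otimes>\<^bsub>free_prod p\<^esub> v \<otimes>\<^bsub>free_prod p\<^esub> w = u \<otimes>\<^bsub>free_prod p\<^esub> (v \<otimes>\<^bsub>free_prod p\<^esub> w)"
    unfolding mult_free_prod using r(1)
    by (induction u) (auto simp: reduced_Cons mult_syl_mult reduced_mult r)
next
  fix u assume "u \<in> carrier (free_prod p)"
  then show "\<exists>v\<in>carrier (free_prod p). v \<otimes>\<^bsub>free_prod p\<^esub> u = \<one>\<^bsub>free_prod p\<^esub>"
    by (intro bexI[of _ "rev (map (syl_inv p) u)"]) (simp_all add: mult_free_prod mult_inv_word reduced_inv_word)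
qed (auto simp: mult_free_prod)

lemma inv_free_prod:
  assumes "reduced p u"
  shows "inv\<^bsub>free_prod p\<^esub> u = rev (map (syl_inv p) u)"
proof -
  interpret group "free_prod p" by (rule group_free_prod)
  show ?thesis
    using assms by (intro inv_equality) (auto simp: mult_free_prod mult_inv_word reduced_inv_word)
qed

lemma mult_eq_append:
  assumes "reduced p (u @ v)"
  shows "u \<otimes>\<^bsub>free_prod p\<^esub> v = u @ v"
  using assms
proof (induction u)
  case (Cons s u)
  have "syl_mult p s w = s # w" if "reduced p (s # w)" for w
    using that by (cases "(p, s, w)" rule: syl_mult.cases) (auto simp: reduced_Cons)
  then show ?case using Cons by (simp add: mult_free_prod reduced_Cons)
qed (simp add: mult_free_prod)

lemma length_syl_mult_le: "length (syl_mult p s w) \<le> Suc (length w)"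
  by (cases "(p, s, w)" rule: syl_mult.cases) auto

lemma syl_mult_long:
  assumes "2 \<le> length w"
  shows "syl_mult p s w \<noteq> []" "last (syl_mult p s w) = last w" "length w \<le> Suc (length (syl_mult p s w))"
  using assms by (cases "(p, s, w)" rule: syl_mult.cases; auto)+

text \<open>The kinds of the syllables of a reduced word alternate between \<open>x\<close> and \<open>y\<close>, so the last one is
  determined by the first one and the parity of the length.\<close>

lemma odd_length_reduced_iff:
  assumes "reduced p w" "w \<noteq> []"
  shows "odd (length w) \<longleftrightarrow> fst (hd w) = fst (last w)"
  using assms
proof (induction w)
  case (Cons s w)
  show ?case
  proof (cases "w = []")
    case False
    then have "fst s \<noteq> fst (hd w)" using Cons.prems by (simp add: reduced_Cons)
    then have "fst s = c \<longleftrightarrow> fst (hd w) \<noteq> c" for c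
      by (cases c; cases "fst s"; cases "fst (hd w)") auto
    with False show ?thesis using Cons by (simp add: reduced_Cons)
  qed simp
qed simp

text \<open>Commuting lists are powers of a common list, and the shortest nonempty \<open>w\<close> that commutes with \<open>a\<close>
  serves for all of them at once: any \<open>k\<close> that commutes with \<open>a\<close> is a prefix of a power of \<open>a\<close>, so
  \<open>k = w @ k'\<close>, and the shorter \<open>k'\<close> commutes with \<open>a\<close> again.\<close>

lemma list_commutant_root:
  assumes "a \<noteq> []"
  obtains w where "w \<noteq> []" "w @ a = a @ w" "\<And>k. k @ a = a @ k \<Longrightarrow> \<exists>j. k = concat (replicate j w)"
proof -
  define w where "w = (ARG_MIN length w. w \<noteq> [] \<and> w @ a = a @ w)"
  have w: "w \<noteq> [] \<and> w @ a = a @ w"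
    and min: "\<And>k. k \<noteq> [] \<and> k @ a = a @ k \<Longrightarrow> length w \<le> length k"
    using arg_min_nat_lemma[of "\<lambda>w. w \<noteq> [] \<and> w @ a = a @ w" a length] assms
    by (auto simp: w_def)
  have "\<exists>j. k = concat (replicate j w)" if "k @ a = a @ k" for k
    using that
  proof (induction "length k" arbitrary: k rule: less_induct)
    case less
    show ?case
    proof (cases "k = []")
      case True
      then show ?thesis by (intro exI[of _ 0]) simp
    next
      case False
      \<comment> \<open>As \<open>a\<close> is nonempty, \<open>a^n\<close> is at least as long as \<open>k\<close> and \<open>w\<close>, so both are prefixes of it.\<close>
      define n where "n = length k"
      let ?A = "concat (replicate n a)"
      have comm: "v @ concat (replicate m a) = concat (replicate m a) @ v"
        if "v @ a = a @ v" for v m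
        using that by (induction m) (simp_all, metis append.assoc)
      have len: "length k \<le> length ?A"
        using assms by (cases a) (simp_all add: n_def length_concat sum_list_replicate)
      have wk: "length w \<le> length k" using min less.prems False by simp
      have "k = take (length k) ?A"
        using arg_cong[OF comm[OF less.prems, of n], of "take (length k)"] len by simp
      moreover have "w = take (length w) ?A"
        using arg_cong[OF comm[of w n], of "take (length w)"] w len wk by simp
      ultimately have "w = take (length w) k" using wk by (metis min_absorb1 take_take)
      then obtain k' where k': "k = w @ k'" by (metis append_take_drop_id)
      have "w @ (k' @ a) = w @ (a @ k')"
        using less.prems w by (metis append.assoc k')
      then have "k' @ a = a @ k'" by simp
      moreover have "length k' < length k" using w k' by simp
      ultimately obtain j where "k' = concat (replicate j w)" using less.hyps by blast
      then show ?thesis using k' by (intro exI[of _ "Suc j"]) simp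
    qed
  qed
  with w show thesis using that by blast
qed

lemma (in group) nat_pow_conjugate:
  assumes "u \<in> carrier G" "v \<in> carrier G"
  shows "(inv u \<otimes> v \<otimes> u) [^] (n::nat) = inv u \<otimes> v [^] n \<otimes> u"
proof (induction n)
  case (Suc n)
  have "inv u \<otimes> v [^] n \<otimes> u \<otimes> (inv u \<otimes> v \<otimes> u) = inv u \<otimes> v [^] n \<otimes> (u \<otimes> inv u) \<otimes> v \<otimes> u"
    using assms by (simp only: m_assoc inv_closed m_closed nat_pow_closed)
  then show ?case using Suc assms by (simp add: m_assoc)
qed (use assms in simp)

lemma (in group) int_pow_conjugate:
  assumes "u \<in> carrier G" "v \<in> carrier G"
  shows "(inv u \<otimes> v \<otimes> u) [^] (n::int) = inv u \<otimes> v [^] n \<otimes> u"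
proof (cases n)
  case (nonneg m)
  then show ?thesis using nat_pow_conjugate[OF assms] by (simp add: int_pow_int)
next
  case (neg m)
  then show ?thesis
    unfolding neg using nat_pow_conjugate[OF assms, of "Suc m"] assms
    by (simp add: int_pow_neg_int inv_mult_group m_assoc del: nat_pow_Suc of_nat_Suc)
qed

locale free_product =
  fixes p :: nat and Q :: "syllable list monoid" (structure)
  assumes Q_def: "Q = free_prod p"
begin

sublocale group Q
  unfolding Q_def by (rule group_free_prod)

lemma in_carrier [simp]: "u \<in> carrier Q \<longleftrightarrow> reduced p u"
  and one_eq [simp]: "\<one> = []"
  and mult_eq: "u \<otimes> v = foldr (syl_mult p) u v"
  by (simp_all add: Q_def mult_free_prod)

lemma mult_Nil [simp]: "[] \<otimes> u = u" "reduced p u \<Longrightarrow> u \<otimes> [] = u" "inv [] = []"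
  "[] [^] (n::nat) = []" "[] [^] (k::int) = []"
  using r_one[of u] inv_one nat_pow_one int_pow_one by (auto simp: mult_eq)

lemma inv_eq: "reduced p u \<Longrightarrow> inv u = rev (map (syl_inv p) u)"
  by (simp add: Q_def inv_free_prod)

lemma mult_append: "reduced p (u @ v) \<Longrightarrow> u \<otimes> v = u @ v"
  by (simp add: Q_def mult_eq_append)

lemma reduced_closed [simp]:
  "reduced p u \<Longrightarrow> reduced p v \<Longrightarrow> reduced p (u \<otimes> v)"
  "reduced p u \<Longrightarrow> reduced p (inv u)"
  "reduced p u \<Longrightarrow> reduced p (u [^] (n::nat))"
  "reduced p u \<Longrightarrow> reduced p (u [^] (k::int))"
  using m_closed[of u v] inv_closed[of u] nat_pow_closed[of u n] int_pow_closed[of u k] by auto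

lemma length_mult_le: "length (u \<otimes> v) \<le> length u + length v"
proof (induction u)
  case (Cons s u)
  show ?case
    using Cons length_syl_mult_le[of p s "u \<otimes> v"] by (simp add: mult_eq)
qed (simp add: mult_eq)

lemma length_inv: "reduced p u \<Longrightarrow> length (inv u) = length u"
  by (simp add: inv_eq)

text \<open>Each syllable of \<open>u\<close> affects at most one syllable of \<open>v\<close>, starting from the left; if \<open>v\<close> is longer
  than \<open>u\<close>, its last syllable survives.\<close>

lemma mult_long_right:
  assumes "length u < length v"
  shows "u \<otimes> v \<noteq> [] \<and> last (u \<otimes> v) = last v \<and> length v \<le> length u + length (u \<otimes> v)"
  using assms
proof (induction u)
  case (Cons s u)
  then show ?case using syl_mult_long[of "u \<otimes> v" p s] by (auto simp: mult_eq)
qed (auto simp: mult_eq)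

lemma fst_hd_mult_long_left:
  assumes "reduced p u" "reduced p v" "length u < length v"
  shows "fst (hd (v \<otimes> u)) = fst (hd v)"
proof -
  have fst_hd: "fst (hd w) = fst (last (inv w))" if "reduced p w" "w \<noteq> []" for w
    using that by (cases w) (simp_all add: inv_eq)
  have last: "last (inv u \<otimes> inv v) = last (inv v)" "inv u \<otimes> inv v \<noteq> []"
    using mult_long_right[of "inv u" "inv v"] assms by (auto simp: length_inv)
  moreover have eq: "inv (v \<otimes> u) = inv u \<otimes> inv v" using assms by (simp add: inv_mult_group)
  ultimately have "v \<otimes> u \<noteq> []" using inv_one by auto
  moreover have "v \<noteq> []" using assms(3) by auto
  ultimately show ?thesis using assms fst_hd eq last by (metis reduced_closed(1))
qed


section \<open>Cyclically reduced words and their centralizers\<close>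

text \<open>For a reduced word, even length means that the first and the last syllable are of different
  kinds, so that no cyclic rotation cancels or merges syllables.\<close>

definition cyc_reduced :: "syllable list \<Rightarrow> bool" where
  "cyc_reduced w \<longleftrightarrow> reduced p w \<and> w \<noteq> [] \<and> even (length w)"

lemma cyc_reduced_iff: "cyc_reduced w \<longleftrightarrow> reduced p w \<and> w \<noteq> [] \<and> fst (hd w) \<noteq> fst (last w)"
  using odd_length_reduced_iff by (auto simp: cyc_reduced_def)

lemma cyc_reducedD [simp]: "cyc_reduced w \<Longrightarrow> reduced p w" "cyc_reduced w \<Longrightarrow> w \<noteq> []"
  by (auto simp: cyc_reduced_def)

lemma cyc_nat_pow:
  assumes "cyc_reduced a"
  shows "a [^] n = concat (replicate n a)"
proof (induction n)
  case (Suc n)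
  have "reduced p (a [^] n)" using assms by simp
  moreover have "last (concat (replicate n a)) = last a" if "n > 0"
    using that assms by (induction n) (auto simp: last_append)
  ultimately have "reduced p (concat (replicate n a) @ a)"
    using assms Suc by (cases "n = 0") (auto simp: reduced_append cyc_reduced_iff simp del: cyc_reducedD)
  moreover have "concat (replicate n a) @ a = a @ concat (replicate n a)"
    by (induction n) auto
  ultimately show ?case using Suc by (simp add: mult_append)
qed simp

lemma length_cyc_nat_pow: "cyc_reduced a \<Longrightarrow> length (a [^] (n::nat)) = n * length a"
  by (simp add: cyc_nat_pow length_concat sum_list_replicate)

lemma length_cyc_int_pow: "cyc_reduced a \<Longrightarrow> length (a [^] (n::int)) = nat \<bar>n\<bar> * length a"
proof (cases n)
  case (neg m)
  assume "cyc_reduced a"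
  then show ?thesis
    unfolding neg int_pow_neg_int using length_cyc_nat_pow[of a "Suc m"] neg
    by (simp add: length_inv int_pow_neg_int del: nat_pow_Suc of_nat_Suc)
qed (simp add: length_cyc_nat_pow int_pow_int)

lemma cyc_int_pow:
  assumes "cyc_reduced a" "n \<noteq> (0::int)"
  shows "cyc_reduced (a [^] n)"
proof -
  have "length (a [^] n) > 0" "even (length (a [^] n))"
    using assms by (auto simp: length_cyc_int_pow cyc_reduced_def simp del: cyc_reducedD)
  then show ?thesis using assms by (auto simp: cyc_reduced_def simp del: cyc_reducedD)
qed

text \<open>Multiplication by a high power of \<open>a\<close> turns commutation in the group into commutation of lists:
  \<open>k a^n = a^n k\<close> ends like \<open>a\<close> by its first form and begins like \<open>a\<close> by its second form, so there is
  no cancellation when it is multiplied with \<open>a\<close> on either side.\<close>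

lemma commuting_with_cyc:
  assumes a: "cyc_reduced a" and k: "reduced p k" "k \<otimes> a = a \<otimes> k"
  obtains n :: nat where "(k \<otimes> a [^] n) @ a = a @ (k \<otimes> a [^] n)" "reduced p (k \<otimes> a [^] n)"
proof -
  define n where "n = Suc (length k)"
  define v where "v = a [^] n"
  have v: "reduced p v" using a by (simp add: v_def)
  have comm: "k \<otimes> v = v \<otimes> k"
    unfolding v_def using a k by (intro group_commutes_pow[symmetric]) auto
  have "v = a @ concat (replicate (length k) a)"
    unfolding v_def cyc_nat_pow[OF a] n_def by simp
  then have hd: "hd v = hd a" using a by simp
  have "replicate n a = replicate (length k) a @ [a]"
    by (simp add: n_def replicate_append_same)
  then have "v = concat (replicate (length k) a) @ a"
    unfolding v_def cyc_nat_pow[OF a] by simp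
  then have last: "last v = last a" using a by simp
  have len: "length k < length v"
    using length_cyc_nat_pow[OF a, of n] a by (cases "length a") (auto simp: v_def n_def simp del: nat_pow_Suc dest: cyc_reducedD)
  define k' where "k' = k \<otimes> v"
  have r: "reduced p k'" using k v by (simp add: k'_def)
  have k': "k' \<noteq> []" "fst (last k') = fst (last a)" "fst (hd k') = fst (hd a)"
    using mult_long_right[OF len] fst_hd_mult_long_left[OF k(1) v len] hd last
    by (simp_all add: k'_def comm)
  have va: "v \<otimes> a = a \<otimes> v"
    unfolding v_def using a by (intro group_commutes_pow) auto
  have "k' \<otimes> a = a \<otimes> k'"
    using k a v va unfolding k'_def by (metis cyc_reducedD(1) in_carrier m_assoc)
  moreover have "k' \<otimes> a = k' @ a" "a \<otimes> k' = a @ k'"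
    using k' a r by (auto intro!: mult_append simp: reduced_append cyc_reduced_iff simp del: cyc_reducedD)
  ultimately have "k' @ a = a @ k'" by simp
  with r show thesis using that[of n] by (simp add: k'_def v_def)
qed

text \<open>The centralizer of a cyclically reduced word is the infinite cyclic group generated by its root.\<close>

lemma cyc_centralizer:
  assumes a: "cyc_reduced a"
  obtains w and m :: nat where "cyc_reduced w" "0 < m" "a = w [^] m"
    "\<And>k. reduced p k \<Longrightarrow> k \<otimes> a = a \<otimes> k \<Longrightarrow> \<exists>j::int. k = w [^] j"
proof -
  obtain w where w: "w \<noteq> []" "w @ a = a @ w"
    and root: "\<And>k. k @ a = a @ k \<Longrightarrow> \<exists>j. k = concat (replicate j w)"
    using list_commutant_root[of a] a by auto
  obtain m where m: "a = concat (replicate m w)" using root[of a] by auto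
  then have "m > 0" using a by (cases m) auto
  then obtain m' where m': "m = Suc m'" by (cases m) auto
  have "a = w @ concat (replicate m' w)" by (simp add: m m')
  then have "reduced p w" using a by (metis cyc_reducedD(1) reduced_append)
  moreover have "hd w = hd a" "last w = last a"
    using w a cyc_reducedD(2)[OF a] by (metis hd_append2, metis last_appendR)
  \<comment> \<open>As a prefix and a suffix of \<open>a\<close>, the root \<open>w\<close> has the same ends, so it is cyclically reduced too.\<close>
  ultimately have cw: "cyc_reduced w" using a w by (simp add: cyc_reduced_iff del: cyc_reducedD)
  have "\<exists>j::int. k = w [^] j" if k: "reduced p k" "k \<otimes> a = a \<otimes> k" for k
  proof -
    obtain n :: nat where n: "(k \<otimes> a [^] n) @ a = a @ (k \<otimes> a [^] n)" using commuting_with_cyc[OF a k] by metis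
    obtain j where "k \<otimes> a [^] n = concat (replicate j w)" using root[OF n] by auto
    then have "k \<otimes> a [^] n = w [^] j" by (simp add: cyc_nat_pow cw)
    moreover have an: "a [^] n = w [^] (m * n)" using m cw by (simp add: cyc_nat_pow[symmetric] nat_pow_pow)
    ultimately have "k = w [^] j \<otimes> inv (w [^] (m * n))"
      using k cw by (metis cyc_reducedD(1) in_carrier inv_solve_right nat_pow_closed)
    also have "\<dots> = w [^] (int j - int (m * n))"
      using int_pow_diff[of w "int j" "int (m * n)"] cw by (simp only: int_pow_int cyc_reducedD in_carrier)
    finally show ?thesis by blast
  qed
  then show thesis using that[OF cw \<open>m > 0\<close>] m cw by (simp add: cyc_nat_pow)
qed

text \<open>Cyclically reduced words are shortest in their conjugacy class: \<open>v^n\<close> has length \<open>n \<cdot> length v\<close>,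
  whereas conjugation by \<open>u\<close> changes the length of an \<open>n\<close>-th power by at most \<open>2 \<cdot> length u\<close>, however
  large \<open>n\<close> is.\<close>

lemma length_cyc_le_conjugate:
  assumes v: "cyc_reduced v" and u: "reduced p u"
  shows "length v \<le> length (inv u \<otimes> v \<otimes> u)"
proof (rule ccontr)
  assume less: "\<not> ?thesis"
  \<comment> \<open>A difference of one in length, amplified \<open>n\<close> times, exceeds the possible gain \<open>2 \<cdot> length u\<close>.\<close>
  define n where "n = Suc (2 * length u)"
  define v' where "v' = inv u \<otimes> v \<otimes> u"
  have r: "reduced p v'" using v u by (simp add: v'_def)
  have len: "length (v' [^] (k::nat)) \<le> k * length v'" for k
  proof (induction k)
    case (Suc k)
    then show ?case using length_mult_le[of "v' [^] k" v'] by simp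
  qed simp
  have "v = u \<otimes> v' \<otimes> inv u"
    unfolding v'_def using u v by (simp add: m_assoc[symmetric]) (simp add: m_assoc)
  then have "v [^] n = u \<otimes> v' [^] n \<otimes> inv u"
    using nat_pow_conjugate[of "inv u" v' n] u r by simp
  then have "length (v [^] n) \<le> 2 * length u + n * length v'"
    using length_mult_le[of "u \<otimes> v' [^] n" "inv u"] length_mult_le[of u "v' [^] n"] len[of n] u
    by (simp add: length_inv)
  moreover have "n * Suc (length v') \<le> n * length v"
    using less by (intro mult_le_mono) (auto simp: v'_def)
  ultimately have "n * Suc (length v') \<le> 2 * length u + n * length v'"
    using length_cyc_nat_pow[OF v, of n] by linarith
  then show False by (simp add: n_def)
qed

lemma length_cyc_conjugate_eq:
  assumes "cyc_reduced v" "reduced p u" "cyc_reduced (inv u \<otimes> v \<otimes> u)"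
  shows "length (inv u \<otimes> v \<otimes> u) = length v"
proof -
  have "inv (inv u) \<otimes> (inv u \<otimes> v \<otimes> u) \<otimes> inv u = v"
    using assms by (simp add: m_assoc[symmetric]) (simp add: m_assoc)
  then show ?thesis
    using length_cyc_le_conjugate[OF assms(1,2)] length_cyc_le_conjugate[OF assms(3), of "inv u"] assms(2)
    by simp
qed

text \<open>\<open>v\<close> commutes with its power \<open>v^n\<close>, hence is itself a power of the cyclically reduced root of \<open>v^n\<close>.\<close>

lemma cyc_of_cyc_int_pow:
  assumes v: "reduced p v" "cyc_reduced (v [^] (n::int))"
  shows "cyc_reduced v"
proof -
  have "v \<otimes> v [^] n = v [^] n \<otimes> v"
    using v(1) int_pow_mult[of v 1 n] int_pow_mult[of v n 1] by (simp add: add.commute)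
  then obtain w and j :: int where w: "cyc_reduced w" "v = w [^] j"
    using cyc_centralizer[OF v(2)] v(1) by metis
  moreover have "j \<noteq> 0" using v w by (auto simp: int_pow_0 dest: cyc_reducedD(2))
  ultimately show ?thesis by (simp add: cyc_int_pow)
qed

text \<open>The hypothesis says that the edges on the axis of \<open>a\<close> lie on the axis of \<open>k\<close>. All powers of \<open>a\<close>
  are such edges, so the conjugates \<open>a^(- n) k a^n\<close> are cyclically reduced, and therefore all have the
  length of \<open>k\<close>. There are only finitely many words of this length; two of the conjugates coincide,
  and \<open>k\<close> commutes with some \<open>a^d\<close>. Now \<open>k\<close> and \<open>a\<close> lie in the cyclic centralizer of \<open>a^d\<close>.\<close>

lemma commute_of_same_cyc_conjugators:
  assumes a: "cyc_reduced a" and k: "cyc_reduced k"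
    and same: "\<And>u. reduced p u \<Longrightarrow> cyc_reduced (inv u \<otimes> a \<otimes> u) \<Longrightarrow> cyc_reduced (inv u \<otimes> k \<otimes> u)"
  shows "k \<otimes> a = a \<otimes> k"
proof -
  define f where "f n = inv (a [^] n) \<otimes> k \<otimes> a [^] n" for n :: nat
  have "f n \<in> {w. set w \<subseteq> UNIV \<times> {..<p} \<and> length w = length k}" for n
  proof -
    have "inv (a [^] n) \<otimes> a \<otimes> a [^] n = a"
      using a by (simp add: m_assoc nat_pow_Suc2[symmetric])
        (simp add: m_assoc[symmetric])
    then have "cyc_reduced (f n)" using same[of "a [^] n"] a by (simp add: f_def)
    moreover from this have "length (f n) = length k"
      unfolding f_def using a k by (intro length_cyc_conjugate_eq) auto
    ultimately show ?thesis by (force simp: cyc_reduced_def reduced_def simp del: cyc_reducedD)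
  qed
  moreover have "UNIV = {Gen_x, Gen_y}" using gen.exhaust by auto
  then have "finite (UNIV :: gen set)" by (metis finite.emptyI finite.insertI)
  ultimately have "finite (range f)"
    by (intro finite_subset[OF _ finite_lists_length_eq[of "UNIV \<times> {..<p}" "length k"]]) auto
  then have "\<not> inj f" using finite_imageD infinite_UNIV_nat by blast
  then obtain m n where mn: "m < n" "f m = f n" by (metis injI linorder_neqE_nat)
  define d where "d = n - m"
  have an: "a [^] n = a [^] d \<otimes> a [^] m" using mn a by (simp add: nat_pow_mult d_def)
  have "inv (a [^] m) \<otimes> (k \<otimes> a [^] m) = inv (a [^] m) \<otimes> (inv (a [^] d) \<otimes> k \<otimes> a [^] d \<otimes> a [^] m)"
    using mn(2) a k by (simp add: f_def an inv_mult_group m_assoc)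
  then have "k = inv (a [^] d) \<otimes> k \<otimes> a [^] d" using a k by simp
  then have kd: "k \<otimes> a [^] d = a [^] d \<otimes> k"
    using a k by (metis cyc_reducedD(1) in_carrier inv_solve_left m_assoc m_closed nat_pow_closed inv_closed)
  have "cyc_reduced (a [^] int d)" using a mn by (intro cyc_int_pow) (auto simp: d_def)
  then have d: "cyc_reduced (a [^] d)" by (simp add: int_pow_int)
  have ad: "a \<otimes> a [^] d = a [^] d \<otimes> a" using a by (simp add: nat_pow_comm nat_pow_Suc2[symmetric])
  obtain w i j where w: "cyc_reduced w" "k = w [^] (i::int)" "a = w [^] (j::int)"
    using cyc_centralizer[OF d] kd ad k a by (metis cyc_reducedD(1))
  then show ?thesis by (simp add: int_pow_mult[symmetric] add.commute)
qed

text \<open>The step that shortens words in the two reductions below, with \<open>s' = s\<close> for conjugation and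
  with \<open>s'\<close> the image of \<open>s\<close> for twisted conjugation: \<open>s\<close> is cancelled on the left, and \<open>s'\<close> is
  absorbed by the last syllable on the right.\<close>

lemma length_shorten_conjugate:
  assumes "reduced p (s # m @ [t])" "reduced p [s']" "fst s' = fst t"
  shows "length (inv [s] \<otimes> (s # m @ [t]) \<otimes> [s']) \<le> Suc (length m)"
proof -
  have r: "reduced p [s]" "reduced p (m @ [t])" "reduced p m" "reduced p [t]"
    using assms(1) by (auto simp: reduced_Cons reduced_append)
  have "s # m @ [t] = [s] \<otimes> (m \<otimes> [t])"
    using assms(1) r by (simp add: mult_append)
  then have eq: "inv [s] \<otimes> (s # m @ [t]) \<otimes> [s'] = m \<otimes> ([t] \<otimes> [s'])"
    using r assms(2) by (simp add: m_assoc[symmetric])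
  have "length ([t] \<otimes> [s']) \<le> 1"
    using assms(3) by (cases t; cases s') (simp add: mult_eq)
  then show ?thesis unfolding eq using length_mult_le[of m "[t] \<otimes> [s']"] by linarith
qed

lemma conjugate_to_short_or_cyc:
  assumes "reduced p q"
  obtains u where "reduced p u" "length (inv u \<otimes> q \<otimes> u) \<le> 1 \<or> cyc_reduced (inv u \<otimes> q \<otimes> u)"
proof -
  have "\<exists>u. reduced p u \<and> (length (inv u \<otimes> q \<otimes> u) \<le> 1 \<or> cyc_reduced (inv u \<otimes> q \<otimes> u))"
    using assms
  proof (induction "length q" arbitrary: q rule: less_induct)
    case less
    show ?case
    proof (cases "length q \<le> 1 \<or> cyc_reduced q")
      case True
      then show ?thesis using less.prems by (intro exI[of _ "[]"]) (metis in_carrier inv_one l_one r_one one_eq one_closed)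
    next
      case False
      then obtain s r where "q = s # r" "r \<noteq> []" by (cases q) auto
      then obtain m t where q: "q = s # m @ [t]" by (metis append_butlast_last_id)
      with False less.prems have st: "fst s = fst t" by (simp add: cyc_reduced_iff del: cyc_reducedD)
      have s: "reduced p [s]" using less.prems q by (simp add: reduced_Cons)
      define q' where "q' = inv [s] \<otimes> q \<otimes> [s]"
      have q': "reduced p q'" using less.prems s by (simp add: q'_def)
      have "length q' < length q"
        using length_shorten_conjugate[of s m t s] less.prems s st by (simp add: q q'_def)
      then obtain u where u: "reduced p u" "length (inv u \<otimes> q' \<otimes> u) \<le> 1 \<or> cyc_reduced (inv u \<otimes> q' \<otimes> u)"
        using less.hyps q' by blast
      moreover have "inv ([s] \<otimes> u) \<otimes> q \<otimes> ([s] \<otimes> u) = inv u \<otimes> q' \<otimes> u"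
        using u s less.prems by (simp add: q'_def inv_mult_group m_assoc)
      ultimately show ?thesis using s by (metis reduced_closed(1))
    qed
  qed
  then show thesis using that by blast
qed

text \<open>If the length is even and positive, the last syllable has the kind opposite to the first
  syllable \<open>s\<close>, that is the kind of \<open>f s\<close>; so twisted conjugation by \<open>s\<close> shortens the word.\<close>

lemma twisted_conjugate_trivial_or_odd:
  assumes hom: "map f \<in> hom Q Q" and f: "\<And>s. fst (f s) \<noteq> fst s" and "reduced p q"
  obtains u where "reduced p u" "inv u \<otimes> q \<otimes> map f u = [] \<or> odd (length (inv u \<otimes> q \<otimes> map f u))"
proof -
  have cl: "reduced p (map f u)" if "reduced p u" for u
    using hom_in_carrier[OF hom, of u] that by simp
  have "\<exists>u. reduced p u \<and> (inv u \<otimes> q \<otimes> map f u = [] \<or> odd (length (inv u \<otimes> q \<otimes> map f u)))"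
    using assms(3)
  proof (induction "length q" arbitrary: q rule: less_induct)
    case less
    show ?case
    proof (cases "q = [] \<or> odd (length q)")
      case True
      then show ?thesis using less.prems
        by (intro exI[of _ "[]"]) (metis in_carrier inv_one l_one r_one one_eq one_closed list.map(1))
    next
      case False
      then have c: "cyc_reduced q" using less.prems by (simp add: cyc_reduced_def del: cyc_reducedD)
      from False obtain s r where "q = s # r" "r \<noteq> []" by (cases q; cases "tl q") auto
      then obtain m t where q: "q = s # m @ [t]" by (metis append_butlast_last_id)
      have "fst s \<noteq> fst t" using c by (simp add: cyc_reduced_iff q del: cyc_reducedD)
      then have st: "fst (f s) = fst t" using f[of s] by (metis gen.exhaust)
      have s: "reduced p [s]" using less.prems q by (simp add: reduced_Cons)
      define q' where "q' = inv [s] \<otimes> q \<otimes> map f [s]"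
      have q': "reduced p q'" using less.prems s cl[OF s] by (simp add: q'_def)
      have "length q' < length q"
        using length_shorten_conjugate[of s m t "f s"] less.prems s st cl[OF s] by (simp add: q q'_def)
      then obtain u where u: "reduced p u" "inv u \<otimes> q' \<otimes> map f u = [] \<or> odd (length (inv u \<otimes> q' \<otimes> map f u))"
        using less.hyps q' by blast
      moreover have "inv ([s] \<otimes> u) \<otimes> q \<otimes> map f ([s] \<otimes> u) = inv u \<otimes> q' \<otimes> map f u"
        using u(1) s less.prems cl[OF s] cl[OF u(1)] hom_mult[OF hom, of "[s]" u]
        by (simp add: q'_def inv_mult_group m_assoc)
      ultimately show ?thesis using s by (metis reduced_closed(1))
    qed
  qed
  then show thesis using that by blast
qed

text \<open>A word of odd length ends with the kind of its first syllable, while \<open>map f q\<close> begins with the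
  other kind; so the product is a plain concatenation, of even length.\<close>

lemma cyc_mult_twist_of_odd:
  assumes hom: "map f \<in> hom Q Q" and f: "\<And>s. fst (f s) \<noteq> fst s" and q: "reduced p q" "odd (length q)"
  shows "cyc_reduced (q \<otimes> map f q)"
proof -
  have "reduced p (map f q)" using hom_in_carrier[OF hom, of q] q by simp
  moreover have "q \<noteq> []" using q by auto
  ultimately have "reduced p (q @ map f q)"
    using q f[of "hd q"] odd_length_reduced_iff[OF q(1)] by (auto simp: reduced_append hd_map)
  then show ?thesis using q \<open>q \<noteq> []\<close> by (simp add: mult_append cyc_reduced_def del: cyc_reducedD)
qed

end

section \<open>Normal forms modulo the centre\<close>

definition gen_elt :: "nat \<Rightarrow> gen \<Rightarrow> gen word set" where
  "gen_elt p c = pres_class (Gpp_rels p) [(c, True)]"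

lemma gx_gen_elt: "gx p = gen_elt p Gen_x" and gy_gen_elt: "gy p = gen_elt p Gen_y"
  by (simp_all add: gen_elt_def gx_def gy_def)

lemma Gpp_universal:
  assumes H: "group H" and f: "\<And>c. f c \<in> carrier H"
    and rel: "f Gen_x [^]\<^bsub>H\<^esub> p = f Gen_y [^]\<^bsub>H\<^esub> p"
  shows "\<exists>F \<in> hom (Gpp p) H. \<forall>c. F (gen_elt p c) = f c"
proof -
  interpret group H by (rule H)
  have "\<exists>F\<in>hom (presented_group (Gpp_rels p)) H. \<forall>w. F (pres_class (Gpp_rels p) w) = word_val H f w"
    by (rule presented_group_universal) (use rel in \<open>auto simp: f Gpp_rels_def word_val_replicate\<close>)
  then obtain F where F: "F \<in> hom (presented_group (Gpp_rels p)) H"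
    and val: "F (pres_class (Gpp_rels p) w) = word_val H f w" for w
    by blast
  have "F (gen_elt p c) = f c" for c
    by (simp add: gen_elt_def val f)
  with F show ?thesis by (auto simp: Gpp_def)
qed

lemma Gpp_hom_unique:
  assumes "group H" "F \<in> hom (Gpp p) H" "F' \<in> hom (Gpp p) H" "\<And>c. F (gen_elt p c) = F' (gen_elt p c)"
    "A \<in> carrier (Gpp p)"
  shows "F A = F' A"
  using assms presented_group_hom_unique[of H F "Gpp_rels p" F'] by (simp add: Gpp_def gen_elt_def)

text \<open>Throughout, \<open>z\<close> is the central element \<open>x^p = y^p\<close>, \<open>e\<close> enumerates the two generators, and \<open>F\<close> is the
  free product \<open>G / \<langle>z\<rangle>\<close> in its concrete form.\<close>

locale amalgam =
  fixes p :: nat and G :: "gen word set monoid" (structure)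
  assumes p2: "2 \<le> p" and G_def: "G = Gpp p"
begin

sublocale group G
  unfolding G_def by (rule group_Gpp)

sublocale Q: free_product p "free_prod p"
  by unfold_locales simp

abbreviation F :: "syllable list monoid" where "F \<equiv> free_prod p"
abbreviation e :: "gen \<Rightarrow> gen word set" where "e \<equiv> gen_elt p"
abbreviation z :: "gen word set" where "z \<equiv> gx p [^] p"

lemma e_closed [simp]: "e c \<in> carrier G"
  using gx_gy_carrier[of p] by (cases c) (simp_all add: G_def gx_gen_elt gy_gen_elt)

lemma e_pow_p: "e c [^] p = z"
  using Gpp_relation[of p] by (cases c) (simp_all add: G_def gx_gen_elt gy_gen_elt)

lemma gx_closed [simp]: "gx p \<in> carrier G"
  by (simp add: gx_gen_elt)

lemma syllable_pow:
  assumes "i \<le> p"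
  shows "[(c, 1)] [^]\<^bsub>F\<^esub> i = (if i = 0 \<or> i = p then [] else [(c, i)])"
  using assms
proof (induction i)
  case (Suc i)
  then have "[(c, 1)] [^]\<^bsub>F\<^esub> i = (if i = 0 then [] else [(c, i)])" by auto
  then show ?case using Suc.prems p2 by (auto simp: Q.mult_eq)
qed simp

lemma reduced_single [simp]: "reduced p [(c, i)] \<longleftrightarrow> 0 < i \<and> i < p"
  by (auto simp: reduced_Cons)

lemma nf_exists: "\<exists>f. f \<in> hom G F \<and> (\<forall>c. f (e c) = [(c, 1)])"
  using Gpp_universal[of F "\<lambda>c. [(c, 1)]" p] p2 Q.is_group syllable_pow[of p]
  by (auto simp: G_def)

definition nf :: "gen word set \<Rightarrow> syllable list" where
  "nf = (SOME f. f \<in> hom G F \<and> (\<forall>c. f (e c) = [(c, 1)]))"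

lemma nf_hom: "nf \<in> hom G F" and nf_e [simp]: "nf (e c) = [(c, 1)]"
  using someI_ex[OF nf_exists] by (simp_all add: nf_def)

sublocale nf: group_hom G F nf
  by unfold_locales (rule nf_hom)

lemma reduced_nf [simp]: "g \<in> carrier G \<Longrightarrow> reduced p (nf g)"
  using nf.hom_closed by simp

text \<open>The exponent sum, which detects the powers of \<open>z\<close> that \<open>nf\<close> forgets.\<close>

definition expo :: "gen word set \<Rightarrow> int" where
  "expo = (SOME f. f \<in> hom G integer_group \<and> (\<forall>c. f (e c) = 1))"

lemma expo_hom: "expo \<in> hom G integer_group" and expo_e [simp]: "expo (e c) = 1"
proof -
  have "\<exists>f. f \<in> hom G integer_group \<and> (\<forall>c. f (e c) = 1)"
    using Gpp_universal[of integer_group "\<lambda>c. 1" p] by (auto simp: G_def)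
  from someI_ex[OF this] show "expo \<in> hom G integer_group" "expo (e c) = 1"
    by (simp_all add: expo_def)
qed

sublocale expo: group_hom G integer_group expo
  by (intro group_hom.intro group_hom_axioms.intro) (simp_all add: expo_hom is_group)

lemma expo_z_pow: "expo (z [^] (k::int)) = k * int p"
  by (simp add: expo.hom_int_pow expo.hom_nat_pow gx_gen_elt)

lemma z_pow_eq_one_iff: "z [^] (k::int) = \<one> \<longleftrightarrow> k = 0"
  using expo_z_pow[of k] p2 by (auto dest!: arg_cong[of _ _ expo] simp: expo_z_pow)

text \<open>Conjugation by \<open>z\<close> fixes both generators, as \<open>z\<close> is a power of each of them.\<close>

lemma z_central:
  assumes g: "g \<in> carrier G"
  shows "z \<otimes> g = g \<otimes> z"
proof -
  have hom: "(\<lambda>h. z \<otimes> h \<otimes> inv z) \<in> hom G G"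
    by (rule homI) (simp_all add: m_assoc inv_solve_left)
  have comm: "z \<otimes> e c = e c \<otimes> z" for c
    by (metis e_closed nat_pow_Suc nat_pow_Suc2 e_pow_p)
  have "z \<otimes> e c \<otimes> inv z = e c" for c
    by (subst comm) (simp add: m_assoc)
  then have "z \<otimes> g \<otimes> inv z = g"
    using Gpp_hom_unique[of G "\<lambda>h. z \<otimes> h \<otimes> inv z" p "\<lambda>h. h" g] hom g is_group
    by (simp add: G_def hom_def)
  then show ?thesis using g by (metis gx_closed inv_solve_right m_closed nat_pow_closed)
qed

lemma z_pow_central: "g \<in> carrier G \<Longrightarrow> z [^] (k::int) \<otimes> g = g \<otimes> z [^] k"
proof -
  assume g: "g \<in> carrier G"
  have "inv g \<otimes> z \<otimes> g = z" using g z_central[OF g] by (simp add: m_assoc) (simp add: m_assoc[symmetric])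
  then have "z [^] k = inv g \<otimes> (z [^] k \<otimes> g)"
    using int_pow_conjugate[of g z k] g by (simp add: m_assoc)
  then show ?thesis using g by (metis gx_closed int_pow_closed inv_solve_left m_closed nat_pow_closed)
qed

lemma nf_z [simp]: "nf z = []"
  using syllable_pow[of p Gen_x] p2 by (simp add: nf.hom_nat_pow gx_gen_elt)

lemma nf_z_pow [simp]: "nf (z [^] (k::int)) = []"
  by (simp add: nf.hom_int_pow)

fun ev :: "syllable list \<Rightarrow> gen word set" where
  "ev [] = \<one>"
| "ev ((c, i) # w) = e c [^] i \<otimes> ev w"

lemma ev_closed [simp]: "ev w \<in> carrier G"
  by (induction w rule: ev.induct) auto

lemma nf_ev [simp]: "reduced p w \<Longrightarrow> nf (ev w) = w"
proof (induction w rule: ev.induct)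
  case (2 c i w)
  then have "0 < i" "i < p" "reduced p w" by (auto simp: reduced_Cons)
  then show ?case
    using 2 syllable_pow[of i c] Q.mult_append[of "[(c, i)]" w]
    by (auto simp: nf.hom_nat_pow)
qed auto

text \<open>Merging two syllables reduces the sum of their exponents modulo \<open>p\<close>, at the cost of a power of \<open>z\<close>.\<close>

lemma ev_syl_mult:
  assumes "reduced p [(c, i)]" "reduced p w"
  shows "\<exists>k::int. e c [^] i \<otimes> ev w = ev (syl_mult p (c, i) w) \<otimes> z [^] k"
proof (cases "\<exists>j v. w = (c, j) # v")
  case True
  then obtain j v where w: "w = (c, j) # v" by blast
  with assms have ij: "i < p" "j < p" "0 < i" "0 < j" by (auto simp: reduced_Cons)
  have eq: "e c [^] i \<otimes> ev w = e c [^] (i + j) \<otimes> ev v"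
    by (simp add: w m_assoc[symmetric] nat_pow_mult)
  show ?thesis
  proof (cases "i + j < p")
    case True
    then show ?thesis using eq w by (intro exI[of _ 0]) simp
  next
    case False
    then have "i + j = p + (i + j - p)" by simp
    then have "e c [^] (i + j) = z \<otimes> e c [^] (i + j - p)"
      by (metis e_closed nat_pow_mult e_pow_p)
    then have "e c [^] i \<otimes> ev w = e c [^] (i + j - p) \<otimes> ev v \<otimes> z"
      using eq z_central[of "e c [^] (i + j - p) \<otimes> ev v"] by (simp add: m_assoc)
    moreover have "(i + j) mod p = i + j - p" if "i + j \<noteq> p"
      using False that ij by (simp add: mod_below_double)
    ultimately show ?thesis using False ij w by (intro exI[of _ 1]) auto
  qed
next
  case False
  then have "syl_mult p (c, i) w = (c, i) # w"
    by (cases "(p, (c, i), w)" rule: syl_mult.cases) auto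
  then show ?thesis by (intro exI[of _ 0]) simp
qed

text \<open>The elements of this form contain \<open>\<one>\<close> and are closed under left multiplication by the generators
  and their inverses, where \<open>e c\<inverse> = (e c)^(p - 1) z\<inverse>\<close>; so they are all of \<open>G\<close>.\<close>

lemma eq_ev_nf: "g \<in> carrier G \<Longrightarrow> \<exists>k::int. g = ev (nf g) \<otimes> z [^] k"
proof -
  let ?P = "\<lambda>g. g \<in> carrier G \<and> (\<exists>k::int. g = ev (nf g) \<otimes> z [^] k)"
  have step: "?P (e c [^] i \<otimes> g)" if "?P g" "0 < i" "i < p" for c i g
  proof -
    obtain k :: int where k: "g = ev (nf g) \<otimes> z [^] k" and g: "g \<in> carrier G" using \<open>?P g\<close> by blast
    have nf: "nf (e c [^] i \<otimes> g) = syl_mult p (c, i) (nf g)"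
      using that syllable_pow[of i c] by (simp add: nf.hom_nat_pow Q.mult_eq)
    obtain k' :: int where "e c [^] i \<otimes> ev (nf g) = ev (syl_mult p (c, i) (nf g)) \<otimes> z [^] k'"
      using ev_syl_mult[of c i "nf g"] \<open>0 < i\<close> \<open>i < p\<close> g by (metis reduced_single reduced_nf)
    then have "e c [^] i \<otimes> g = ev (syl_mult p (c, i) (nf g)) \<otimes> z [^] k' \<otimes> z [^] k"
      by (subst k) (simp add: m_assoc[symmetric])
    then have "e c [^] i \<otimes> g = ev (nf (e c [^] i \<otimes> g)) \<otimes> z [^] (k' + k)"
      unfolding nf by (simp add: int_pow_mult m_assoc)
    with g show ?thesis by (intro conjI exI[of _ "k' + k"]) auto
  qed
  have inv_e: "inv (e c) = e c [^] (p - 1) \<otimes> inv z" for c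
  proof -
    have "e c [^] (p - 1) \<otimes> e c = z" using p2 e_pow_p[of c] nat_pow_Suc[of "e c" "p - 1"] by simp
    then have "inv z = inv (e c) \<otimes> inv (e c [^] (p - 1))" by (metis e_closed inv_mult_group nat_pow_closed)
    then show ?thesis
      using z_pow_central[of "e c [^] (p - 1)" "- 1"] by (simp add: int_pow_neg m_assoc)
  qed
  have shift: "?P (g \<otimes> z [^] k)" if "?P g" for g and k :: int
  proof -
    obtain k' :: int where k': "g = ev (nf g) \<otimes> z [^] k'" and g: "g \<in> carrier G" using \<open>?P g\<close> by blast
    have "nf (g \<otimes> z [^] k) = nf g" using g by simp
    moreover have "g \<otimes> z [^] k = ev (nf g) \<otimes> z [^] (k' + k)"
      by (subst k') (simp add: int_pow_mult m_assoc)
    ultimately show ?thesis using g by (metis gx_closed int_pow_closed m_closed nat_pow_closed)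
  qed
  have "?P (pres_class (Gpp_rels p) w)" for w
  proof (induction w)
    case Nil
    have "pres_class (Gpp_rels p) [] = \<one>" by (simp add: G_def Gpp_def presented_group_def)
    then show ?case by (intro conjI exI[of _ 0]) auto
  next
    case (Cons l w)
    obtain c b where l: "l = (c, b)" by fastforce
    let ?g = "pres_class (Gpp_rels p) w"
    have eq: "pres_class (Gpp_rels p) (l # w) = pres_class (Gpp_rels p) [l] \<otimes> ?g"
      by (simp add: G_def Gpp_def mult_pres_class)
    show ?case
    proof (cases b)
      case True
      then have "pres_class (Gpp_rels p) (l # w) = e c [^] (1::nat) \<otimes> ?g"
        unfolding eq by (simp add: l gen_elt_def[symmetric])
      then show ?thesis using step[OF Cons, of 1 c] p2 by simp
    next
      case False
      have "pres_class (Gpp_rels p) [l] = inv (e c)"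
        using inv_letter_class[of "Gpp_rels p" c] False by (simp add: l gen_elt_def G_def Gpp_def)
      then have "pres_class (Gpp_rels p) (l # w) = e c [^] (p - 1) \<otimes> ?g \<otimes> z [^] (- 1::int)"
        using Cons z_pow_central[of ?g "- 1"] by (simp add: eq inv_e int_pow_neg m_assoc)
      then show ?thesis using shift[OF step[OF Cons, of "p - 1" c], of "-1"] p2 by simp
    qed
  qed
  moreover assume "g \<in> carrier G"
  then obtain w where "g = pres_class (Gpp_rels p) w"
    by (auto simp: G_def Gpp_def presented_group_def)
  ultimately show ?thesis by blast
qed

lemma nf_eq_iff:
  assumes "g \<in> carrier G" "h \<in> carrier G"
  shows "nf g = nf h \<longleftrightarrow> (\<exists>k::int. h = g \<otimes> z [^] k)"
proof
  assume eq: "nf g = nf h"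
  obtain k l :: int where k: "g = ev (nf g) \<otimes> z [^] k" and l: "h = ev (nf g) \<otimes> z [^] l"
    using eq_ev_nf assms eq by metis
  have "g \<otimes> z [^] (l - k) = ev (nf g) \<otimes> z [^] k \<otimes> z [^] (l - k)"
    using arg_cong[OF k, of "\<lambda>x. x \<otimes> z [^] (l - k)"] .
  also have "\<dots> = h"
    by (subst l) (simp add: m_assoc int_pow_mult[symmetric])
  finally have "h = g \<otimes> z [^] (l - k)" by simp
  then show "\<exists>k::int. h = g \<otimes> z [^] k" by blast
qed (use assms in auto)

lemma nf_eq_Nil_iff: "g \<in> carrier G \<Longrightarrow> nf g = [] \<longleftrightarrow> (\<exists>k::int. g = z [^] k)"
  using nf_eq_iff[of \<one> g] by auto

text \<open>If the normal forms commute, the commutator is a power of \<open>z\<close>; as its exponent sum vanishes, it is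
  trivial.\<close>

lemma commute_iff_nf:
  assumes g: "g \<in> carrier G" and h: "h \<in> carrier G"
  shows "g \<otimes> h = h \<otimes> g \<longleftrightarrow> nf g \<otimes>\<^bsub>F\<^esub> nf h = nf h \<otimes>\<^bsub>F\<^esub> nf g"
proof
  assume "nf g \<otimes>\<^bsub>F\<^esub> nf h = nf h \<otimes>\<^bsub>F\<^esub> nf g"
  then have "nf (h \<otimes> g) = nf (g \<otimes> h)" using assms by simp
  then obtain k :: int where k: "g \<otimes> h = h \<otimes> g \<otimes> z [^] k"
    using nf_eq_iff[of "h \<otimes> g" "g \<otimes> h"] assms by auto
  then have "expo (g \<otimes> h) = expo (h \<otimes> g \<otimes> z [^] k)" by simp
  then have "k = 0" using assms p2 by (simp add: expo_z_pow)
  with k show "g \<otimes> h = h \<otimes> g" using assms by simp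
qed (use assms in \<open>metis nf.hom_mult\<close>)


section \<open>Centralizers of loxodromic elements\<close>

text \<open>The edge \<open>u\<langle>z\<rangle>\<close> of the tree lies on the axis of \<open>h\<close>; the metric meaning is established by
  \<open>displacement_inner_min\<close> below.\<close>

definition axial :: "gen word set \<Rightarrow> gen word set \<Rightarrow> bool" where
  "axial h u \<longleftrightarrow> u \<in> carrier G \<and> Q.cyc_reduced (nf (inv u \<otimes> h \<otimes> u))"

text \<open>An algebraic form of hyperbolicity; see \<open>hyperbolic_iff_loxodromic\<close>.\<close>

definition loxodromic :: "gen word set \<Rightarrow> bool" where
  "loxodromic h \<longleftrightarrow> (\<exists>u. axial h u)"

definition lattice :: "gen word set \<Rightarrow> gen word set set" where
  "lattice h = {h [^] j \<otimes> z [^] i |j i. (j::int) \<in> UNIV \<and> (i::int) \<in> UNIV}"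

lemma axial_power:
  fixes j i :: int
  assumes "h \<in> carrier G"
  shows "axial (h [^] j \<otimes> z [^] i) u \<longleftrightarrow> j \<noteq> 0 \<and> axial h u"
proof (cases "u \<in> carrier G")
  case True
  let ?v = "nf (inv u \<otimes> h \<otimes> u)"
  have v: "reduced p ?v" using assms True by simp
  have eq: "nf (inv u \<otimes> (h [^] j \<otimes> z [^] i) \<otimes> u) = ?v [^]\<^bsub>F\<^esub> j"
    using Q.int_pow_conjugate[of "nf u" "nf h" j] assms True
    by (simp add: nf.hom_int_pow)
  show ?thesis
    unfolding axial_def eq
    using True v Q.cyc_int_pow[of ?v j] Q.cyc_of_cyc_int_pow[OF v, of j] Q.cyc_reducedD(2)[of "[]"] by auto
qed (simp add: axial_def)

lemma axial_one: "\<not> axial \<one> u"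
  by (auto simp: axial_def dest: Q.cyc_reducedD(2))

lemma lattice_mult:
  assumes "h \<in> carrier G"
  shows "h [^] (j::int) \<otimes> z [^] (i::int) \<otimes> (h [^] (j'::int) \<otimes> z [^] (i'::int)) = h [^] (j + j') \<otimes> z [^] (i + i')"
proof -
  have "h [^] j \<otimes> z [^] i \<otimes> (h [^] j' \<otimes> z [^] i') = h [^] j \<otimes> (z [^] i \<otimes> h [^] j') \<otimes> z [^] i'"
    using assms by (simp add: m_assoc)
  also have "\<dots> = h [^] j \<otimes> h [^] j' \<otimes> (z [^] i \<otimes> z [^] i')"
    using assms z_pow_central[of "h [^] j'" i] by (simp add: m_assoc)
  finally show ?thesis using assms by (simp add: int_pow_mult)
qed

lemma lattice_inv:
  assumes "h \<in> carrier G"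
  shows "inv (h [^] (j::int) \<otimes> z [^] (i::int)) = h [^] (- j) \<otimes> z [^] (- i)"
  using lattice_mult[OF assms, of "- j" "- i" j i] assms by (intro inv_equality) auto

lemma lattice_pow:
  assumes "h \<in> carrier G"
  shows "(h [^] (j::int) \<otimes> z [^] (i::int)) [^] (n::int) = h [^] (j * n) \<otimes> z [^] (i * n)"
proof -
  have "h [^] j \<otimes> z [^] i = z [^] i \<otimes> h [^] j" using assms z_pow_central[of "h [^] j" i] by simp
  from int_pow_mult_distrib[OF this] show ?thesis using assms by (simp add: int_pow_pow)
qed

text \<open>If \<open>h^j z^i = \<one>\<close> with \<open>j \<noteq> 0\<close>, then \<open>\<one>\<close> would be loxodromic, by \<open>axial_power\<close>.\<close>

lemma lattice_unique:
  assumes h: "h \<in> carrier G" "loxodromic h"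
    and eq: "h [^] (j::int) \<otimes> z [^] (i::int) = h [^] (j'::int) \<otimes> z [^] (i'::int)"
  shows "j = j' \<and> i = i'"
proof -
  have one: "h [^] (j - j') \<otimes> z [^] (i - i') = \<one>"
  proof -
    have "h [^] (j - j') \<otimes> z [^] (i - i') = h [^] j \<otimes> z [^] i \<otimes> inv (h [^] j' \<otimes> z [^] i')"
      using lattice_mult[OF h(1), of j i "- j'" "- i'"] lattice_inv[OF h(1), of j' i'] by simp
    then show ?thesis unfolding eq using h(1) by simp
  qed
  obtain u where "axial h u" using h(2) by (auto simp: loxodromic_def)
  then have j: "j - j' = 0" using axial_power[OF h(1), of "j - j'" "i - i'" u] axial_one one by metis
  then show ?thesis using one h(1) z_pow_eq_one_iff by simp
qed

lemma subgroup_lattice: "h \<in> carrier G \<Longrightarrow> subgroup (lattice h) G"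
proof (rule subgroupI)
  assume h: "h \<in> carrier G"
  show "lattice h \<subseteq> carrier G" using h by (auto simp: lattice_def)
  show "lattice h \<noteq> {}" by (auto simp: lattice_def)
  fix a b assume "a \<in> lattice h" "b \<in> lattice h"
  then show "inv a \<in> lattice h" "a \<otimes> b \<in> lattice h"
    using h lattice_inv lattice_mult unfolding lattice_def by (fastforce, fastforce)
qed

lemma generate_z_eq_lattice:
  assumes h: "h \<in> carrier G"
  shows "generate G {z, h} = lattice h"
proof
  have "h = h [^] (1::int) \<otimes> z [^] (0::int)" "z = h [^] (0::int) \<otimes> z [^] (1::int)" using h by simp_all
  then have "{z, h} \<subseteq> lattice h" unfolding lattice_def by blast
  then show "generate G {z, h} \<subseteq> lattice h"
    using generate_subgroup_incl[OF _ subgroup_lattice[OF h]] by simp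
  have S: "subgroup (generate G {z, h}) G" using h by (intro generate_is_subgroup) auto
  have "h \<in> generate G {z, h}" "z \<in> generate G {z, h}" by (auto intro: generate.incl)
  then show "lattice h \<subseteq> generate G {z, h}"
    using subgroup_int_pow_closed[OF S] subgroup.m_closed[OF S] by (auto simp: lattice_def)
qed

lemma generate_z: "generate G {z} = range (\<lambda>i::int. z [^] i)"
  by (subst generate_pow) auto

lemma cyclic_iso_integers:
  assumes c: "c \<in> carrier G" and inf: "\<And>n::int. c [^] n = \<one> \<Longrightarrow> n = 0"
  shows "subgroup_iso G (generate G {c}) integer_group"
proof -
  have "(\<lambda>n::int. c [^] n) \<in> iso integer_group (G\<lparr>carrier := generate G {c}\<rparr>)"
  proof (rule isoI)
    show "(\<lambda>n::int. c [^] n) \<in> hom integer_group (G\<lparr>carrier := generate G {c}\<rparr>)"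
      using c by (intro homI) (auto simp: generate_pow int_pow_mult)
    have "m = n" if "c [^] m = c [^] n" for m n :: int
      using inf[of "m - n"] that c by (simp add: int_pow_diff)
    then show "bij_betw (\<lambda>n::int. c [^] n) (carrier integer_group) (carrier (G\<lparr>carrier := generate G {c}\<rparr>))"
      using c by (auto simp: bij_betw_def inj_on_def generate_pow)
  qed
  then show ?thesis by (intro group.iso_sym[OF group_integer_group]) (auto simp: is_iso_def)
qed

lemma lattice_iso_integers_squared:
  assumes h: "h \<in> carrier G" "loxodromic h"
  shows "subgroup_iso G (lattice h) (integer_group \<times>\<times> integer_group)"
proof -
  let ?f = "\<lambda>(j::int, i::int). h [^] j \<otimes> z [^] i"
  have "?f \<in> iso (integer_group \<times>\<times> integer_group) (G\<lparr>carrier := lattice h\<rparr>)"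
  proof (rule isoI)
    show "?f \<in> hom (integer_group \<times>\<times> integer_group) (G\<lparr>carrier := lattice h\<rparr>)"
      using h by (intro homI) (auto simp: lattice_def lattice_mult)
    show "bij_betw ?f (carrier (integer_group \<times>\<times> integer_group)) (carrier (G\<lparr>carrier := lattice h\<rparr>))"
      using lattice_unique[OF h] by (auto simp: bij_betw_def inj_on_def lattice_def)
  qed
  then show ?thesis
    by (intro group.iso_sym[OF DirProd_group]) (auto simp: is_iso_def)
qed

text \<open>After conjugation, the normal form of \<open>a\<close> is cyclically reduced and its centralizer in \<open>F\<close> is
  generated by the root \<open>w\<close>; the generator \<open>h\<close> is a lift of \<open>w\<close>, conjugated back. The kernel of \<open>nf\<close>
  contributes the powers of \<open>z\<close>.\<close>

lemma centralizer_loxodromic: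
  assumes a: "a \<in> carrier G" "loxodromic a"
  obtains h and m l :: int where "h \<in> carrier G" "0 < m" "a = h [^] m \<otimes> z [^] l" "loxodromic h"
    "centralizer G a = lattice h"
proof -
  obtain u where u: "u \<in> carrier G" and cyc: "Q.cyc_reduced (nf (inv u \<otimes> a \<otimes> u))"
    using a(2) by (auto simp: loxodromic_def axial_def)
  let ?a = "nf (inv u \<otimes> a \<otimes> u)"
  obtain w and m :: nat where w: "Q.cyc_reduced w" "0 < m" "?a = w [^]\<^bsub>F\<^esub> m"
    and root: "\<And>k. reduced p k \<Longrightarrow> k \<otimes>\<^bsub>F\<^esub> ?a = ?a \<otimes>\<^bsub>F\<^esub> k \<Longrightarrow> \<exists>j::int. k = w [^]\<^bsub>F\<^esub> j"
    using Q.cyc_centralizer[OF cyc] by blast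
  define h where "h = u \<otimes> ev w \<otimes> inv u"
  have h: "h \<in> carrier G" using u by (simp add: h_def)
  have "inv u \<otimes> h \<otimes> u = ev w"
    using u by (simp add: h_def m_assoc) (simp add: m_assoc[symmetric])
  then have nf_h: "nf (inv u \<otimes> h \<otimes> u) = w" using w by simp
  then have "axial h u" using u w by (simp add: axial_def)
  then have lox: "loxodromic h" by (auto simp: loxodromic_def)
  have pow: "\<exists>i::int. k = h [^] j \<otimes> z [^] i"
    if k: "k \<in> carrier G" "nf (inv u \<otimes> k \<otimes> u) = w [^]\<^bsub>F\<^esub> j" for k and j :: int
  proof -
    have "nf (inv u \<otimes> k \<otimes> u) = nf (inv u \<otimes> h [^] j \<otimes> u)"
      using k(2) nf_h nf.hom_int_pow[of "inv u \<otimes> h \<otimes> u" j] int_pow_conjugate[of u h j] h u by simp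
    then have "nf k = nf (h [^] j)" using k(1) h u by simp
    then show ?thesis using nf_eq_iff[of "h [^] j" k] k(1) h by auto
  qed
  obtain l :: int where l: "a = h [^] (int m) \<otimes> z [^] l"
    using pow[of a "int m"] w a by (auto simp: int_pow_int)
  have "centralizer G a = lattice h"
  proof
    show "centralizer G a \<subseteq> lattice h"
    proof
      fix k assume "k \<in> centralizer G a"
      then have k: "k \<in> carrier G" "k \<otimes> a = a \<otimes> k" by (auto simp: centralizer_def)
      let ?k = "inv u \<otimes> k \<otimes> u"
      have conj: "inv u \<otimes> s \<otimes> u \<otimes> (inv u \<otimes> t \<otimes> u) = inv u \<otimes> (s \<otimes> t) \<otimes> u"
        if "s \<in> carrier G" "t \<in> carrier G" for s t
        using that u by (simp add: m_assoc) (simp add: m_assoc[symmetric])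
      have "?k \<otimes> (inv u \<otimes> a \<otimes> u) = inv u \<otimes> a \<otimes> u \<otimes> ?k"
        using conj[OF k(1) a(1)] conj[OF a(1) k(1)] k(2) by simp
      then have "nf ?k \<otimes>\<^bsub>F\<^esub> ?a = ?a \<otimes>\<^bsub>F\<^esub> nf ?k"
        using commute_iff_nf[of ?k "inv u \<otimes> a \<otimes> u"] k u a by blast
      then obtain j :: int where "nf ?k = w [^]\<^bsub>F\<^esub> j"
        using root[of "nf ?k"] k u by auto
      then show "k \<in> lattice h" using pow[of k j] k by (auto simp: lattice_def)
    qed
    show "lattice h \<subseteq> centralizer G a"
      using h l lattice_mult[OF h] by (auto simp: lattice_def centralizer_def add.commute)
  qed
  with h w l lox show thesis using that[of h "int m" l] by simp
qed

text \<open>Otherwise \<open>G\<close> would be a lattice and hence commutative, but \<open>xy\<close> and \<open>yx\<close> have different normal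
  forms.\<close>

lemma loxodromic_not_central:
  assumes a: "a \<in> carrier G" "loxodromic a"
  obtains k where "k \<in> carrier G" "k \<otimes> a \<noteq> a \<otimes> k"
proof (rule ccontr)
  assume "\<not> thesis"
  then have central: "centralizer G a = carrier G" using that by (auto simp: centralizer_def)
  obtain h where "h \<in> carrier G" "centralizer G a = lattice h"
    using centralizer_loxodromic[OF a] by metis
  moreover from this have "e Gen_x \<in> lattice h" "e Gen_y \<in> lattice h"
    using central e_closed by metis+
  then obtain j i j' i' :: int
    where "e Gen_x = h [^] j \<otimes> z [^] i" "e Gen_y = h [^] j' \<otimes> z [^] i'"
    by (auto simp: lattice_def)
  ultimately have "e Gen_x \<otimes> e Gen_y = e Gen_y \<otimes> e Gen_x"
    using lattice_mult[of h j i j' i'] lattice_mult[of h j' i' j i] by (simp add: add.commute)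
  then have "nf (e Gen_x \<otimes> e Gen_y) = nf (e Gen_y \<otimes> e Gen_x)" by simp
  then show False by (simp add: Q.mult_eq)
qed

lemma loxodromic_power:
  "h \<in> carrier G \<Longrightarrow> loxodromic (h [^] (j::int) \<otimes> z [^] (i::int)) \<longleftrightarrow> j \<noteq> 0 \<and> loxodromic h"
  by (auto simp: loxodromic_def axial_power)

text \<open>After conjugation by an edge on the common axis this is \<open>commute_of_same_cyc_conjugators\<close>, lifted
  from \<open>F\<close> to \<open>G\<close> by \<open>commute_iff_nf\<close>.\<close>

lemma commute_of_axial_eq:
  assumes a: "a \<in> carrier G" "loxodromic a" and k: "k \<in> carrier G" "\<And>u. axial a u \<longleftrightarrow> axial k u"
  shows "k \<in> centralizer G a"
proof -
  obtain u where u: "axial a u" using a by (auto simp: loxodromic_def)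
  then have uG: "u \<in> carrier G" by (simp add: axial_def)
  let ?a = "inv u \<otimes> a \<otimes> u" and ?k = "inv u \<otimes> k \<otimes> u"
  have comp: "inv\<^bsub>F\<^esub> v \<otimes>\<^bsub>F\<^esub> nf (inv u \<otimes> s \<otimes> u) \<otimes>\<^bsub>F\<^esub> v = nf (inv (u \<otimes> ev v) \<otimes> s \<otimes> (u \<otimes> ev v))"
    if "reduced p v" "s \<in> carrier G" for s v
    using that uG by (simp add: inv_mult_group Q.inv_mult_group Q.m_assoc)
  have "nf ?k \<otimes>\<^bsub>F\<^esub> nf ?a = nf ?a \<otimes>\<^bsub>F\<^esub> nf ?k"
  proof (rule Q.commute_of_same_cyc_conjugators)
    show "Q.cyc_reduced (nf ?a)" "Q.cyc_reduced (nf ?k)" using u k by (auto simp: axial_def)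
    fix v assume "reduced p v" "Q.cyc_reduced (inv\<^bsub>F\<^esub> v \<otimes>\<^bsub>F\<^esub> nf ?a \<otimes>\<^bsub>F\<^esub> v)"
    then show "Q.cyc_reduced (inv\<^bsub>F\<^esub> v \<otimes>\<^bsub>F\<^esub> nf ?k \<otimes>\<^bsub>F\<^esub> v)"
      using k a uG comp k(2)[of "u \<otimes> ev v"] by (simp add: axial_def)
  qed
  then have "?k \<otimes> ?a = ?a \<otimes> ?k" using commute_iff_nf[of ?k ?a] k a uG by blast
  then have "u \<otimes> (?k \<otimes> ?a) \<otimes> inv u = u \<otimes> (?a \<otimes> ?k) \<otimes> inv u" by simp
  moreover have "u \<otimes> (inv u \<otimes> s \<otimes> u \<otimes> (inv u \<otimes> t \<otimes> u)) \<otimes> inv u = s \<otimes> t"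
    if "s \<in> carrier G" "t \<in> carrier G" for s t
  proof -
    have "u \<otimes> (inv u \<otimes> s \<otimes> u \<otimes> (inv u \<otimes> t \<otimes> u)) \<otimes> inv u = (u \<otimes> inv u) \<otimes> s \<otimes> (u \<otimes> inv u) \<otimes> t \<otimes> (u \<otimes> inv u)"
      using that uG by (simp only: m_assoc m_closed inv_closed)
    then show ?thesis using that uG by simp
  qed
  ultimately show ?thesis using k a by (simp add: centralizer_def)
qed

end

section \<open>The Bass-Serre tree in terms of normal forms\<close>

lemma (in group) l_coset_eq_iff:
  assumes H: "subgroup H G" and g: "g \<in> carrier G" and h: "h \<in> carrier G"
  shows "g <# H = h <# H \<longleftrightarrow> inv g \<otimes> h \<in> H"
proof
  assume "g <# H = h <# H"
  moreover have "h \<in> h <# H" using subgroup.one_closed[OF H] h by (force simp: l_coset_def)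
  ultimately obtain k where "k \<in> H" "h = g \<otimes> k" by (auto simp: l_coset_def)
  then show "inv g \<otimes> h \<in> H" using g subgroup.mem_carrier[OF H] by (simp add: m_assoc[symmetric])
next
  assume k: "inv g \<otimes> h \<in> H"
  have "h = g \<otimes> (inv g \<otimes> h)" using g h by (simp add: m_assoc[symmetric])
  then have "h <# H = g <# ((inv g \<otimes> h) <# H)"
    using g h k subgroup.subset[OF H] by (metis inv_closed lcos_m_assoc m_closed)
  also have "(inv g \<otimes> h) <# H = H"
    using coset_join3[OF _ H k] g h by simp
  finally show "g <# H = h <# H" by simp
qed

context amalgam
begin

abbreviation sub :: "gen \<Rightarrow> gen word set set" where "sub c \<equiv> generate G {e c}"

text \<open>The vertex \<open>g\<langle>x\<rangle>\<close> or \<open>g\<langle>y\<rangle>\<close>, depending on the generator; treating the two types uniformly halves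
  the case distinctions on paths.\<close>

definition vert :: "gen \<Rightarrow> gen word set \<Rightarrow> gen word set bs_vertex" where
  "vert c g = (case c of Gen_x \<Rightarrow> Vx (g <# sub Gen_x) | Gen_y \<Rightarrow> Vy (g <# sub Gen_y))"

definition edge :: "gen word set \<Rightarrow> gen word set set" where
  "edge g = g <# generate G {z}"

lemma subgroup_sub: "subgroup (sub c) G"
  by (intro generate_is_subgroup) auto

lemma nf_e_pow: "nf (e c [^] (j::int)) = [] \<or> (\<exists>i. nf (e c [^] j) = [(c, i)])"
proof -
  define i where "i = nat (j mod int p)"
  have i: "i < p" "j = int p * (j div int p) + int i" using p2 by (simp_all add: i_def nat_less_iff)
  then have "e c [^] j = (e c [^] p) [^] (j div int p) \<otimes> e c [^] i"
    by (metis e_closed int_pow_int int_pow_mult int_pow_pow)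
  then have "nf (e c [^] j) = nf (e c [^] i)" by (simp add: e_pow_p)
  also have "\<dots> = [(c, 1)] [^]\<^bsub>F\<^esub> i" by (simp add: nf.hom_nat_pow)
  finally show ?thesis using syllable_pow[of i c] i by auto
qed

lemma mem_sub_iff:
  assumes k: "k \<in> carrier G"
  shows "k \<in> sub c \<longleftrightarrow> nf k = [] \<or> (\<exists>i. nf k = [(c, i)])"
proof
  assume "k \<in> sub c"
  then show "nf k = [] \<or> (\<exists>i. nf k = [(c, i)])" using nf_e_pow by (auto simp: generate_pow)
next
  assume "nf k = [] \<or> (\<exists>i. nf k = [(c, i)])"
  then obtain i :: nat where "nf k = nf (e c [^] i)"
  proof
    assume "nf k = []"
    then show thesis using that[of 0] by simp
  next
    assume "\<exists>i. nf k = [(c, i)]"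
    then obtain i where i: "nf k = [(c, i)]" ..
    then have "reduced p [(c, i)]" using k reduced_nf by metis
    then show thesis using that[of i] i syllable_pow[of i c] by (auto simp: nf.hom_nat_pow)
  qed
  then obtain l :: int where "k = e c [^] i \<otimes> z [^] l" using nf_eq_iff[of "e c [^] i" k] k by auto
  also have "\<dots> = e c [^] (int i + int p * l)"
    by (simp add: e_pow_p[of c, symmetric] int_pow_mult int_pow_pow[symmetric] int_pow_int)
  finally show "k \<in> sub c" by (auto simp: generate_pow)
qed

lemma vert_eq_iff:
  assumes "g \<in> carrier G" "h \<in> carrier G"
  shows "vert c g = vert d h \<longleftrightarrow> c = d \<and> inv g \<otimes> h \<in> sub c"
  using l_coset_eq_iff[OF subgroup_sub assms] by (cases c; cases d) (simp_all add: vert_def)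

lemma edge_eq_iff:
  assumes "g \<in> carrier G" "h \<in> carrier G"
  shows "edge g = edge h \<longleftrightarrow> nf (inv g \<otimes> h) = []"
proof -
  have "subgroup (generate G {z}) G" by (intro generate_is_subgroup) auto
  then show ?thesis
    using l_coset_eq_iff[OF _ assms] nf_eq_Nil_iff[of "inv g \<otimes> h"] assms
    by (auto simp: edge_def generate_z)
qed

lemma ends_edge:
  assumes g: "g \<in> carrier G"
  shows "end_x p (edge g) = vert Gen_x g" "end_y p (edge g) = vert Gen_y g"
proof -
  have "edge g <#> sub c = g <# sub c" for c
  proof -
    have Z: "subgroup (generate G {z}) G" by (intro generate_is_subgroup) auto
    have zc: "generate G {z} \<subseteq> sub c"
    proof -
      have "z [^] k = e c [^] (int p * k)" for k :: int
        by (simp add: e_pow_p[of c, symmetric] int_pow_pow[symmetric] int_pow_int)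
      then show ?thesis by (auto simp: generate_z generate_pow)
    qed
    have "generate G {z} <#> sub c = sub c"
    proof
      show "generate G {z} <#> sub c \<subseteq> sub c"
        using zc subgroup.m_closed[OF subgroup_sub] by (auto simp: set_mult_def)
      show "sub c \<subseteq> generate G {z} <#> sub c"
        using subgroup.one_closed[OF Z] subgroup.mem_carrier[OF subgroup_sub]
        by (force simp: set_mult_def)
    qed
    then show ?thesis
      using setmult_lcos_assoc[OF subgroup.subset[OF Z] subgroup.subset[OF subgroup_sub] g]
      by (simp add: edge_def)
  qed
  then show "end_x p (edge g) = vert Gen_x g" "end_y p (edge g) = vert Gen_y g"
    by (simp_all add: end_x_def end_y_def vert_def gx_gen_elt gy_gen_elt G_def[symmetric])
qed

lemma lcosets_eq_edges: "lcosets\<^bsub>Gpp p\<^esub> (generate (Gpp p) {gx p [^]\<^bsub>Gpp p\<^esub> p}) = edge ` carrier G"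
  unfolding G_def[symmetric] by (auto simp: LCOSETS_def edge_def)

lemma ex_gen: "(\<exists>c. P c) \<longleftrightarrow> P Gen_x \<or> P Gen_y"
  by (metis gen.exhaust)

lemma adj_iff:
  "(v, w) \<in> bs_adj p \<longleftrightarrow> (\<exists>g\<in>carrier G. \<exists>c d. c \<noteq> d \<and> v = vert c g \<and> w = vert d g)"
proof -
  have "(\<exists>c d. c \<noteq> d \<and> v = vert c g \<and> w = vert d g) \<longleftrightarrow>
      v = vert Gen_x g \<and> w = vert Gen_y g \<or> v = vert Gen_y g \<and> w = vert Gen_x g" for g
    by (simp add: ex_gen)
  then show ?thesis unfolding bs_adj_def lcosets_eq_edges by (auto simp: ends_edge)
qed

text \<open>The least number of factors, taken alternately from the two generating subgroups and beginning
  with \<open>\<langle>e c\<rangle>\<close>, whose product is \<open>w\<close>; one trivial factor is needed if \<open>w\<close> does not begin with a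
  syllable of kind \<open>c\<close>. A walk of \<open>n\<close> edges in the tree from a vertex of type \<open>c\<close> corresponds to a product
  of \<open>n + 1\<close> such factors.\<close>

definition factors_from :: "gen \<Rightarrow> syllable list \<Rightarrow> nat" where
  "factors_from c w = length w + (if w \<noteq> [] \<and> fst (hd w) = c then 0 else 1)"

lemma gen_other: "c \<noteq> d \<Longrightarrow> x \<noteq> c \<longleftrightarrow> x = d" for c d x :: gen
  by (cases c; cases d; cases x) auto

text \<open>The first factor \<open>s\<close> is best chosen as the first syllable of \<open>w\<close> if that has kind \<open>c\<close>, and trivial
  otherwise; no other choice leaves fewer factors.\<close>

lemma factors_from_step:
  assumes w: "reduced p w" and cd: "c \<noteq> d"
  shows "(\<exists>s\<in>sub c. factors_from d (nf (inv s) \<otimes>\<^bsub>F\<^esub> w) \<le> Suc n) \<longleftrightarrow> factors_from c w \<le> Suc (Suc n)"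
proof
  assume "\<exists>s\<in>sub c. factors_from d (nf (inv s) \<otimes>\<^bsub>F\<^esub> w) \<le> Suc n"
  then obtain s where s: "s \<in> sub c" and le: "factors_from d (nf (inv s) \<otimes>\<^bsub>F\<^esub> w) \<le> Suc n" by blast
  have sG: "s \<in> carrier G" using s subgroup.mem_carrier[OF subgroup_sub] by blast
  have "inv s \<in> sub c" using s subgroup.m_inv_closed[OF subgroup_sub] by blast
  then consider "nf (inv s) = []" | i where "nf (inv s) = [(c, i)]"
    using mem_sub_iff[of "inv s"] sG by auto
  then have "factors_from c w \<le> Suc (factors_from d (nf (inv s) \<otimes>\<^bsub>F\<^esub> w))"
  proof cases
    case 1
    then show ?thesis by (simp add: factors_from_def)
  next
    case 2
    then show ?thesis using cd
      by (cases "(p, (c, i), w)" rule: syl_mult.cases) (auto simp: factors_from_def Q.mult_eq)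
  qed
  then show "factors_from c w \<le> Suc (Suc n)" using le by linarith
next
  assume le: "factors_from c w \<le> Suc (Suc n)"
  show "\<exists>s\<in>sub c. factors_from d (nf (inv s) \<otimes>\<^bsub>F\<^esub> w) \<le> Suc n"
  proof (cases "w \<noteq> [] \<and> fst (hd w) = c")
    case True
    then obtain i v where wv: "w = (c, i) # v" by (cases w) auto
    have r: "reduced p [(c, i)]" "reduced p v" "v \<noteq> [] \<Longrightarrow> fst (hd v) = d"
      using w wv gen_other[OF cd] by (auto simp: reduced_Cons)
    have "nf (ev [(c, i)]) = [(c, i)]" using r(1) by (rule nf_ev)
    then have nf: "nf (e c [^] i) = [(c, i)]" by simp
    have "w = [(c, i)] \<otimes>\<^bsub>F\<^esub> v" using w wv Q.mult_append[of "[(c, i)]" v] by simp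
    then have "nf (inv (e c [^] i)) \<otimes>\<^bsub>F\<^esub> w = v"
      using r nf Q.inv_solve_left[of v "[(c, i)]" w] w by (simp del: reduced_single)
    moreover have "factors_from d v \<le> Suc n" using le wv r(3) by (cases v) (auto simp: factors_from_def)
    moreover have "e c [^] i \<in> sub c" using mem_sub_iff[of "e c [^] i" c] nf by simp
    ultimately show ?thesis by metis
  next
    case False
    then have "factors_from d w \<le> Suc n"
      using le gen_other[OF cd, of "fst (hd w)"] by (cases "w = []") (simp_all add: factors_from_def)
    then show ?thesis
      using w subgroup.one_closed[OF subgroup_sub] by (intro bexI[of _ \<one>]) auto
  qed
qed

text \<open>The parity condition is needed because the two vertex types alternate along a walk.\<close>

lemma walk_iff:
  assumes "g \<in> carrier G" and h: "h \<in> carrier G"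
  shows "(vert c g, vert d h) \<in> bs_adj p ^^ n \<longleftrightarrow>
     (even n \<longleftrightarrow> c = d) \<and> factors_from c (nf (inv g \<otimes> h)) \<le> Suc n"
  using assms(1)
proof (induction n arbitrary: c g)
  case 0
  have "factors_from c w \<le> 1 \<longleftrightarrow> w = [] \<or> (\<exists>i. w = [(c, i)])" for w
    by (cases w) (auto simp: factors_from_def)
  then show ?case using 0 h vert_eq_iff[of g h c d] mem_sub_iff[of "inv g \<otimes> h" c] by simp
next
  case (Suc n)
  obtain c' where c': "c \<noteq> c'" by (cases c) auto
  have adj: "(vert c g, v) \<in> bs_adj p \<longleftrightarrow> (\<exists>s\<in>sub c. v = vert c' (g \<otimes> s))" for v
  proof
    assume "(vert c g, v) \<in> bs_adj p"
    then obtain k c1 d1 where k: "k \<in> carrier G" "c1 \<noteq> d1" "vert c g = vert c1 k" "v = vert d1 k"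
      by (auto simp: adj_iff)
    then have "c1 = c" "inv g \<otimes> k \<in> sub c" using vert_eq_iff[of g k] Suc.prems by auto
    moreover have "d1 = c'" using gen_other[OF c'] k(2) \<open>c1 = c\<close> by metis
    moreover have "k = g \<otimes> (inv g \<otimes> k)" using Suc.prems k(1) by (simp add: m_assoc[symmetric])
    ultimately show "\<exists>s\<in>sub c. v = vert c' (g \<otimes> s)" using k(4) by metis
  next
    assume "\<exists>s\<in>sub c. v = vert c' (g \<otimes> s)"
    then obtain s where s: "s \<in> sub c" "v = vert c' (g \<otimes> s)" by blast
    then have sG: "s \<in> carrier G" using subgroup.mem_carrier[OF subgroup_sub] by blast
    have "inv g \<otimes> (g \<otimes> s) = s" using sG Suc.prems by (simp add: m_assoc[symmetric])
    then have "vert c g = vert c (g \<otimes> s)" using vert_eq_iff[of g "g \<otimes> s"] sG s Suc.prems by simp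
    then show "(vert c g, v) \<in> bs_adj p" unfolding adj_iff using s sG Suc.prems c' by blast
  qed
  have "(vert c g, vert d h) \<in> bs_adj p ^^ Suc n \<longleftrightarrow>
      (\<exists>v. (vert c g, v) \<in> bs_adj p \<and> (v, vert d h) \<in> bs_adj p ^^ n)"
    by (meson relpow_Suc_D2 relpow_Suc_I2)
  also have "\<dots> \<longleftrightarrow> (\<exists>s\<in>sub c. (vert c' (g \<otimes> s), vert d h) \<in> bs_adj p ^^ n)"
    by (simp only: adj) blast
  also have "\<dots> \<longleftrightarrow> (\<exists>s\<in>sub c. (even n \<longleftrightarrow> c' = d) \<and>
      factors_from c' (nf (inv s) \<otimes>\<^bsub>F\<^esub> nf (inv g \<otimes> h)) \<le> Suc n)"
  proof (rule bex_cong[OF refl])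
    fix s assume "s \<in> sub c"
    then have s: "s \<in> carrier G" using subgroup.mem_carrier[OF subgroup_sub] by blast
    have "nf (inv (g \<otimes> s) \<otimes> h) = nf (inv s) \<otimes>\<^bsub>F\<^esub> nf (inv g \<otimes> h)"
      using s h Suc.prems by (simp add: inv_mult_group m_assoc Q.m_assoc Q.inv_mult_group)
    then show "(vert c' (g \<otimes> s), vert d h) \<in> bs_adj p ^^ n \<longleftrightarrow> (even n \<longleftrightarrow> c' = d) \<and>
      factors_from c' (nf (inv s) \<otimes>\<^bsub>F\<^esub> nf (inv g \<otimes> h)) \<le> Suc n"
      using Suc.IH[of "g \<otimes> s" c'] s Suc.prems by simp
  qed
  also have "\<dots> \<longleftrightarrow> (even n \<longleftrightarrow> c' = d) \<and> factors_from c (nf (inv g \<otimes> h)) \<le> Suc (Suc n)"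
    using factors_from_step[of "nf (inv g \<otimes> h)" c c' n, OF reduced_nf c'] Suc.prems h by (simp only: m_closed inv_closed) blast
  also have "(even n \<longleftrightarrow> c' = d) \<longleftrightarrow> (even (Suc n) \<longleftrightarrow> c = d)"
    using gen_other[OF c', of d] by auto
  finally show ?case .
qed

text \<open>Of the \<open>length w\<close> syllables of \<open>w\<close>, the first one costs no edge if the walk starts at a
  vertex of its kind, and likewise the last one if the walk ends at a vertex of its kind; parity decides between \<open>length w - 1\<close>,
  \<open>length w\<close> and \<open>length w + 1\<close>.\<close>

lemma bs_vdist_vert:
  assumes g: "g \<in> carrier G" and h: "h \<in> carrier G" and w: "w = nf (inv g \<otimes> h)"
  shows "w = [] \<Longrightarrow> bs_vdist p (vert c g) (vert c h) = 0"
    and "w \<noteq> [] \<Longrightarrow> real (bs_vdist p (vert c g) (vert d h)) =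
      real (length w) - 1 + of_bool (c \<noteq> fst (hd w)) + of_bool (d \<noteq> fst (last w))"
proof -
  have vdist: "bs_vdist p (vert c g) (vert d h) = (LEAST n. (even n \<longleftrightarrow> c = d) \<and> factors_from c w \<le> Suc n)" for c d
    using walk_iff[OF g h] by (simp add: bs_vdist_def w)
  show "bs_vdist p (vert c g) (vert c h) = 0" if "w = []"
    unfolding vdist using that by (intro Least_equality) (auto simp: factors_from_def)
  assume ne: "w \<noteq> []"
  have parity: "odd (length w) \<longleftrightarrow> fst (hd w) = fst (last w)"
    using odd_length_reduced_iff[of p w] ne w g h by simp
  define n where "n = length w - 1 + of_bool (c \<noteq> fst (hd w)) + of_bool (d \<noteq> fst (last w))"
  obtain k where k: "length w = Suc k" using ne by (cases w) auto
  have "bs_vdist p (vert c g) (vert d h) = n"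
    unfolding vdist
  proof (rule Least_equality)
    have par: "even n \<longleftrightarrow> c = d" using parity k
      by (cases c; cases d; cases "fst (hd w)"; cases "fst (last w)") (auto simp: n_def)
    then show "(even n \<longleftrightarrow> c = d) \<and> factors_from c w \<le> Suc n"
      using ne k by (auto simp: factors_from_def n_def)
    fix m assume m: "(even m \<longleftrightarrow> c = d) \<and> factors_from c w \<le> Suc m"
    then have "even m \<longleftrightarrow> even n" using par by simp
    \<comment> \<open>A walk might be one step shorter than \<open>n\<close>, but parity excludes this.\<close>
    moreover have "n \<le> Suc m" using m ne k by (auto simp: factors_from_def n_def split: if_splits)
    ultimately show "n \<le> m" by (cases "n = Suc m") auto
  qed
  then show "real (bs_vdist p (vert c g) (vert d h)) =
      real (length w) - 1 + of_bool (c \<noteq> fst (hd w)) + of_bool (d \<noteq> fst (last w))"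
    by (simp add: n_def k)
qed

text \<open>The distance from the point at parameter \<open>t\<close> of an edge to the endpoint of type \<open>c\<close>.\<close>

definition depth :: "gen \<Rightarrow> real \<Rightarrow> real" where
  "depth c t = (if c = Gen_x then t else 1 - t)"

lemma bs_exits_edge:
  "g \<in> carrier G \<Longrightarrow> bs_exits p (Inner (edge g) t) = range (\<lambda>c. (vert c g, depth c t))"
proof -
  have U: "UNIV = {Gen_x, Gen_y}" using gen.exhaust by auto
  show "g \<in> carrier G \<Longrightarrow> ?thesis" by (auto simp: ends_edge depth_def U)
qed

text \<open>A geodesic leaves the first edge through the endpoint of the kind of the first syllable of \<open>w\<close>, and
  enters the second edge through that of the last syllable: another endpoint lengthens the walk by
  a whole edge and saves less than that inside the edge.\<close>

lemma bs_dist_inner: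
  assumes g: "g \<in> carrier G" and h: "h \<in> carrier G" and w: "w = nf (inv g \<otimes> h)"
    and s: "0 < s" "s < 1" and t: "0 < t" "t < 1"
  shows "bs_dist p (Inner (edge g) s) (Inner (edge h) t) =
    (if w = [] then \<bar>s - t\<bar>
     else real (length w) - 1 + depth (fst (hd w)) s + depth (fst (last w)) t)"
proof (cases "w = []")
  case True
  then show ?thesis using edge_eq_iff[OF g h] w by simp
next
  case False
  let ?d = "\<lambda>c d. depth c s + real (bs_vdist p (vert c g) (vert d h)) + depth d t"
  have set: "{a + real (bs_vdist p u v) + b |u a v b.
      (u, a) \<in> bs_exits p (Inner (edge g) s) \<and> (v, b) \<in> bs_exits p (Inner (edge h) t)}
    = (\<lambda>(c, d). ?d c d) ` UNIV"
    unfolding bs_exits_edge[OF g] bs_exits_edge[OF h]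
    by (auto simp: image_iff) (intro exI conjI, (rule refl)+)
  have U: "UNIV = {Gen_x, Gen_y}" using gen.exhaust by auto
  have "finite (UNIV :: (gen \<times> gen) set)" unfolding UNIV_Times_UNIV[symmetric] by (simp add: U)
  then have "Min ((\<lambda>(c, d). ?d c d) ` UNIV) = ?d (fst (hd w)) (fst (last w))"
  proof (intro Min_eqI finite_imageI)
    fix y assume "y \<in> (\<lambda>(c, d). ?d c d) ` UNIV"
    then obtain c d where y: "y = ?d c d" by auto
    have "depth c' s \<le> depth c s + of_bool (c \<noteq> c')" "depth c' t \<le> depth c t + of_bool (c \<noteq> c')" for c c'
      using s t by (cases c; cases c'; simp add: depth_def)+
    from this(1)[of "fst (hd w)" c] this(2)[of "fst (last w)" d]
    show "?d (fst (hd w)) (fst (last w)) \<le> y"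
      unfolding y bs_vdist_vert(2)[OF g h w False] by simp
  qed auto
  also have "\<dots> = real (length w) - 1 + depth (fst (hd w)) s + depth (fst (last w)) t"
    unfolding bs_vdist_vert(2)[OF g h w False] by simp
  finally show ?thesis
    using False edge_eq_iff[OF g h] w set by (simp add: via_vertices_dist_def)
qed

lemma bs_dist_vert: "bs_dist p (Vert u) (Vert v) = real (bs_vdist p u v)"
  by (simp add: via_vertices_dist_def)

lemma bs_points_eq:
  "bs_points p = {Vert (vert c u) |c u. u \<in> carrier G} \<union>
     {Inner (edge u) t |u t. u \<in> carrier G \<and> 0 < t \<and> t < 1}"
proof -
  have x: "lcosets\<^bsub>Gpp p\<^esub> (generate (Gpp p) {gx p}) = (\<lambda>u. u <# sub Gen_x) ` carrier G"
    and y: "lcosets\<^bsub>Gpp p\<^esub> (generate (Gpp p) {gy p}) = (\<lambda>u. u <# sub Gen_y) ` carrier G"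
    unfolding G_def[symmetric] by (auto simp: LCOSETS_def gx_gen_elt gy_gen_elt)
  have "{Vert (vert c u) |c u. u \<in> carrier G} =
    {Vert (vert Gen_x u) |u. u \<in> carrier G} \<union> {Vert (vert Gen_y u) |u. u \<in> carrier G}"
    by (auto simp: ex_gen)
  then show ?thesis unfolding bs_points_def x y lcosets_eq_edges by (auto simp: vert_def)
qed

lemma bs_act_vert:
  assumes "h \<in> carrier G" "u \<in> carrier G"
  shows "bs_act p h (Vert (vert c u)) = Vert (vert c (h \<otimes> u))"
  using lcos_m_assoc[OF subgroup.subset[OF subgroup_sub] assms]
  by (cases c) (simp_all add: vert_def G_def[symmetric])

lemma bs_act_inner:
  assumes "h \<in> carrier G" "u \<in> carrier G"
  shows "bs_act p h (Inner (edge u) t) = Inner (edge (h \<otimes> u)) t"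
  using lcos_m_assoc[of "generate G {z}" h u] generate_incl[of "{z}"] assms
  by (simp add: edge_def G_def[symmetric])

section \<open>Displacements, translation lengths and axes\<close>

lemma displacement_vert:
  assumes "h \<in> carrier G" "u \<in> carrier G" and w: "w = nf (inv u \<otimes> h \<otimes> u)"
  shows "bs_dist p (Vert (vert c u)) (bs_act p h (Vert (vert c u))) =
    (if w = [] then 0
     else real (length w) - 1 + of_bool (c \<noteq> fst (hd w)) + of_bool (c \<noteq> fst (last w)))"
proof -
  have "w = nf (inv u \<otimes> (h \<otimes> u))" using assms by (simp add: m_assoc)
  then show ?thesis
    using bs_vdist_vert[of u "h \<otimes> u" w c] assms(1,2)
    by (simp only: bs_act_vert bs_dist_vert) simp
qed

lemma displacement_inner:
  assumes "h \<in> carrier G" "u \<in> carrier G" "0 < t" "t < 1" and w: "w = nf (inv u \<otimes> h \<otimes> u)"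
  shows "bs_dist p (Inner (edge u) t) (bs_act p h (Inner (edge u) t)) =
    (if w = [] then 0 else real (length w) - 1 + depth (fst (hd w)) t + depth (fst (last w)) t)"
proof -
  have "w = nf (inv u \<otimes> (h \<otimes> u))" using assms by (simp add: m_assoc)
  then show ?thesis
    using bs_dist_inner[of u "h \<otimes> u" w t t] assms(1-4)
    by (simp only: bs_act_inner) simp
qed

lemma displacement_nonneg:
  assumes "h \<in> carrier G" "P \<in> bs_points p"
  shows "0 \<le> bs_dist p P (bs_act p h P)"
proof -
  have l: "1 \<le> real (length w)" if "w \<noteq> []" for w :: "syllable list"
    using that by (cases w) auto
  from assms(2) consider c u where "P = Vert (vert c u)" "u \<in> carrier G"
    | u t where "P = Inner (edge u) t" "u \<in> carrier G" "0 < t" "t < 1"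
    unfolding bs_points_eq by blast
  then show ?thesis
  proof cases
    case 1
    then show ?thesis using displacement_vert[OF assms(1) 1(2) refl, of c] l[of "nf (inv u \<otimes> h \<otimes> u)"]
      by (simp del: bs_dist.simps bs_act.simps)
  next
    case 2
    then show ?thesis using displacement_inner[OF assms(1) 2(2-4) refl] l[of "nf (inv u \<otimes> h \<otimes> u)"]
      by (simp add: depth_def del: bs_dist.simps bs_act.simps)
  qed
qed


text \<open>Among the conjugates of \<open>h\<close>, those with cyclically reduced normal form all have the same length, and
  all others are longer; being of odd length, they are longer by at least one.\<close>

lemma length_conjugate_axial:
  assumes h: "h \<in> carrier G" and u0: "axial h u0" and u: "u \<in> carrier G"
  shows "axial h u \<Longrightarrow> length (nf (inv u \<otimes> h \<otimes> u)) = length (nf (inv u0 \<otimes> h \<otimes> u0))"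
    and "\<not> axial h u \<Longrightarrow> length (nf (inv u0 \<otimes> h \<otimes> u0)) < length (nf (inv u \<otimes> h \<otimes> u))"
proof -
  define v where "v = nf (inv u0 \<otimes> u)"
  have u0G: "u0 \<in> carrier G" and cyc: "Q.cyc_reduced (nf (inv u0 \<otimes> h \<otimes> u0))" using u0 by (auto simp: axial_def)
  have v: "reduced p v" using u u0G by (simp add: v_def)
  have "inv u \<otimes> h \<otimes> u = inv (inv u0 \<otimes> u) \<otimes> (inv u0 \<otimes> h \<otimes> u0) \<otimes> (inv u0 \<otimes> u)"
  proof -
    have "inv (inv u0 \<otimes> u) \<otimes> (inv u0 \<otimes> h \<otimes> u0) \<otimes> (inv u0 \<otimes> u)
      = inv u \<otimes> (u0 \<otimes> inv u0) \<otimes> h \<otimes> (u0 \<otimes> inv u0) \<otimes> u"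
      using u u0G h by (simp only: inv_mult_group inv_inv m_assoc m_closed inv_closed)
    then show ?thesis using u u0G h by simp
  qed
  then have eq: "nf (inv u \<otimes> h \<otimes> u) = inv\<^bsub>F\<^esub> v \<otimes>\<^bsub>F\<^esub> nf (inv u0 \<otimes> h \<otimes> u0) \<otimes>\<^bsub>F\<^esub> v"
    using u u0G h by (simp add: v_def)
  show "length (nf (inv u \<otimes> h \<otimes> u)) = length (nf (inv u0 \<otimes> h \<otimes> u0))" if "axial h u"
    unfolding eq using that Q.length_cyc_conjugate_eq[OF cyc v] by (simp only: axial_def eq)
  assume "\<not> axial h u"
  have le: "length (nf (inv u0 \<otimes> h \<otimes> u0)) \<le> length (nf (inv u \<otimes> h \<otimes> u))"
    unfolding eq by (rule Q.length_cyc_le_conjugate[OF cyc v])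
  have "reduced p (nf (inv u \<otimes> h \<otimes> u))" using u h by simp
  moreover have "nf (inv u \<otimes> h \<otimes> u) \<noteq> []" using le Q.cyc_reducedD(2)[OF cyc] by auto
  ultimately have "odd (length (nf (inv u \<otimes> h \<otimes> u)))"
    using \<open>\<not> axial h u\<close> u by (simp only: axial_def Q.cyc_reduced_def) blast
  moreover have "even (length (nf (inv u0 \<otimes> h \<otimes> u0)))" using cyc by (simp only: Q.cyc_reduced_def)
  ultimately show "length (nf (inv u0 \<otimes> h \<otimes> u0)) < length (nf (inv u \<otimes> h \<otimes> u))"
    using le by (metis le_neq_implies_less)
qed

lemma displacement_axial_vert:
  assumes h: "h \<in> carrier G" and u: "axial h u"
  shows "bs_dist p (Vert (vert c u)) (bs_act p h (Vert (vert c u))) = length (nf (inv u \<otimes> h \<otimes> u))"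
proof -
  have uG: "u \<in> carrier G" and w: "Q.cyc_reduced (nf (inv u \<otimes> h \<otimes> u))" using u by (auto simp: axial_def)
  have ne: "nf (inv u \<otimes> h \<otimes> u) \<noteq> []"
    "fst (hd (nf (inv u \<otimes> h \<otimes> u))) \<noteq> fst (last (nf (inv u \<otimes> h \<otimes> u)))"
    using w by (auto simp only: Q.cyc_reduced_iff)
  show ?thesis
    using displacement_vert[OF h uG refl, of c] ne(1) gen_other[OF ne(2), of c] ne(2)
    by (simp del: nf.hom_mult bs_dist.simps bs_act.simps)
qed

text \<open>A vertex lies on the axis if one of its incident edges does. If the normal form \<open>w\<close> at the edge \<open>u\<close>
  has odd length and the displacement is nevertheless minimal, then \<open>w\<close> begins and ends with
  syllables of kind \<open>c\<close>; turning around the vertex by the first of them reaches an incident edge on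
  the axis.\<close>

lemma displacement_vert_min:
  fixes L :: nat and d :: real
  assumes h: "h \<in> carrier G" and u0: "axial h u0" and u: "u \<in> carrier G"
    and L: "L = length (nf (inv u0 \<otimes> h \<otimes> u0))"
    and d_def: "d = bs_dist p (Vert (vert c u)) (bs_act p h (Vert (vert c u)))"
  shows "real L \<le> d" and "d = real L \<longleftrightarrow> (\<exists>k. axial h k \<and> vert c k = vert c u)"
proof -
  define w where "w = nf (inv u \<otimes> h \<otimes> u)"
  have attained: "d = real L" if "axial h k" "vert c k = vert c u" for k
    using displacement_axial_vert[OF h that(1), of c] length_conjugate_axial(1)[OF h u0 _ that(1)] that
    by (simp only: d_def L axial_def)
  have "real L \<le> d \<and> (d = real L \<longrightarrow> (\<exists>k. axial h k \<and> vert c k = vert c u))"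
  proof (cases "axial h u")
    case True
    then show ?thesis using attained[OF True refl] by auto
  next
    case False
    then have less: "L < length w" using length_conjugate_axial(2)[OF h u0 u False] by (simp only: L w_def)
    then have ne: "w \<noteq> []" by auto
    have r: "reduced p w" using u h by (simp add: w_def)
    have "odd (length w)" using False u r ne by (simp only: axial_def Q.cyc_reduced_def w_def) blast
    then have same: "fst (hd w) = fst (last w)" using odd_length_reduced_iff[OF r ne] by simp
    have d: "d = real (length w) - 1 + (if c = fst (hd w) then 0 else 2)"
      using displacement_vert[OF h u w_def, of c] ne same by (simp only: d_def) simp
    have "\<exists>k. axial h k \<and> vert c k = vert c u" if "d = real L"
    proof -
      have len: "length w = Suc L" "c = fst (hd w)" using that d less by (auto split: if_splits)
      have "L \<noteq> 0" using u0 L Q.cyc_reducedD(2) by (auto simp only: axial_def length_0_conv)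
      with len obtain s r' where "w = s # r'" "r' \<noteq> []" by (cases w) auto
      then obtain m t where w: "w = s # m @ [t]" by (metis append_butlast_last_id)
      have s: "reduced p [s]" "fst s = c" using r w len by (auto simp: reduced_Cons)
      define k where "k = u \<otimes> ev [s]"
      have k: "k \<in> carrier G" using u by (simp only: k_def m_closed ev_closed)
      have nf_s: "nf (ev [s]) = [s]" using s by simp
      have "nf (inv k \<otimes> h \<otimes> k) = inv\<^bsub>F\<^esub> [s] \<otimes>\<^bsub>F\<^esub> w \<otimes>\<^bsub>F\<^esub> [s]"
        using u h s nf_s ev_closed[of "[s]"] unfolding k_def w_def
        by (simp add: inv_mult_group Q.inv_mult_group Q.m_assoc del: ev.simps)
      then have "length (nf (inv k \<otimes> h \<otimes> k)) \<le> Suc (length m)"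
        using Q.length_shorten_conjugate[of s m t s] r s w same by simp
      then have "\<not> L < length (nf (inv k \<otimes> h \<otimes> k))" using len w by simp
      then have "axial h k" using length_conjugate_axial(2)[OF h u0 k] L by blast
      moreover have "vert c k = vert c u"
      proof -
        have "inv u \<otimes> k = ev [s]" using u ev_closed[of "[s]"] by (simp add: k_def m_assoc[symmetric] del: ev.simps)
        moreover have "ev [s] \<in> sub c" using mem_sub_iff[of "ev [s]" c] nf_s s(2) by (cases s) (simp del: ev.simps)
        ultimately show ?thesis using vert_eq_iff[OF u k, of c c] by simp
      qed
      ultimately show ?thesis by blast
    qed
    moreover have "real L \<le> d" using d less by simp
    ultimately show ?thesis by blast
  qed
  with attained show "real L \<le> d" "d = real L \<longleftrightarrow> (\<exists>k. axial h k \<and> vert c k = vert c u)" by blast+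
qed

text \<open>For a word of even length the two depths belong to different endpoints and add up to \<open>1\<close>; for an
  odd one their sum is positive, and the word is longer than the minimum.\<close>

lemma displacement_inner_min:
  fixes L :: nat and d :: real
  assumes h: "h \<in> carrier G" and u0: "axial h u0" and u: "u \<in> carrier G" and t: "0 < t" "t < 1"
    and L: "L = length (nf (inv u0 \<otimes> h \<otimes> u0))"
    and d_def: "d = bs_dist p (Inner (edge u) t) (bs_act p h (Inner (edge u) t))"
  shows "real L \<le> d" and "d = real L \<longleftrightarrow> axial h u"
proof -
  define w where "w = nf (inv u \<otimes> h \<otimes> u)"
  have d: "d = (if w = [] then 0 else real (length w) - 1 + depth (fst (hd w)) t + depth (fst (last w)) t)"
    unfolding d_def by (rule displacement_inner[OF h u t w_def])
  have "real L \<le> d \<and> (d = real L \<longleftrightarrow> axial h u)"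
  proof (cases "axial h u")
    case True
    then have "w \<noteq> []" "fst (hd w) \<noteq> fst (last w)" by (auto simp only: axial_def Q.cyc_reduced_iff w_def)
    then have "depth (fst (hd w)) t + depth (fst (last w)) t = 1"
      by (cases "fst (hd w)"; cases "fst (last w)") (auto simp: depth_def)
    then have "d = length w" using d \<open>w \<noteq> []\<close> by simp
    then show ?thesis using True length_conjugate_axial(1)[OF h u0 u True] by (simp only: L w_def) simp
  next
    case False
    then have less: "L < length w" using length_conjugate_axial(2)[OF h u0 u False] by (simp only: L w_def)
    have "0 < depth c t" for c using t by (simp add: depth_def)
    then have "0 < depth (fst (hd w)) t + depth (fst (last w)) t" by (simp add: add_pos_pos)
    moreover have "w \<noteq> []" using less by auto
    ultimately have "real L < d" using d less by simp
    with False show ?thesis by simp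
  qed
  then show "real L \<le> d" "d = real L \<longleftrightarrow> axial h u" by blast+
qed

lemma transl_len_axial:
  assumes h: "h \<in> carrier G" and u0: "axial h u0"
  shows "transl_len p h = length (nf (inv u0 \<otimes> h \<otimes> u0))"
  unfolding transl_len_def
proof (rule cInf_eq_minimum)
  have u0G: "u0 \<in> carrier G" using u0 by (simp add: axial_def)
  let ?P = "Vert (vert Gen_x u0)"
  have "?P \<in> bs_points p" using u0G unfolding bs_points_eq by blast
  then show "real (length (nf (inv u0 \<otimes> h \<otimes> u0))) \<in> (\<lambda>z. bs_dist p z (bs_act p h z)) ` bs_points p"
    by (rule rev_image_eqI) (rule displacement_axial_vert[OF h u0, symmetric])
  fix x assume "x \<in> (\<lambda>z. bs_dist p z (bs_act p h z)) ` bs_points p"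
  then show "real (length (nf (inv u0 \<otimes> h \<otimes> u0))) \<le> x"
    unfolding bs_points_eq
    using displacement_vert_min(1)[OF h u0 _ refl refl] displacement_inner_min(1)[OF h u0 _ _ _ refl refl] by blast
qed

text \<open>An element that is not loxodromic is conjugate to a single syllable modulo \<open>z\<close>, or is a power of \<open>z\<close>;
  in either case it fixes a vertex.\<close>

lemma hyperbolic_iff_loxodromic:
  assumes h: "h \<in> carrier G"
  shows "hyperbolic p h \<longleftrightarrow> loxodromic h"
proof
  assume "loxodromic h"
  then obtain u where u: "axial h u" by (auto simp: loxodromic_def)
  then have "nf (inv u \<otimes> h \<otimes> u) \<noteq> []" by (auto simp only: axial_def Q.cyc_reduced_def)
  then show "hyperbolic p h"
    unfolding hyperbolic_def transl_len_axial[OF h u] by (metis length_greater_0_conv of_nat_0_less_iff)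
next
  assume hyp: "hyperbolic p h"
  show "loxodromic h"
  proof (rule ccontr)
    assume not: "\<not> loxodromic h"
    obtain v where v: "reduced p v" and
      short: "length (inv\<^bsub>F\<^esub> v \<otimes>\<^bsub>F\<^esub> nf h \<otimes>\<^bsub>F\<^esub> v) \<le> 1 \<or> Q.cyc_reduced (inv\<^bsub>F\<^esub> v \<otimes>\<^bsub>F\<^esub> nf h \<otimes>\<^bsub>F\<^esub> v)"
      using Q.conjugate_to_short_or_cyc[OF reduced_nf[OF h]] by blast
    define w where "w = nf (inv (ev v) \<otimes> h \<otimes> ev v)"
    have eq: "w = inv\<^bsub>F\<^esub> v \<otimes>\<^bsub>F\<^esub> nf h \<otimes>\<^bsub>F\<^esub> v" using h v by (simp add: w_def)
    have "\<not> Q.cyc_reduced w" using not by (auto simp: loxodromic_def axial_def w_def)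
    then have "length w \<le> 1" using short unfolding eq[symmetric] by blast
    then have "w = [] \<or> (\<exists>s. w = [s])" by (cases w) simp_all
    then have "bs_dist p (Vert (vert (fst (hd w)) (ev v))) (bs_act p h (Vert (vert (fst (hd w)) (ev v)))) = 0"
      using displacement_vert[OF h ev_closed w_def, of "fst (hd w)"] by (auto simp del: bs_dist.simps bs_act.simps)
    moreover have "Vert (vert (fst (hd w)) (ev v)) \<in> bs_points p"
      unfolding bs_points_eq using ev_closed by blast
    moreover have "bdd_below ((\<lambda>z. bs_dist p z (bs_act p h z)) ` bs_points p)"
      using displacement_nonneg[OF h] by (intro bdd_belowI2[of _ 0])
    ultimately have "transl_len p h \<le> 0"
      unfolding transl_len_def by - (rule cINF_lower2[OF _ _ eq_refl])
    then show False using hyp by (simp add: hyperbolic_def)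
  qed
qed

lemma axis_eq_iff:
  assumes h: "h \<in> carrier G" "loxodromic h" and k: "k \<in> carrier G" "loxodromic k"
  shows "axis p h = axis p k \<longleftrightarrow> (\<forall>u. axial h u \<longleftrightarrow> axial k u)"
proof
  have inner: "Inner (edge u) t \<in> axis p s \<longleftrightarrow> axial s u"
    if s: "s \<in> carrier G" "loxodromic s" and "u \<in> carrier G" "0 < t" "t < 1" for s u t
  proof -
    obtain u0 where u0: "axial s u0" using s by (auto simp: loxodromic_def)
    have "Inner (edge u) t \<in> bs_points p" using that unfolding bs_points_eq by blast
    then show ?thesis
      using displacement_inner_min(2)[OF s(1) u0 that(3-5) refl refl] transl_len_axial[OF s(1) u0]
      by (simp only: axis_def mem_Collect_eq simp_thms)
  qed
  have vert: "Vert (vert c u) \<in> axis p s \<longleftrightarrow> (\<exists>k. axial s k \<and> vert c k = vert c u)"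
    if s: "s \<in> carrier G" "loxodromic s" and "u \<in> carrier G" for s u c
  proof -
    obtain u0 where u0: "axial s u0" using s by (auto simp: loxodromic_def)
    have "Vert (vert c u) \<in> bs_points p" using that unfolding bs_points_eq by blast
    then show ?thesis
      using displacement_vert_min(2)[OF s(1) u0 that(3) refl refl] transl_len_axial[OF s(1) u0]
      by (simp only: axis_def mem_Collect_eq simp_thms)
  qed
  show "axis p h = axis p k" if "\<forall>u. axial h u \<longleftrightarrow> axial k u"
  proof (rule Set.set_eqI)
    fix P
    show "P \<in> axis p h \<longleftrightarrow> P \<in> axis p k"
    proof (cases "P \<in> bs_points p")
      case True
      then show ?thesis
        unfolding bs_points_eq using inner[OF h] inner[OF k] vert[OF h] vert[OF k] that by auto
    qed (simp add: axis_def)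
  qed
  assume eq: "axis p h = axis p k"
  have "axial h u \<longleftrightarrow> axial k u" if "u \<in> carrier G" for u
    using inner[OF h that, of "1/2"] inner[OF k that, of "1/2"] eq by simp
  then show "\<forall>u. axial h u \<longleftrightarrow> axial k u" by (auto simp: axial_def)
qed

lemma transl_len_power:
  assumes h: "h \<in> carrier G" "loxodromic h" and j: "j \<noteq> (0::int)"
  shows "transl_len p (h [^] j \<otimes> z [^] (i::int)) = \<bar>j\<bar> * transl_len p h"
proof -
  obtain u where u: "axial h u" using h by (auto simp: loxodromic_def)
  then have uG: "u \<in> carrier G" and cyc: "Q.cyc_reduced (nf (inv u \<otimes> h \<otimes> u))" by (auto simp: axial_def)
  have "axial (h [^] j \<otimes> z [^] i) u" using axial_power[OF h(1)] u j by blast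
  moreover have "nf (inv u \<otimes> (h [^] j \<otimes> z [^] i) \<otimes> u) = nf (inv u \<otimes> h \<otimes> u) [^]\<^bsub>F\<^esub> j"
    using Q.int_pow_conjugate[of "nf u" "nf h" j] h uG by (simp add: nf.hom_int_pow)
  ultimately have "transl_len p (h [^] j \<otimes> z [^] i) = length (nf (inv u \<otimes> h \<otimes> u) [^]\<^bsub>F\<^esub> j)"
    using transl_len_axial[of "h [^] j \<otimes> z [^] i" u] h by simp
  also have "\<dots> = nat \<bar>j\<bar> * length (nf (inv u \<otimes> h \<otimes> u))"
    using Q.length_cyc_int_pow[OF cyc, of j] by (simp only:)
  finally show ?thesis using transl_len_axial[OF h(1) u] by simp
qed

text \<open>The elements sharing the axis of \<open>a\<close> commute with \<open>a\<close>, so they are the \<open>h^j z^i\<close> with \<open>j \<noteq> 0\<close>, and the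
  translation length of such an element is proportional to \<open>\<bar>j\<bar>\<close>.\<close>

lemma min_translation_iff:
  assumes h: "h \<in> carrier G" "loxodromic h" and a: "a = h [^] m \<otimes> z [^] (l::int)" "m \<noteq> (0::int)"
    and C: "centralizer G a = lattice h"
  shows "min_translation_along p a k \<longleftrightarrow> (\<exists>(j::int) (i::int). \<bar>j\<bar> = 1 \<and> k = h [^] j \<otimes> z [^] i)"
proof -
  have aG: "a \<in> carrier G" "loxodromic a" using a h loxodromic_power by auto
  have pos: "0 < transl_len p h" using hyperbolic_iff_loxodromic[OF h(1)] h by (simp add: hyperbolic_def)
  have same_axis: "hyperbolic p k \<and> axis p k = axis p a \<longleftrightarrow> (\<exists>(j::int) (i::int). j \<noteq> 0 \<and> k = h [^] j \<otimes> z [^] i)"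
    if k: "k \<in> carrier G" for k
  proof
    assume "hyperbolic p k \<and> axis p k = axis p a"
    then have lox: "loxodromic k" and ax: "axis p a = axis p k" using hyperbolic_iff_loxodromic[OF k] by auto
    then have "\<forall>u. axial a u \<longleftrightarrow> axial k u" using axis_eq_iff[OF aG k lox] by simp
    then have "k \<in> lattice h" using commute_of_axial_eq[OF aG k] C by simp
    then obtain j i :: int where k_eq: "k = h [^] j \<otimes> z [^] i" by (auto simp: lattice_def)
    have "j \<noteq> 0" using lox loxodromic_power[OF h(1), of j i] by (simp add: k_eq)
    with k_eq show "\<exists>(j::int) (i::int). j \<noteq> 0 \<and> k = h [^] j \<otimes> z [^] i"
      by (intro exI[of _ j] exI[of _ i] conjI)
  next
    assume "\<exists>(j::int) (i::int). j \<noteq> 0 \<and> k = h [^] j \<otimes> z [^] i"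
    then obtain j i :: int where ji: "j \<noteq> 0" "k = h [^] j \<otimes> z [^] i" by blast
    then have lox: "loxodromic k" using loxodromic_power[OF h(1)] h by blast
    have "axial k u \<longleftrightarrow> axial a u" for u using ji a axial_power[OF h(1)] by simp
    then show "hyperbolic p k \<and> axis p k = axis p a"
      using axis_eq_iff[OF k lox aG] hyperbolic_iff_loxodromic[OF k] lox by blast
  qed
  have min: "min_translation_along p a k \<longleftrightarrow> k \<in> carrier G \<and> hyperbolic p k \<and> axis p k = axis p a \<and>
      (\<forall>k'\<in>carrier G. hyperbolic p k' \<and> axis p k' = axis p a \<longrightarrow> transl_len p k \<le> transl_len p k')"
    by (simp add: min_translation_along_def G_def)
  show ?thesis
  proof
    assume k: "min_translation_along p a k"
    then obtain j i :: int where ji: "j \<noteq> 0" "k = h [^] j \<otimes> z [^] i" using same_axis unfolding min by blast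
    have "h = h [^] (1::int) \<otimes> z [^] (0::int)" using h by simp
    then have "hyperbolic p h \<and> axis p h = axis p a" using same_axis[OF h(1)] one_neq_zero by metis
    then have "transl_len p k \<le> transl_len p h" using k h(1) unfolding min by simp
    then have "\<bar>real_of_int j\<bar> * transl_len p h \<le> 1 * transl_len p h"
      using transl_len_power[OF h ji(1), of i] ji(2) by simp
    then have "\<bar>real_of_int j\<bar> \<le> 1" using pos by (simp only: mult_le_cancel_right_pos)
    then have "\<bar>j\<bar> = 1" using ji(1) by linarith
    with ji(2) show "\<exists>(j::int) (i::int). \<bar>j\<bar> = 1 \<and> k = h [^] j \<otimes> z [^] i" by blast
  next
    assume "\<exists>(j::int) (i::int). \<bar>j\<bar> = 1 \<and> k = h [^] j \<otimes> z [^] i"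
    then obtain j i :: int where ji: "\<bar>j\<bar> = 1" "k = h [^] j \<otimes> z [^] i" by blast
    then have j0: "j \<noteq> 0" and j1: "\<bar>real_of_int j\<bar> = 1" by linarith+
    have kG: "k \<in> carrier G" using ji h by simp
    have "transl_len p k \<le> transl_len p k'"
      if k': "k' \<in> carrier G" "hyperbolic p k' \<and> axis p k' = axis p a" for k'
    proof -
      obtain j' i' :: int where j': "j' \<noteq> 0" "k' = h [^] j' \<otimes> z [^] i'" using same_axis[OF k'(1)] k'(2) by blast
      have "1 \<le> \<bar>real_of_int j'\<bar>" using j'(1) by linarith
      then have "1 * transl_len p h \<le> \<bar>real_of_int j'\<bar> * transl_len p h"
        using pos by (intro mult_right_mono) auto
      then show ?thesis
        using transl_len_power[OF h j'(1), of i'] transl_len_power[OF h j0, of i] j'(2) ji(2) j1 by simp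
    qed
    moreover have "hyperbolic p k \<and> axis p k = axis p a" using same_axis[OF kG] ji(2) j0 by blast
    ultimately show "min_translation_along p a k" unfolding min using kG by blast
  qed
qed

lemma lattice_generator_change:
  assumes h: "h \<in> carrier G" and j: "\<bar>j\<bar> = (1::int)"
  shows "lattice (h [^] j \<otimes> z [^] (i::int)) = lattice h"
proof
  have shift: "(h [^] j \<otimes> z [^] i) [^] n \<otimes> z [^] k = h [^] (j * n) \<otimes> z [^] (i * n + k)" for n k :: int
    using h by (simp add: lattice_pow m_assoc int_pow_mult)
  then show "lattice (h [^] j \<otimes> z [^] i) \<subseteq> lattice h" by (auto simp: lattice_def)
  have jj: "j * (j * n) = n" for n using j by (auto simp: abs_if split: if_splits)
  have "h [^] n \<otimes> z [^] k = (h [^] j \<otimes> z [^] i) [^] (j * n) \<otimes> z [^] (k - i * (j * n))" for n k :: int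
    by (simp add: shift jj)
  then show "lattice h \<subseteq> lattice (h [^] j \<otimes> z [^] i)" unfolding lattice_def by blast
qed

end

section \<open>Twisted conjugation\<close>

lemma (in group) AutoGroup_mult:
  "\<alpha> \<in> auto G \<Longrightarrow> \<beta> \<in> auto G \<Longrightarrow> \<alpha> \<otimes>\<^bsub>AutoGroup G\<^esub> \<beta> = compose (carrier G) \<alpha> \<beta>"
  by (simp add: AutoGroup_def BijGroup_def auto_def)

lemma (in group) carrier_AutoGroup: "carrier (AutoGroup G) = auto G"
  by (simp add: AutoGroup_def)

lemma (in group) one_AutoGroup: "\<one>\<^bsub>AutoGroup G\<^esub> = (\<lambda>h\<in>carrier G. h)"
  by (simp add: AutoGroup_def BijGroup_def)

lemma (in group) inner_aut_auto:
  assumes a: "a \<in> carrier G"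
  shows "inner_aut G a \<in> auto G"
proof -
  have cancel: "b \<otimes> (inv b \<otimes> h \<otimes> b) \<otimes> inv b = h" "inv b \<otimes> (b \<otimes> h \<otimes> inv b) \<otimes> b = h"
    if "b \<in> carrier G" "h \<in> carrier G" for b h
  proof -
    have "b \<otimes> (inv b \<otimes> h \<otimes> b) \<otimes> inv b = (b \<otimes> inv b) \<otimes> h \<otimes> (b \<otimes> inv b)"
      "inv b \<otimes> (b \<otimes> h \<otimes> inv b) \<otimes> b = (inv b \<otimes> b) \<otimes> h \<otimes> (inv b \<otimes> b)"
      using that by (simp_all only: m_assoc m_closed inv_closed)
    then show "b \<otimes> (inv b \<otimes> h \<otimes> b) \<otimes> inv b = h" "inv b \<otimes> (b \<otimes> h \<otimes> inv b) \<otimes> b = h"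
      using that by simp_all
  qed
  have "bij_betw (inner_aut G a) (carrier G) (carrier G)"
    using a cancel[OF a] by (intro bij_betw_byWitness[where f' = "\<lambda>h. inv a \<otimes> h \<otimes> a"]) (auto simp: inner_aut_def)
  moreover have "inner_aut G a \<in> hom G G"
  proof (rule homI)
    fix s t assume s: "s \<in> carrier G" and t: "t \<in> carrier G"
    have "a \<otimes> s \<otimes> inv a \<otimes> (a \<otimes> t \<otimes> inv a) = a \<otimes> s \<otimes> (inv a \<otimes> a) \<otimes> t \<otimes> inv a"
      using a s t by (simp only: m_assoc m_closed inv_closed)
    then show "inner_aut G a (s \<otimes> t) = inner_aut G a s \<otimes> inner_aut G a t"
      using a s t by (simp add: inner_aut_def m_assoc)
  qed (use a in \<open>auto simp: inner_aut_def\<close>)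
  ultimately show ?thesis by (simp add: auto_def Bij_def inner_aut_def)
qed

lemma (in group) inner_aut_mult:
  assumes "a \<in> carrier G" "b \<in> carrier G"
  shows "inner_aut G a \<otimes>\<^bsub>AutoGroup G\<^esub> inner_aut G b = inner_aut G (a \<otimes> b)"
  unfolding AutoGroup_mult[OF inner_aut_auto[OF assms(1)] inner_aut_auto[OF assms(2)]]
  using assms by (auto simp: compose_def inner_aut_def inv_mult_group m_assoc fun_eq_iff)

lemma (in group) inner_aut_pow:
  assumes "a \<in> carrier G"
  shows "inner_aut G a [^]\<^bsub>AutoGroup G\<^esub> (n::nat) = inner_aut G (a [^] n)"
proof (induction n)
  case 0
  show ?case by (auto simp: one_AutoGroup inner_aut_def)
next
  case (Suc n)
  then show ?case using assms inner_aut_mult[of "a [^] n" a] by simp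
qed

lemma (in group) inner_aut_eq_one_iff:
  assumes a: "a \<in> carrier G"
  shows "inner_aut G a = \<one>\<^bsub>AutoGroup G\<^esub> \<longleftrightarrow> (\<forall>h\<in>carrier G. h \<otimes> a = a \<otimes> h)"
proof -
  have "inner_aut G a = \<one>\<^bsub>AutoGroup G\<^esub> \<longleftrightarrow> (\<forall>h\<in>carrier G. a \<otimes> h \<otimes> inv a = h)"
    by (auto simp: one_AutoGroup inner_aut_def fun_eq_iff restrict_def)
  also have "a \<otimes> h \<otimes> inv a = h \<longleftrightarrow> h \<otimes> a = a \<otimes> h" if "h \<in> carrier G" for h
    using that a by (metis inv_solve_right inv_closed m_closed)
  then have "(\<forall>h\<in>carrier G. a \<otimes> h \<otimes> inv a = h) \<longleftrightarrow> (\<forall>h\<in>carrier G. h \<otimes> a = a \<otimes> h)" by blast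
  finally show ?thesis .
qed

text \<open>A common frame for \<open>\<theta> = \<sigma>\<close> and \<open>\<theta> = \<sigma>\<tau>\<close>: on normal forms \<open>\<theta>\<close> acts syllable by syllable through a map
  \<open>f\<close> that exchanges the two kinds, and on the centre it acts by the sign \<open>\<epsilon>\<close>.\<close>

locale twisted_conjugation = amalgam +
  fixes \<theta> :: "gen word set \<Rightarrow> gen word set" and f :: "syllable \<Rightarrow> syllable"
    and \<epsilon> :: int and g :: "gen word set"
  assumes theta_auto: "\<theta> \<in> auto G"
    and theta_theta_e: "\<theta> (\<theta> (e c)) = e c"
    and nf_theta_e: "nf (\<theta> (e c)) = [f (c, 1)]"
    and theta_z: "\<theta> z = z [^] \<epsilon>"
    and f_hom: "map f \<in> hom F F"
    and f_type: "fst (f s) \<noteq> fst s"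
    and g_closed [simp]: "g \<in> carrier G"
begin

lemma theta_hom: "\<theta> \<in> hom G G"
  using theta_auto by (simp add: auto_def)

sublocale \<theta>: group_hom G G \<theta>
  by (intro group_hom.intro group_hom_axioms.intro theta_hom is_group)

lemma theta_theta [simp]: "h \<in> carrier G \<Longrightarrow> \<theta> (\<theta> h) = h"
  using Gpp_hom_unique[of G "\<theta> \<circ> \<theta>" p "\<lambda>h. h" h] hom_compose[OF theta_hom theta_hom] is_group theta_theta_e
  by (simp add: G_def[symmetric] hom_def)

lemma nf_theta: "h \<in> carrier G \<Longrightarrow> nf (\<theta> h) = map f (nf h)"
proof -
  have "(\<lambda>h. nf (\<theta> h)) \<in> hom G F" by (rule homI) simp_all
  moreover have "(\<lambda>h. map f (nf h)) \<in> hom G F"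
    using hom_mult[OF f_hom] hom_in_carrier[OF f_hom] by (intro homI) simp_all
  ultimately show "h \<in> carrier G \<Longrightarrow> ?thesis"
    using Gpp_hom_unique[of F "\<lambda>h. nf (\<theta> h)" p "\<lambda>h. map f (nf h)" h] Q.is_group nf_theta_e
    by (simp add: G_def[symmetric])
qed

lemma theta_z_pow: "\<theta> (z [^] (k::int)) = z [^] (\<epsilon> * k)"
  by (simp only: \<theta>.hom_int_pow gx_closed nat_pow_closed theta_z int_pow_pow)

definition a :: "gen word set" where "a = g \<otimes> \<theta> g"

definition \<phi> :: "gen word set \<Rightarrow> gen word set" where
  "\<phi> = compose (carrier G) (inner_aut G g) \<theta>"

lemma a_closed [simp]: "a \<in> carrier G"
  by (simp add: a_def)

lemma phi_apply: "h \<in> carrier G \<Longrightarrow> \<phi> h = g \<otimes> \<theta> h \<otimes> inv g"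
  by (simp add: \<phi>_def compose_def inner_aut_def)

lemma phi_auto: "\<phi> \<in> auto G"
proof -
  interpret A: group "AutoGroup G" by (rule AutoGroup)
  have "inner_aut G g \<otimes>\<^bsub>AutoGroup G\<^esub> \<theta> \<in> carrier (AutoGroup G)"
    using inner_aut_auto[OF g_closed] theta_auto by (intro A.m_closed) (simp_all add: carrier_AutoGroup)
  then show ?thesis
    using AutoGroup_mult[OF inner_aut_auto[OF g_closed] theta_auto] by (simp add: \<phi>_def carrier_AutoGroup)
qed

sublocale \<phi>: group_hom G G \<phi>
  using phi_auto by (intro group_hom.intro group_hom_axioms.intro is_group) (simp add: auto_def)

lemma phi_phi: "h \<in> carrier G \<Longrightarrow> \<phi> (\<phi> h) = a \<otimes> h \<otimes> inv a"
  by (simp add: phi_apply a_def inv_mult_group m_assoc)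

lemma phi_squared: "\<phi> \<otimes>\<^bsub>AutoGroup G\<^esub> \<phi> = inner_aut G a"
  unfolding AutoGroup_mult[OF phi_auto phi_auto]
  by (auto simp: compose_def inner_aut_def phi_phi fun_eq_iff restrict_def)

lemma phi_a: "\<phi> a = a"
  by (simp add: phi_apply a_def m_assoc)

lemma phi_z_pow: "\<phi> (z [^] (k::int)) = z [^] (\<epsilon> * k)"
proof -
  have "\<phi> (z [^] k) = z [^] (\<epsilon> * k) \<otimes> g \<otimes> inv g"
    using z_pow_central[of g "\<epsilon> * k"] by (simp only: phi_apply int_pow_closed nat_pow_closed gx_closed theta_z_pow g_closed)
  then show ?thesis by (simp add: m_assoc)
qed

text \<open>In the first case \<open>\<phi>\<close> maps the edge \<open>u\<langle>z\<rangle>\<close> to itself and, exchanging the vertex types, inverts it;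
  in the second case \<open>\<phi>\<close> translates along the axis of \<open>a\<close>.\<close>

lemma inversion_or_loxodromic:
  "(\<exists>u\<in>carrier G. \<exists>k::int. g = u \<otimes> z [^] k \<otimes> inv (\<theta> u)) \<or> loxodromic a"
proof -
  obtain v where v: "reduced p v" and
    alt: "inv\<^bsub>F\<^esub> v \<otimes>\<^bsub>F\<^esub> nf g \<otimes>\<^bsub>F\<^esub> map f v = [] \<or> odd (length (inv\<^bsub>F\<^esub> v \<otimes>\<^bsub>F\<^esub> nf g \<otimes>\<^bsub>F\<^esub> map f v))"
    using Q.twisted_conjugate_trivial_or_odd[OF f_hom f_type reduced_nf[OF g_closed]] by blast
  define u where "u = ev v"
  have u: "u \<in> carrier G" by (simp add: u_def)
  define g' where "g' = inv u \<otimes> g \<otimes> \<theta> u"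
  have g': "g' \<in> carrier G" using u by (simp add: g'_def)
  have nf_g': "nf g' = inv\<^bsub>F\<^esub> v \<otimes>\<^bsub>F\<^esub> nf g \<otimes>\<^bsub>F\<^esub> map f v"
    using u v by (simp add: g'_def nf_theta) (simp add: u_def)
  have g: "g = u \<otimes> g' \<otimes> inv (\<theta> u)"
  proof -
    have "u \<otimes> g' \<otimes> inv (\<theta> u) = (u \<otimes> inv u) \<otimes> g \<otimes> (\<theta> u \<otimes> inv (\<theta> u))"
      unfolding g'_def using u by (simp only: m_assoc m_closed inv_closed \<theta>.hom_closed g_closed)
    then show ?thesis using u by simp
  qed
  show ?thesis
  proof (cases "nf g' = []")
    case True
    then obtain k :: int where "g' = z [^] k" using nf_eq_Nil_iff[OF g'] by blast
    with g u show ?thesis by blast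
  next
    case False
    then have "odd (length (nf g'))" using alt nf_g' by simp
    then have "Q.cyc_reduced (nf g' \<otimes>\<^bsub>F\<^esub> map f (nf g'))"
      by (intro Q.cyc_mult_twist_of_odd[OF f_hom f_type reduced_nf[OF g']])
    then have cyc: "Q.cyc_reduced (nf (g' \<otimes> \<theta> g'))" using g' nf_theta[OF g'] by simp
    have "inv u \<otimes> a \<otimes> u = g' \<otimes> \<theta> g'"
      unfolding a_def g'_def using u by (simp add: m_assoc) (simp add: m_assoc[symmetric])
    then have "axial a u" using cyc u by (simp add: axial_def)
    then show ?thesis by (auto simp: loxodromic_def)
  qed
qed

text \<open>If \<open>a\<close> is loxodromic, its powers are too, so none of them is central and no power of \<open>\<phi>\<^sup>2 = \<iota>\<^sub>a\<close> is
  trivial. Otherwise \<open>a\<close> is a power of \<open>z\<close>, and \<open>\<phi>\<^sup>2\<close> is the identity.\<close>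

lemma finite_order_iff: "has_finite_order (AutoGroup G) \<phi> \<longleftrightarrow> \<not> loxodromic a"
proof
  interpret A: group "AutoGroup G" by (rule AutoGroup)
  have phiA: "\<phi> \<in> carrier (AutoGroup G)" using phi_auto by (simp add: carrier_AutoGroup)
  show "\<not> loxodromic a" if fin: "has_finite_order (AutoGroup G) \<phi>"
  proof
    assume lox: "loxodromic a"
    obtain n :: nat where n: "0 < n" "\<phi> [^]\<^bsub>AutoGroup G\<^esub> n = \<one>\<^bsub>AutoGroup G\<^esub>"
      using fin by (auto simp: has_finite_order_def)
    have "inner_aut G (a [^] n) = (\<phi> [^]\<^bsub>AutoGroup G\<^esub> (2::nat)) [^]\<^bsub>AutoGroup G\<^esub> n"
      using phiA by (simp add: inner_aut_pow[symmetric] phi_squared[symmetric] numeral_2_eq_2)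
    also have "\<dots> = (\<phi> [^]\<^bsub>AutoGroup G\<^esub> n) [^]\<^bsub>AutoGroup G\<^esub> (2::nat)"
      using phiA by (simp only: A.nat_pow_pow mult.commute)
    finally have "inner_aut G (a [^] n) = \<one>\<^bsub>AutoGroup G\<^esub>" using n(2) by simp
    then have central: "\<forall>h\<in>carrier G. h \<otimes> a [^] n = a [^] n \<otimes> h"
      using inner_aut_eq_one_iff[of "a [^] n"] by simp
    have "loxodromic (a [^] n)"
      using loxodromic_power[of a "int n" 0] lox n(1) by (simp add: int_pow_int)
    then show False using loxodromic_not_central[of "a [^] n"] central by (metis a_closed nat_pow_closed)
  qed
  assume "\<not> loxodromic a"
  then obtain u and k :: int where u: "u \<in> carrier G" and g: "g = u \<otimes> z [^] k \<otimes> inv (\<theta> u)"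
    using inversion_or_loxodromic by blast
  have "\<theta> g = \<theta> u \<otimes> z [^] (\<epsilon> * k) \<otimes> inv u"
    unfolding g using u by (simp add: theta_z_pow)
  then have "a = u \<otimes> z [^] k \<otimes> inv (\<theta> u) \<otimes> (\<theta> u \<otimes> z [^] (\<epsilon> * k) \<otimes> inv u)"
    unfolding a_def using g by simp
  also have "\<dots> = u \<otimes> z [^] k \<otimes> (inv (\<theta> u) \<otimes> \<theta> u) \<otimes> z [^] (\<epsilon> * k) \<otimes> inv u"
    using u by (simp only: m_assoc m_closed inv_closed \<theta>.hom_closed int_pow_closed nat_pow_closed gx_closed)
  also have "\<dots> = u \<otimes> (z [^] (k + \<epsilon> * k) \<otimes> inv u)"
    using u by (simp add: int_pow_mult m_assoc)
  also have "\<dots> = z [^] (k + \<epsilon> * k)"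
    using u z_pow_central[of "inv u" "k + \<epsilon> * k"] by (simp add: m_assoc[symmetric])
  finally have "a = z [^] (k + \<epsilon> * k)" .
  then have "h \<otimes> a = a \<otimes> h" if "h \<in> carrier G" for h
    using z_pow_central[OF that, of "k + \<epsilon> * k"] by (simp only:)
  then have "\<forall>h\<in>carrier G. h \<otimes> a = a \<otimes> h" by blast
  then have "inner_aut G a = \<one>\<^bsub>AutoGroup G\<^esub>" by (simp only: inner_aut_eq_one_iff[OF a_closed])
  then have "\<phi> [^]\<^bsub>AutoGroup G\<^esub> (2::nat) = \<one>\<^bsub>AutoGroup G\<^esub>"
    using phiA phi_squared by (simp add: numeral_2_eq_2)
  then show "has_finite_order (AutoGroup G) \<phi>"
    unfolding has_finite_order_def by (intro exI[of _ 2]) simp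
qed

text \<open>A fixed point of \<open>\<phi>\<close>, conjugated by \<open>u\<close>, becomes a fixed point of \<open>\<theta>\<close>. Its normal form cannot have
  a first syllable, because \<open>\<theta>\<close> would change the kind of that syllable.\<close>

lemma Fix_if_not_loxodromic:
  assumes "\<not> loxodromic a"
  shows "Fix G \<phi> = {z [^] i |i::int. z [^] (\<epsilon> * i) = z [^] i}"
proof
  show "{z [^] i |i::int. z [^] (\<epsilon> * i) = z [^] i} \<subseteq> Fix G \<phi>"
  proof clarify
    fix i :: int assume "z [^] (\<epsilon> * i) = z [^] i"
    then have "\<phi> (z [^] i) = z [^] i" by (simp only: phi_z_pow)
    moreover have "z [^] i \<in> carrier G" by simp
    ultimately show "z [^] i \<in> Fix G \<phi>" unfolding Fix_def by blast
  qed
  obtain u and k :: int where u: "u \<in> carrier G" and g: "g = u \<otimes> z [^] k \<otimes> inv (\<theta> u)"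
    using inversion_or_loxodromic assms by blast
  show "Fix G \<phi> \<subseteq> {z [^] i |i::int. z [^] (\<epsilon> * i) = z [^] i}"
  proof
    fix h assume "h \<in> Fix G \<phi>"
    then have h: "h \<in> carrier G" "\<phi> h = h" by (auto simp: Fix_def)
    define h' where "h' = inv u \<otimes> h \<otimes> u"
    have h': "h' \<in> carrier G" using u h by (simp add: h'_def)
    have "h = u \<otimes> z [^] k \<otimes> inv (\<theta> u) \<otimes> \<theta> h \<otimes> inv (u \<otimes> z [^] k \<otimes> inv (\<theta> u))"
      using h phi_apply[OF h(1)] g by simp
    also have "\<dots> = u \<otimes> (z [^] k \<otimes> (inv (\<theta> u) \<otimes> \<theta> h \<otimes> \<theta> u) \<otimes> inv (z [^] k)) \<otimes> inv u"
      using u h(1) by (simp add: inv_mult_group m_assoc)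
    also have "inv (\<theta> u) \<otimes> \<theta> h \<otimes> \<theta> u = \<theta> h'" using u h(1) by (simp add: h'_def)
    also have "z [^] k \<otimes> \<theta> h' \<otimes> inv (z [^] k) = \<theta> h'"
      using z_pow_central[of "\<theta> h'" k] h' by (simp add: m_assoc)
    finally have "h = u \<otimes> \<theta> h' \<otimes> inv u" .
    then have "h' = (inv u \<otimes> u) \<otimes> \<theta> h' \<otimes> (inv u \<otimes> u)"
      unfolding h'_def using u h' by (metis \<theta>.hom_closed h'_def inv_closed m_assoc m_closed)
    then have "\<theta> h' = h'" using u h' by simp
    then have "map f (nf h') = nf h'" using nf_theta[OF h'] by simp
    then have "nf h' = []"
      using f_type[of "hd (nf h')"] by (cases "nf h' = []") (auto dest: arg_cong[of _ _ hd] simp: hd_map)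
    then obtain i :: int where i: "h' = z [^] i" using nf_eq_Nil_iff[OF h'] by blast
    have "h = u \<otimes> h' \<otimes> inv u"
    proof -
      have "u \<otimes> h' \<otimes> inv u = (u \<otimes> inv u) \<otimes> h \<otimes> (u \<otimes> inv u)"
        unfolding h'_def using u h(1) by (simp only: m_assoc m_closed inv_closed)
      then show ?thesis using u h(1) by simp
    qed
    also have "\<dots> = z [^] i \<otimes> u \<otimes> inv u" using z_pow_central[OF u, of i] by (simp only: i)
    also have "\<dots> = z [^] i" using u by (simp add: m_assoc)
    finally have "h = z [^] i" .
    moreover from this have "z [^] (\<epsilon> * i) = z [^] i" using h(2) phi_z_pow[of i] by simp
    ultimately show "h \<in> {z [^] i |i::int. z [^] (\<epsilon> * i) = z [^] i}" by blast
  qed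
qed

lemma Fix_subset_centralizer: "Fix G \<phi> \<subseteq> centralizer G a"
proof
  fix h assume "h \<in> Fix G \<phi>"
  then have h: "h \<in> carrier G" "\<phi> (\<phi> h) = h" by (auto simp: Fix_def)
  then have "a \<otimes> h \<otimes> inv a = h" using phi_phi by simp
  then have "h \<otimes> a = a \<otimes> h" using h(1) by (metis a_closed inv_solve_right inv_closed m_closed)
  then show "h \<in> centralizer G a" using h(1) by (simp add: centralizer_def)
qed

text \<open>\<open>\<phi>\<close> fixes \<open>a\<close> and so preserves its centralizer. Comparing exponents in \<open>\<phi>(a) = a\<close> leaves one unknown,
  the exponent \<open>i\<close> in \<open>\<phi>(h) = h z^i\<close>.\<close>

lemma phi_on_lattice:
  assumes h: "h \<in> carrier G" "loxodromic h" and a: "a = h [^] m \<otimes> z [^] (l::int)" "(m::int) \<noteq> 0"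
    and C: "centralizer G a = lattice h"
  obtains i :: int where "i * m = (1 - \<epsilon>) * l"
    "\<And>r s::int. \<phi> (h [^] r \<otimes> z [^] s) = h [^] r \<otimes> z [^] (i * r + \<epsilon> * s)"
proof -
  have "h = h [^] (1::int) \<otimes> z [^] (0::int)" using h by simp
  then have "h \<in> lattice h" unfolding lattice_def by blast
  then have "h \<otimes> a = a \<otimes> h" using C by (auto simp: centralizer_def)
  then have "\<phi> h \<otimes> a = a \<otimes> \<phi> h" using phi_a h by (metis \<phi>.hom_mult a_closed)
  then have "\<phi> h \<in> lattice h" using C h by (auto simp: centralizer_def)
  then obtain j i :: int where ji: "\<phi> h = h [^] j \<otimes> z [^] i" by (auto simp: lattice_def)
  have pow: "\<phi> (h [^] r \<otimes> z [^] s) = h [^] (j * r) \<otimes> z [^] (i * r + \<epsilon> * s)" for r s :: int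
  proof -
    have "\<phi> (h [^] r \<otimes> z [^] s) = (h [^] j \<otimes> z [^] i) [^] r \<otimes> z [^] (\<epsilon> * s)"
      using h by (simp only: \<phi>.hom_mult \<phi>.hom_int_pow[of h] int_pow_closed nat_pow_closed gx_closed phi_z_pow ji)
    then show ?thesis using h by (simp add: lattice_pow int_pow_mult m_assoc)
  qed
  have "h [^] (j * m) \<otimes> z [^] (i * m + \<epsilon> * l) = h [^] m \<otimes> z [^] l"
    using pow[of m l] phi_a a by simp
  then have "j * m = m \<and> i * m + \<epsilon> * l = l" by (rule lattice_unique[OF h])
  then have "j = 1" "i * m = (1 - \<epsilon>) * l" using a(2) by (auto simp: algebra_simps)
  then show thesis using that pow by simp
qed


section \<open>The fixed subgroups\<close>

lemma Fix_if_center_fixed: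
  assumes eps: "\<epsilon> = 1"
  shows "\<not> loxodromic a \<Longrightarrow> Fix G \<phi> = generate G {z} \<and> subgroup_iso G (Fix G \<phi>) integer_group"
    and "loxodromic a \<Longrightarrow> Fix G \<phi> = centralizer G a
        \<and> subgroup_iso G (Fix G \<phi>) (integer_group \<times>\<times> integer_group)
        \<and> hyperbolic p a
        \<and> (\<exists>h. min_translation_along p a h)
        \<and> (\<forall>h. min_translation_along p a h \<longrightarrow> Fix G \<phi> = generate G {z, h})"
proof -
  assume "\<not> loxodromic a"
  then have "Fix G \<phi> = generate G {z}"
    unfolding generate_z Fix_if_not_loxodromic[OF \<open>\<not> loxodromic a\<close>] eps by auto
  moreover have "subgroup_iso G (generate G {z}) integer_group"
    using z_pow_eq_one_iff by (intro cyclic_iso_integers) auto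
  ultimately show "Fix G \<phi> = generate G {z} \<and> subgroup_iso G (Fix G \<phi>) integer_group" by simp
next
  assume lox: "loxodromic a"
  obtain h and m l :: int where h: "h \<in> carrier G" "loxodromic h" and m: "0 < m" "a = h [^] m \<otimes> z [^] l"
    and C: "centralizer G a = lattice h"
    using centralizer_loxodromic[OF a_closed lox] by metis
  have m0: "m \<noteq> 0" using m by simp
  obtain i :: int where i: "i * m = (1 - \<epsilon>) * l"
    and phi: "\<And>r s::int. \<phi> (h [^] r \<otimes> z [^] s) = h [^] r \<otimes> z [^] (i * r + \<epsilon> * s)"
    using phi_on_lattice[OF h m(2) m0 C] by metis
  have "i = 0" using i m0 eps by simp
  then have "k \<in> Fix G \<phi>" if k: "k \<in> lattice h" for k
  proof -
    obtain r s :: int where "k = h [^] r \<otimes> z [^] s" using k by (auto simp: lattice_def)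
    then show ?thesis using phi[of r s] eps \<open>i = 0\<close> h by (simp add: Fix_def)
  qed
  then have Fix: "Fix G \<phi> = lattice h" using Fix_subset_centralizer C by blast
  note min = min_translation_iff[OF h m(2) m0 C]
  have "\<bar>1::int\<bar> = 1" by simp
  then have "\<exists>k. min_translation_along p a k" using min by blast
  moreover have "Fix G \<phi> = generate G {z, k}" if k: "min_translation_along p a k" for k
  proof -
    obtain j s :: int where js: "\<bar>j\<bar> = 1" "k = h [^] j \<otimes> z [^] s" using min k by blast
    then have "generate G {z, k} = lattice k" using h by (intro generate_z_eq_lattice) simp
    also have "\<dots> = lattice h" unfolding js(2) by (rule lattice_generator_change[OF h(1) js(1)])
    finally show ?thesis using Fix by simp
  qed
  ultimately show "Fix G \<phi> = centralizer G a
        \<and> subgroup_iso G (Fix G \<phi>) (integer_group \<times>\<times> integer_group)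
        \<and> hyperbolic p a
        \<and> (\<exists>h. min_translation_along p a h)
        \<and> (\<forall>h. min_translation_along p a h \<longrightarrow> Fix G \<phi> = generate G {z, h})"
    using Fix C lattice_iso_integers_squared[OF h] hyperbolic_iff_loxodromic[OF a_closed] lox by simp
qed

text \<open>In the loxodromic case the equation \<open>i r = 2 s\<close> for a fixed point \<open>h^r z^s\<close> is linear and homogeneous,
  so a root of a fixed point in \<open>C(a)\<close> is fixed as well. Every cyclic subgroup containing \<open>a\<close> lies in
  \<open>C(a)\<close>, hence in the fixed subgroup.\<close>

lemma Fix_if_center_inverted:
  assumes eps: "\<epsilon> = - 1"
  shows "\<not> loxodromic a \<Longrightarrow> Fix G \<phi> = {\<one>}"
    and "loxodromic a \<Longrightarrow> a \<in> carrier G - center G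
        \<and> is_max_cyclic G a (Fix G \<phi>)
        \<and> subgroup_iso G (Fix G \<phi>) integer_group"
proof -
  assume not: "\<not> loxodromic a"
  have "z [^] (- i) = z [^] i \<longleftrightarrow> i = 0" for i :: int
  proof
    assume "z [^] (- i) = z [^] i"
    then have "expo (z [^] (- i)) = expo (z [^] i)" by simp
    then show "i = 0" using p2 by (simp only: expo_z_pow) auto
  qed simp
  then have "{z [^] i |i::int. z [^] (- 1 * i) = z [^] i} = {z [^] (0::int)}" by simp
  then show "Fix G \<phi> = {\<one>}" unfolding Fix_if_not_loxodromic[OF not] eps by simp
next
  assume lox: "loxodromic a"
  obtain h and m l :: int where h: "h \<in> carrier G" "loxodromic h" and m: "0 < m" "a = h [^] m \<otimes> z [^] l"
    and C: "centralizer G a = lattice h"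
    using centralizer_loxodromic[OF a_closed lox] by metis
  have m0: "m \<noteq> 0" using m by simp
  obtain i :: int where phi: "\<And>r s::int. \<phi> (h [^] r \<otimes> z [^] s) = h [^] r \<otimes> z [^] (i * r + \<epsilon> * s)"
    using phi_on_lattice[OF h m(2) m0 C] by metis
  have Fix_iff: "h [^] r \<otimes> z [^] s \<in> Fix G \<phi> \<longleftrightarrow> i * r = 2 * s" for r s :: int
  proof -
    have "h [^] r \<otimes> z [^] s \<in> Fix G \<phi> \<longleftrightarrow> i * r - s = s"
      using lattice_unique[OF h, of r "i * r - s" r s] h by (auto simp: Fix_def phi eps)
    then show ?thesis by auto
  qed
  \<comment> \<open>The primitive solution of \<open>i r = 2 s\<close> with \<open>r > 0\<close>.\<close>
  define r0 s0 :: int where "r0 = (if even i then 1 else 2)" and "s0 = (if even i then i div 2 else i)"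
  define c where "c = h [^] r0 \<otimes> z [^] s0"
  have c: "c \<in> carrier G" using h by (simp add: c_def)
  have c_pow: "c [^] n = h [^] (r0 * n) \<otimes> z [^] (s0 * n)" for n :: int
    using lattice_pow[OF h(1)] by (simp only: c_def)
  have Fix: "Fix G \<phi> = generate G {c}"
  proof
    show "generate G {c} \<subseteq> Fix G \<phi>"
      using c by (auto simp: generate_pow c_pow Fix_iff r0_def s0_def)
    show "Fix G \<phi> \<subseteq> generate G {c}"
    proof
      fix k assume k: "k \<in> Fix G \<phi>"
      then have "k \<in> lattice h" using Fix_subset_centralizer C by blast
      then obtain r s :: int where rs: "k = h [^] r \<otimes> z [^] s" by (auto simp: lattice_def)
      then have eq: "i * r = 2 * s" using k Fix_iff by blast
      have "\<exists>n. r = r0 * n \<and> s = s0 * n"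
      proof (cases "even i")
        case True
        then show ?thesis using eq by (intro exI[of _ r]) (auto simp: r0_def s0_def)
      next
        case False
        then have "even r" using eq by (metis dvd_triv_left even_mult_iff)
        then show ?thesis using False eq by (intro exI[of _ "r div 2"]) (auto simp: r0_def s0_def)
      qed
      then show "k \<in> generate G {c}" using c rs c_pow by (auto simp: generate_pow)
    qed
  qed
  have "n = 0" if "c [^] n = \<one>" for n :: int
  proof -
    have "h [^] (r0 * n) \<otimes> z [^] (s0 * n) = h [^] (0::int) \<otimes> z [^] (0::int)" using that c_pow[of n] by simp
    then have "r0 * n = 0" using lattice_unique[OF h] by blast
    then show ?thesis by (simp add: r0_def split: if_splits)
  qed
  then have iso: "subgroup_iso G (Fix G \<phi>) integer_group" using cyclic_iso_integers[OF c] Fix by simp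
  obtain k where "k \<in> carrier G" "k \<otimes> a \<noteq> a \<otimes> k" using loxodromic_not_central[OF a_closed lox] .
  then have "a \<in> carrier G - center G" by (auto simp: center_def)
  moreover have "is_max_cyclic G a (Fix G \<phi>)"
    unfolding is_max_cyclic_def
  proof (intro conjI allI impI)
    show "cyclic_subgroup G (Fix G \<phi>)" using Fix c by (auto simp: cyclic_subgroup_def)
    show "a \<in> Fix G \<phi>" using phi_a by (simp add: Fix_def)
    fix D assume "cyclic_subgroup G D \<and> a \<in> D"
    then obtain d where d: "d \<in> carrier G" "D = generate G {d}" "a \<in> generate G {d}"
      by (auto simp: cyclic_subgroup_def)
    then obtain n :: int where n: "a = d [^] n" by (auto simp: generate_pow)
    have "d \<otimes> a = a \<otimes> d"
      using int_pow_mult[OF d(1), of 1 n] int_pow_mult[OF d(1), of n 1] d(1) by (simp add: n add.commute)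
    then have "d \<in> lattice h" using C d(1) by (auto simp: centralizer_def)
    then obtain r s :: int where rs: "d = h [^] r \<otimes> z [^] s" by (auto simp: lattice_def)
    have "\<phi> a = \<phi> d [^] n" using n d(1) \<phi>.hom_int_pow by simp
    then have "(h [^] r \<otimes> z [^] (i * r + \<epsilon> * s)) [^] n = (h [^] r \<otimes> z [^] s) [^] n"
      using phi_a n phi[of r s] rs by simp
    then have "(i * r + \<epsilon> * s) * n = s * n"
      unfolding lattice_pow[OF h(1)] using lattice_unique[OF h] by blast
    moreover have "n \<noteq> 0"
    proof
      assume "n = 0"
      then have "a = \<one>" using n by simp
      then show False using lox axial_one by (auto simp: loxodromic_def)
    qed
    ultimately have "d \<in> Fix G \<phi>" unfolding rs Fix_iff eps by auto
    then have "{d} \<subseteq> generate G {c}" using Fix by simp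
    then show "D \<subseteq> Fix G \<phi>"
      unfolding d(2) Fix using c by (intro generate_subgroup_incl generate_is_subgroup) auto
  qed
  ultimately show "a \<in> carrier G - center G \<and> is_max_cyclic G a (Fix G \<phi>)
      \<and> subgroup_iso G (Fix G \<phi>) integer_group" using iso by blast
qed

end

fun other :: "gen \<Rightarrow> gen" where
  "other Gen_x = Gen_y"
| "other Gen_y = Gen_x"

lemma other_neq: "other c \<noteq> c" and other_inject: "other c = other d \<longleftrightarrow> c = d"
  by (cases c; cases d; simp)+

lemma (in amalgam) map_hom:
  assumes range: "\<And>i. 0 < i \<Longrightarrow> i < p \<Longrightarrow> 0 < k i \<and> k i < p"
    and cancel: "\<And>i j. 0 < i \<Longrightarrow> i < p \<Longrightarrow> 0 < j \<Longrightarrow> j < p \<Longrightarrow> k i + k j = p \<longleftrightarrow> i + j = p"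
    and merge: "\<And>i j. 0 < i \<Longrightarrow> i < p \<Longrightarrow> 0 < j \<Longrightarrow> j < p \<Longrightarrow> i + j \<noteq> p \<Longrightarrow> k ((i + j) mod p) = (k i + k j) mod p"
  shows "map (map_prod other k) \<in> hom F F"
proof -
  let ?f = "map_prod other k"
  have red: "reduced p (map ?f w)" if "reduced p w" for w
    using that by (induction w) (auto simp: reduced_Cons range other_inject hd_map)
  have mult: "map ?f (syl_mult p s w) = syl_mult p (?f s) (map ?f w)" if "reduced p [s]" "reduced p w" for s w
    using that by (cases "(p, s, w)" rule: syl_mult.cases)
      (auto simp: reduced_Cons cancel merge other_inject)
  have "map ?f (foldr (syl_mult p) u v) = foldr (syl_mult p) (map ?f u) (map ?f v)"
    if "reduced p u" "reduced p v" for u v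
    using that(1)
  proof (induction u)
    case (Cons s u)
    then have "reduced p [s]" "reduced p u" by (auto simp: reduced_Cons)
    then show ?case using Cons mult[of s "foldr (syl_mult p) u v"] reduced_mult[of p u v] that(2) by simp
  qed simp
  then show ?thesis by (intro homI) (simp_all add: red Q.mult_eq)
qed

lemma (in group) compose_auto:
  "\<alpha> \<in> auto G \<Longrightarrow> \<beta> \<in> auto G \<Longrightarrow> compose (carrier G) \<alpha> \<beta> \<in> auto G"
  using group.is_monoid[OF AutoGroup] monoid.m_closed[of "AutoGroup G" \<alpha> \<beta>]
  by (simp add: AutoGroup_mult carrier_AutoGroup)

lemma (in amalgam) sigma_twisted_conjugation:
  assumes "g \<in> carrier G"
  shows "twisted_conjugation p G (sigma p) (map_prod other (\<lambda>i. i)) 1 g"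
proof
  have e: "sigma p (e c) = e (other c)" for c
    using sigma_spec(2,3)[of p] by (cases c) (simp_all add: gx_gen_elt gy_gen_elt)
  show auto: "sigma p \<in> auto G" unfolding G_def by (rule sigma_spec)
  interpret s: group_hom G G "sigma p"
    using auto by (intro group_hom.intro group_hom_axioms.intro is_group) (simp add: auto_def)
  show "sigma p (sigma p (e c)) = e c" for c by (cases c) (simp_all add: e)
  show "nf (sigma p (e c)) = [map_prod other (\<lambda>i. i) (c, 1)]" for c by (simp add: e)
  have "sigma p z = e Gen_y [^] p" by (simp add: s.hom_nat_pow gx_gen_elt e)
  then show "sigma p z = z [^] (1::int)" using e_pow_p[of Gen_y] by simp
  show "map (map_prod other (\<lambda>i. i)) \<in> hom F F" by (rule map_hom) auto
  show "fst (map_prod other (\<lambda>i. i) s) \<noteq> fst s" for s :: syllable using other_neq by (cases s) auto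
  show "g \<in> carrier G" by fact
qed

lemma (in amalgam) sigma_tau_twisted_conjugation:
  assumes "g \<in> carrier G"
  shows "twisted_conjugation p G (compose (carrier G) (sigma p) (tau p)) (map_prod other (\<lambda>i. p - i)) (- 1) g"
proof
  let ?t = "compose (carrier G) (sigma p) (tau p)"
  have s_auto: "sigma p \<in> auto G" and t_auto: "tau p \<in> auto G"
    unfolding G_def by (rule sigma_spec tau_spec)+
  then show auto: "?t \<in> auto G" by (rule compose_auto)
  interpret s: group_hom G G "sigma p"
    using s_auto by (intro group_hom.intro group_hom_axioms.intro is_group) (simp add: auto_def)
  interpret t: group_hom G G ?t
    using auto by (intro group_hom.intro group_hom_axioms.intro is_group) (simp add: auto_def)
  have "sigma p (e c) = e (other c)" for c
    using sigma_spec(2,3)[of p] by (cases c) (simp_all add: gx_gen_elt gy_gen_elt)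
  moreover have "tau p (e c) = inv (e c)" for c
    using tau_spec(2,3)[of p] by (cases c) (simp_all add: gx_gen_elt gy_gen_elt G_def)
  ultimately have e: "?t (e c) = inv (e (other c))" for c by (simp add: compose_def)
  show "?t (?t (e c)) = e c" for c by (cases c) (simp_all add: e)
  show "nf (?t (e c)) = [map_prod other (\<lambda>i. p - i) (c, 1)]" for c
    using p2 by (simp add: e Q.inv_eq)
  have "?t z = (inv (e Gen_y)) [^] p" by (simp add: t.hom_nat_pow gx_gen_elt e)
  also have "\<dots> = inv z" using nat_pow_inv[of "e Gen_y" p] e_pow_p[of Gen_y] by simp
  finally show "?t z = z [^] (- 1::int)" by (simp add: int_pow_neg)
  show "map (map_prod other (\<lambda>i. p - i)) \<in> hom F F"
  proof (rule map_hom)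
    fix i j :: nat assume ij: "0 < i" "i < p" "0 < j" "j < p"
    then show "p - i + (p - j) = p \<longleftrightarrow> i + j = p" by auto
    assume "i + j \<noteq> p"
    then show "p - (i + j) mod p = (p - i + (p - j)) mod p"
      using ij mod_below_double[of "i + j" p] mod_below_double[of "p - i + (p - j)" p] by auto
  qed auto
  show "fst (map_prod other (\<lambda>i. p - i) s) \<noteq> fst s" for s :: syllable using other_neq by (cases s) auto
  show "g \<in> carrier G" by fact
qed

theorem theorem1p2:
  fixes p :: nat and g :: "gen word set"
  assumes "p \<ge> 2" and "g \<in> carrier (Gpp p)"
  shows
    "let G = Gpp p;
         xp = gx p [^]\<^bsub>G\<^esub> p;
         \<phi> = compose (carrier G) (inner_aut G g) (sigma p);
         \<psi> = compose (carrier G) (inner_aut G g) (compose (carrier G) (sigma p) (tau p));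
         a = g \<otimes>\<^bsub>G\<^esub> sigma p g;
         b = g \<otimes>\<^bsub>G\<^esub> sigma p (tau p g)
     in
       (has_finite_order (AutoGroup G) \<phi> \<longrightarrow>
          Fix G \<phi> = generate G {xp} \<and> subgroup_iso G (Fix G \<phi>) integer_group)
     \<and> (\<not> has_finite_order (AutoGroup G) \<phi> \<longrightarrow>
          Fix G \<phi> = centralizer G a
        \<and> subgroup_iso G (Fix G \<phi>) (integer_group \<times>\<times> integer_group)
        \<and> hyperbolic p a
        \<and> (\<exists>h. min_translation_along p a h)
        \<and> (\<forall>h. min_translation_along p a h \<longrightarrow> Fix G \<phi> = generate G {xp, h}))
     \<and> (has_finite_order (AutoGroup G) \<psi> \<longrightarrow>
          Fix G \<psi> = {\<one>\<^bsub>G\<^esub>})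
     \<and> (\<not> has_finite_order (AutoGroup G) \<psi> \<longrightarrow>
          b \<in> carrier G - center G
        \<and> is_max_cyclic G b (Fix G \<psi>)
        \<and> subgroup_iso G (Fix G \<psi>) integer_group)"
proof -
  interpret amalgam p "Gpp p" by unfold_locales (use assms(1) in simp_all)
  interpret \<sigma>: twisted_conjugation p "Gpp p" "sigma p" "map_prod other (\<lambda>i. i)" 1 g
    by (rule sigma_twisted_conjugation[OF assms(2)])
  interpret \<sigma>\<tau>: twisted_conjugation p "Gpp p" "compose (carrier (Gpp p)) (sigma p) (tau p)"
      "map_prod other (\<lambda>i. p - i)" "- 1" g
    by (rule sigma_tau_twisted_conjugation[OF assms(2)])
  have b: "\<sigma>\<tau>.a = g \<otimes>\<^bsub>Gpp p\<^esub> sigma p (tau p g)"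
    unfolding \<sigma>\<tau>.a_def using assms(2) by (simp add: compose_def)
  show ?thesis
    unfolding Let_def \<sigma>.\<phi>_def[symmetric] \<sigma>\<tau>.\<phi>_def[symmetric] \<sigma>.a_def[symmetric] b[symmetric]
      \<sigma>.finite_order_iff \<sigma>\<tau>.finite_order_iff
      not_not
    using \<sigma>.Fix_if_center_fixed[OF refl] \<sigma>\<tau>.Fix_if_center_inverted[OF refl] by blast
qed

end
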